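(* Let $\mathbb D$ be the Poincaré disk and let $f\in C_c^\infty(\mathbb D)$ be a compactly supported smooth function. Then for every $z\in\mathbb C$ with $\operatorname{Re}(z)>0$, $$\bigl(\Delta-z(z+1)\bigr)\,S^{(z)}\,\Pi_0^{(z)}f=-8\pi^2 f ,$$ where $$\Pi_0^{(z)}h(x)=\int_{S_x\mathbb D}\int_{\mathbb R}e^{-z|t|}h(\gamma_{x,v}(t))\,dt\,dS_x(v),\qquad S^{(z)}h(x)=\int_{S_x\mathbb D}\int_0^\infty e^{-(z+1)t}h(\gamma_{x,v}(t))\,dt\,dS_x(v).$$
   Context: $\mathbb D=\{w\in\mathbb C:|w|<1\}$ carries the metric $4|dw|^2/(1-|w|^2)^2$ of constant Gaussian curvature $-1$. $\Delta$ is its Laplace–Beltrami operator with sign convention $\Delta=\operatorname{div}\operatorname{grad}$. $S_x\mathbb D$ is the circle of unit tangent vectors at $x$, with standard length measure $dS_x$ (total mass $2\pi$), and $\gamma_{x,v}$ is the unit-speed geodesic with $\gamma_{x,v}(0)=x$, $\dot\gamma_{x,v}(0)=v$. *)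

theory Defs
  imports "HOL-Analysis.Analysis"
begin

section \<open>The Poincare disk\<close>

definition disk :: "complex set" where
  "disk = ball 0 1"

text \<open>All tangent spaces are identified with \<^typ>\<open>complex\<close>; note that the real inner product of
  complex numbers is $\mathrm{Re}(v \bar w)$.\<close>

definition metric :: "complex \<Rightarrow> complex \<Rightarrow> complex \<Rightarrow> real" where
  "metric x v w = 4 * (v \<bullet> w) / (1 - (norm x)\<^sup>2)\<^sup>2"

definition volume_density :: "complex \<Rightarrow> real" where
  "volume_density x =
     sqrt (metric x 1 1 * metric x \<i> \<i> - (metric x 1 \<i>)\<^sup>2)"


section \<open>Smooth functions\<close>

primrec Ck_on :: "nat \<Rightarrow> ('a::real_normed_vector \<Rightarrow> 'b::real_normed_vector) \<Rightarrow> 'a set \<Rightarrow> bool" where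
  "Ck_on 0 f U \<longleftrightarrow> continuous_on U f"
| "Ck_on (Suc k) f U \<longleftrightarrow>
     (\<forall>x\<in>U. f differentiable (at x)) \<and>
     (\<forall>v. Ck_on k (\<lambda>x. frechet_derivative f (at x) v) U)"

text \<open>Functions on the disk are represented by total functions on \<^typ>\<open>complex\<close> whose values
  outside the disk are irrelevant.  The support is taken relative to the disk, so its compactness
  keeps it away from the boundary circle.\<close>

definition Cc_infinity :: "(complex \<Rightarrow> complex) \<Rightarrow> bool" where
  "Cc_infinity f \<longleftrightarrow>
     (\<forall>k. Ck_on k f disk) \<and> compact (disk \<inter> closure {x \<in> disk. f x \<noteq> 0})"


section \<open>The Laplace-Beltrami operator\<close>

definition grad :: "(complex \<Rightarrow> real) \<Rightarrow> complex \<Rightarrow> complex" where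
  "grad u x = (THE G. \<forall>w. metric x G w = frechet_derivative u (at x) w)"

definition divergence :: "(complex \<Rightarrow> complex) \<Rightarrow> complex \<Rightarrow> real" where
  "divergence X x =
     (\<Sum>b\<in>Basis. frechet_derivative (\<lambda>y. volume_density y *\<^sub>R X y) (at x) b \<bullet> b)
       / volume_density x"

definition laplace_beltrami_real :: "(complex \<Rightarrow> real) \<Rightarrow> complex \<Rightarrow> real" where
  "laplace_beltrami_real u = divergence (grad u)"

definition laplace_beltrami :: "(complex \<Rightarrow> complex) \<Rightarrow> complex \<Rightarrow> complex" where
  "laplace_beltrami u x =
     Complex (laplace_beltrami_real (\<lambda>y. Re (u y)) x) (laplace_beltrami_real (\<lambda>y. Im (u y)) x)"


section \<open>Geodesics\<close>

text \<open>Christoffel symbols of the first kind, by the Koszul formula for constant vector fields: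
  this is the inner product of $\nabla_u v$ with $w$ at $x$.\<close>

definition christoffel :: "complex \<Rightarrow> complex \<Rightarrow> complex \<Rightarrow> complex \<Rightarrow> real" where
  "christoffel x u v w =
     (frechet_derivative (\<lambda>y. metric y v w) (at x) u
      + frechet_derivative (\<lambda>y. metric y u w) (at x) v
      - frechet_derivative (\<lambda>y. metric y u v) (at x) w) / 2"

text \<open>The last conjunct says that the covariant acceleration $\nabla_{\dot\gamma}\dot\gamma$
  is orthogonal to every \<open>w\<close>, hence zero.\<close>

definition is_geodesic :: "(real \<Rightarrow> complex) \<Rightarrow> bool" where
  "is_geodesic \<gamma> \<longleftrightarrow>
     (\<exists>\<gamma>' \<gamma>''. \<forall>t.
        \<gamma> t \<in> disk \<and>
        (\<gamma> has_vector_derivative \<gamma>' t) (at t) \<and>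
        (\<gamma>' has_vector_derivative \<gamma>'' t) (at t) \<and>
        (\<forall>w. metric (\<gamma> t) (\<gamma>'' t) w + christoffel (\<gamma> t) (\<gamma>' t) (\<gamma>' t) w = 0))"

text \<open>Geodesics have constant speed, so this has unit speed whenever \<open>v\<close> is a unit tangent
  vector at \<open>x\<close>.\<close>

definition geodesic :: "complex \<Rightarrow> complex \<Rightarrow> real \<Rightarrow> complex" where
  "geodesic x v =
     (THE \<gamma>. is_geodesic \<gamma> \<and> \<gamma> 0 = x \<and> (\<gamma> has_vector_derivative v) (at 0))"


section \<open>Unit tangent circles\<close>

definition unit_tangents :: "complex \<Rightarrow> complex set" where
  "unit_tangents x = {v. metric x v v = 1}"

text \<open>The length measure of the unit tangent circle at \<open>x\<close>, which is a Euclidean circle of radius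
  $(1-|x|^2)/2$, is the image of Lebesgue measure on $[0,2\pi)$ under the parametrisation below,
  whose speed with respect to \<open>metric x\<close> is one.\<close>

definition tangent_circle :: "complex \<Rightarrow> complex measure" where
  "tangent_circle x =
     distr (restrict_space lborel {0..<2*pi}) (restrict_space borel (unit_tangents x))
       (\<lambda>\<theta>. of_real ((1 - (norm x)\<^sup>2) / 2) * cis \<theta>)"

lemma space_tangent_circle [simp]: "space (tangent_circle x) = unit_tangents x"
  by (simp add: tangent_circle_def space_restrict_space)

lemma unit_tangents_param:
  assumes "x \<in> disk"
  shows "of_real ((1 - (norm x)\<^sup>2) / 2) * cis \<theta> \<in> unit_tangents x"
proof -
  have "norm x < 1" using assms by (simp add: disk_def)
  hence "(norm x)\<^sup>2 < 1" by (simp add: power_less_one_iff abs_square_less_1)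
  thus ?thesis
    by (simp add: unit_tangents_def metric_def dot_square_norm norm_mult power_mult_distrib
        power_divide del: of_real_divide of_real_diff of_real_power)
qed

lemma emeasure_tangent_circle:
  assumes "x \<in> disk"
  shows "emeasure (tangent_circle x) (unit_tangents x) = ennreal (2 * pi)"
proof -
  let ?p = "\<lambda>\<theta>. of_real ((1 - (norm x)\<^sup>2) / 2) * cis \<theta> :: complex"
  have "continuous_on UNIV ?p" by (intro continuous_intros)
  hence "?p \<in> borel_measurable (restrict_space lborel {0..<2*pi})"
    by (auto intro!: measurable_restrict_space1 borel_measurable_continuous_onI)
  hence m: "?p \<in> measurable (restrict_space lborel {0..<2*pi})
                 (restrict_space borel (unit_tangents x))"
    using unit_tangents_param[OF assms]
    by (intro measurable_restrict_space2) auto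
  have "?p -` unit_tangents x \<inter> space (restrict_space lborel {0..<2*pi}) = {0..<2*pi}"
    using unit_tangents_param[OF assms] by (auto simp: space_restrict_space)
  moreover have "unit_tangents x \<in> sets (restrict_space borel (unit_tangents x))"
    using sets.top[of "restrict_space borel (unit_tangents x)"]
    by (simp add: space_restrict_space)
  ultimately show ?thesis
    using m by (simp add: tangent_circle_def emeasure_distr emeasure_restrict_space)
qed


section \<open>The operators\<close>

definition Pi0_integrand :: "complex \<Rightarrow> (complex \<Rightarrow> complex) \<Rightarrow> complex \<Rightarrow> complex \<Rightarrow> real \<Rightarrow> complex" where
  "Pi0_integrand z h x v t = exp (- z * of_real \<bar>t\<bar>) * h (geodesic x v t)"

definition S_integrand :: "complex \<Rightarrow> (complex \<Rightarrow> complex) \<Rightarrow> complex \<Rightarrow> complex \<Rightarrow> real \<Rightarrow> complex" where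
  "S_integrand z h x v t = exp (- (z + 1) * of_real t) * h (geodesic x v t)"

definition Pi0 :: "complex \<Rightarrow> (complex \<Rightarrow> complex) \<Rightarrow> complex \<Rightarrow> complex" where
  "Pi0 z h x = (LINT v|tangent_circle x. LINT t|lborel. Pi0_integrand z h x v t)"

definition S_op :: "complex \<Rightarrow> (complex \<Rightarrow> complex) \<Rightarrow> complex \<Rightarrow> complex" where
  "S_op z h x = (LINT v|tangent_circle x. (LINT t:{0..}|lborel. S_integrand z h x v t))"

text \<open>Absolute convergence of the double integrals.\<close>

definition Pi0_converges :: "complex \<Rightarrow> (complex \<Rightarrow> complex) \<Rightarrow> complex \<Rightarrow> bool" where
  "Pi0_converges z h x \<longleftrightarrow>
     integrable (tangent_circle x \<Otimes>\<^sub>M lborel) (\<lambda>(v, t). Pi0_integrand z h x v t)"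

definition S_converges :: "complex \<Rightarrow> (complex \<Rightarrow> complex) \<Rightarrow> complex \<Rightarrow> bool" where
  "S_converges z h x \<longleftrightarrow>
     set_integrable (tangent_circle x \<Otimes>\<^sub>M lborel) (unit_tangents x \<times> {0..})
       (\<lambda>(v, t). S_integrand z h x v t)"

end

theory Submission
  imports Defs
begin

text \<open>
  Write $A(z) h(x)$ for the integral of $e^{-zt} h(\gamma(t))$ over $t \geq 0$ and over the unit speed
  geodesics $\gamma$ starting at $x$, so that $\Pi_0^{(z)} = 2 A(z)$ and $S^{(z)} = A(z+1)$.
  Integrating the radial part $\partial_t (\sinh t \, \partial_t)$ of the Laplacian by parts against
  $e^{-(z+1)t}$ gives $A(z)(z(z+1) - \Delta) f = A(z+2)((z+1)(z+2) - \Delta) f$.  The operators $A(z)$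
  commute with each other, hence $Q(z) = A(z+1) A(z) (z(z+1) - \Delta) f$ satisfies
  $Q(z) = Q(z+1)$.  Since $z A(z) f$ tends to $2 \pi f$ as $\mathrm{Re}\, z$ tends to infinity,
  $Q = 4 \pi^2 f$.  It remains to know that $A(z+1) A(z) f$ is twice differentiable and that $\Delta$ commutes
  with it; for this $A(z+1) A(z) f(x)$ is written as an average of $f(g_x(y))$ over a fixed complex
  measure in $y$, where $g_x$ is the Moebius transformation below, whose $x$-derivatives are bounded
  uniformly in $y$.
\<close>

section \<open>Moebius isometries and the Euclidean radius of a hyperbolic distance\<close>

definition mob :: "complex \<Rightarrow> complex \<Rightarrow> complex" where
  "mob x y = (x + y) / (1 + cnj x * y)"

lemma in_disk_iff: "x \<in> disk \<longleftrightarrow> norm x < 1"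
  by (simp add: disk_def)

lemma open_disk: "open disk"
  by (simp add: disk_def)

lemma one_minus_norm_sq_pos: "x \<in> disk \<Longrightarrow> 0 < 1 - (norm x)\<^sup>2"
  by (simp add: in_disk_iff abs_square_less_1)

lemma norm_mult_less_1:
  fixes a b :: complex
  assumes "norm a < 1" "norm b \<le> 1"
  shows "norm (a * b) < 1"
proof -
  have "norm a * norm b \<le> norm a"
    using assms by (simp add: mult_left_le)
  thus ?thesis using assms by (simp add: norm_mult)
qed

lemma mob_denom_nz: "x \<in> disk \<Longrightarrow> norm y \<le> 1 \<Longrightarrow> 1 + cnj x * y \<noteq> 0"
  using norm_mult_less_1[of "cnj x" y]
  by (metis add_eq_0_iff complex_mod_cnj in_disk_iff less_irrefl norm_minus_cancel norm_one)

text \<open>Together with \<open>has_field_derivative_mob\<close> this says that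
  \<open>mob x\<close> is an isometry, since the length element is 2 |dw| / (1 - |w|^2). It also
  yields that the disk is preserved, as all factors on the right are positive.\<close>

lemma one_minus_mob:
  assumes "1 + cnj x * y \<noteq> 0"
  shows "1 - (norm (mob x y))\<^sup>2 = (1 - (norm x)\<^sup>2) * (1 - (norm y)\<^sup>2) / (norm (1 + cnj x * y))\<^sup>2"
proof -
  have nz: "(norm (1 + cnj x * y))\<^sup>2 \<noteq> 0" using assms by simp
  have "(norm (1 + cnj x * y))\<^sup>2 - (norm (x + y))\<^sup>2 = (1 - (norm x)\<^sup>2) * (1 - (norm y)\<^sup>2)"
    unfolding cmod_power2 by simp algebra
  moreover have "1 - (norm (mob x y))\<^sup>2 =
     ((norm (1 + cnj x * y))\<^sup>2 - (norm (x + y))\<^sup>2) / (norm (1 + cnj x * y))\<^sup>2"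
    using nz by (simp add: mob_def norm_divide power_divide diff_divide_distrib)
  ultimately show ?thesis by simp
qed

lemma mob_in_disk:
  assumes "x \<in> disk" "y \<in> disk"
  shows "mob x y \<in> disk"
proof -
  have nz: "1 + cnj x * y \<noteq> 0" using mob_denom_nz assms by (simp add: in_disk_iff)
  have "1 - (norm (mob x y))\<^sup>2 > 0"
    using one_minus_mob[OF nz] nz one_minus_norm_sq_pos[OF assms(1)] one_minus_norm_sq_pos[OF assms(2)]
    by simp
  thus ?thesis by (simp add: in_disk_iff abs_square_less_1)
qed

text \<open>The length element 2 |dw| / (1 - |w|^2) puts the points at distance t from 0 at
  Euclidean radius tanh (t/2). Since \<open>tau\<close> is odd, negative times need no separate
  formula.\<close>

definition tau :: "real \<Rightarrow> real" where
  "tau t = tanh (t / 2)"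

lemma tau_0 [simp]: "tau 0 = 0" by (simp add: tau_def)

lemma tau_minus: "tau (- t) = - tau t" by (simp add: tau_def)

lemma abs_tau: "\<bar>tau t\<bar> < 1"
  using tanh_real_bounds[of "t/2"] by (auto simp: tau_def abs_less_iff)

lemma tau_sq: "1 - (tau t)\<^sup>2 > 0"
  using abs_tau[of t] by (simp add: abs_square_less_1)

lemma has_field_derivative_tau:
  "(tau has_field_derivative (1 - (tau t)\<^sup>2) / 2) (at t)"
  unfolding tau_def by (auto intro!: derivative_eq_intros simp: cosh_real_pos[THEN less_imp_neq, symmetric])

lemma has_vector_derivative_of_real_tau:
  "((\<lambda>t. complex_of_real (tau t)) has_vector_derivative of_real ((1 - (tau t)\<^sup>2) / 2)) (at t)"
  using has_field_derivative_tau[of t]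
  by (intro has_vector_derivative_of_real) (simp add: has_real_derivative_iff_has_vector_derivative)

lemma has_vector_derivative_cis:
  "(cis has_vector_derivative \<i> * cis t) (at t)"
proof -
  have "((\<lambda>t. exp (\<i> * complex_of_real t)) has_vector_derivative \<i> * exp (\<i> * of_real t)) (at t)"
    by (rule has_vector_derivative_real_field) (auto intro!: derivative_eq_intros)
  thus ?thesis by (simp add: cis_conv_exp[abs_def])
qed

lemma continuous_on_tau [continuous_intros]:
  "continuous_on A g \<Longrightarrow> continuous_on A (\<lambda>x. tau (g x))"
  unfolding tau_def by (intro continuous_intros) auto

text \<open>A Euclidean circle of radius r about 0 has hyperbolic length 2 pi times 2 r / (1 - r^2);
  with r = \<open>tau t\<close> this is the weight sinh t of polar coordinates.\<close>

lemma sinh_tau: "sinh t = 2 * tau t / (1 - (tau t)\<^sup>2)"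
proof -
  have c: "cosh (t/2) \<noteq> 0" by simp
  have q: "1 - (tau t)\<^sup>2 = 1 / (cosh (t/2))\<^sup>2"
    using c cosh_square_eq[of "t/2"] sum_power2_eq_zero_iff[of "sinh (t/2)" 1]
    by (simp add: tau_def tanh_def power_divide divide_simps)
  moreover have "sinh t = 2 * sinh (t/2) * cosh (t/2)"
    using sinh_double[of "t/2"] by simp
  ultimately show ?thesis using c unfolding q
    by (simp add: tau_def tanh_def field_simps power2_eq_square)
qed

lemma tau_cis_in_disk: "norm e = 1 \<Longrightarrow> of_real (tau t) * e \<in> disk"
  using abs_tau by (simp add: in_disk_iff norm_mult)

section \<open>Geodesics\<close>

lemma metric_derivative:
  assumes "x \<in> disk"
  shows "frechet_derivative (\<lambda>y. metric y v w) (at x) u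
           = 16 * (v \<bullet> w) * (x \<bullet> u) / (1 - (norm x)\<^sup>2) ^ 3"
proof -
  have p: "1 - (norm x)\<^sup>2 > 0" using assms by (rule one_minus_norm_sq_pos)
  hence nz: "1 - x \<bullet> x \<noteq> 0" by (simp add: dot_square_norm)
  have "((\<lambda>y. metric y v w) has_derivative
      (\<lambda>u. 16 * (v \<bullet> w) * (x \<bullet> u) / (1 - (norm x)\<^sup>2) ^ 3)) (at x)"
    unfolding metric_def power2_norm_eq_inner
    apply (rule derivative_eq_intros refl | use nz in simp; fail)+
    apply (rule ext)
    apply (use nz in \<open>simp add: inner_commute divide_simps\<close>)
    apply algebra
    done
  from frechet_derivative_at[OF this] show ?thesis by metis
qed

text \<open>Translates between the complex form of the geodesic acceleration and the real inner
  products that the Koszul formula produces.\<close>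

lemma cnj_mult_sq:
  fixes x u :: complex
  shows "cnj x * u ^ 2 = of_real (2 * (x \<bullet> u)) * u - of_real (u \<bullet> u) * x"
  by (simp add: complex_eq_iff inner_complex_def algebra_simps power2_eq_square)

text \<open>For a conformal metric the Christoffel terms combine into a multiple of one complex
  square, and nondegeneracy of the inner product lets the equation be solved for
  \<open>a\<close>.\<close>

lemma geodesic_equation_iff:
  assumes "x \<in> disk"
  shows "(\<forall>w. metric x a w + christoffel x u u w = 0) \<longleftrightarrow>
     a = - (2 / (1 - (norm x)\<^sup>2)) *\<^sub>R (cnj x * u ^ 2)"
proof -
  define s where "s = 1 - (norm x)\<^sup>2"
  have s: "s > 0" using assms one_minus_norm_sq_pos s_def by simp
  have *: "metric x a w + christoffel x u u w
      = (4 / s\<^sup>2) * ((a + (2 / s) *\<^sub>R (cnj x * u ^ 2)) \<bullet> w)" for w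
  proof -
    have "(cnj x * u ^ 2) \<bullet> w = 2 * (x \<bullet> u) * (u \<bullet> w) - (u \<bullet> u) * (x \<bullet> w)"
      unfolding cnj_mult_sq by (simp add: inner_complex_def algebra_simps)
    moreover have "metric x a w = 4 * (a \<bullet> w) / s\<^sup>2" by (simp add: metric_def s_def)
    ultimately show ?thesis
      unfolding christoffel_def metric_derivative[OF assms] s_def[symmetric] inner_add_left inner_scaleR_left
      using s by (simp add: divide_simps) algebra
  qed
  have "(\<forall>w. metric x a w + christoffel x u u w = 0) \<longleftrightarrow> a + (2 / s) *\<^sub>R (cnj x * u ^ 2) = 0"
    unfolding * using s inner_eq_zero_iff[of "a + (2 / s) *\<^sub>R (cnj x * u ^ 2)"]
    by (auto simp del: inner_eq_zero_iff)
  thus ?thesis unfolding s_def[symmetric] by (simp add: add_eq_0_iff2)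
qed

text \<open>Factoring y'' - y shows that y + y' and y - y' solve first order equations, so after
  multiplication by exp (-t) and exp t they are constant.\<close>

lemma second_order_linear_unique:
  fixes y y' :: "real \<Rightarrow> 'a::real_normed_vector"
  assumes "\<And>t. (y has_vector_derivative y' t) (at t)"
    and "\<And>t. (y' has_vector_derivative y t) (at t)"
  shows "y t = cosh t *\<^sub>R y 0 + sinh t *\<^sub>R y' 0"
proof -
  have "((\<lambda>t. exp (-t) *\<^sub>R (y t + y' t)) has_vector_derivative 0) (at t within UNIV)" for t
    using assms by (auto intro!: derivative_eq_intros simp: has_real_derivative_iff_has_vector_derivative[symmetric] algebra_simps)
  hence 1: "exp (-t) *\<^sub>R (y t + y' t) = y 0 + y' 0"
    using has_vector_derivative_zero_constant[of UNIV "\<lambda>t. exp (-t) *\<^sub>R (y t + y' t)"]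
    by simp (metis exp_zero minus_zero scaleR_one)
  have "((\<lambda>t. exp t *\<^sub>R (y t - y' t)) has_vector_derivative 0) (at t within UNIV)" for t
    using assms by (auto intro!: derivative_eq_intros simp: has_real_derivative_iff_has_vector_derivative[symmetric] algebra_simps)
  hence 2: "exp t *\<^sub>R (y t - y' t) = y 0 - y' 0"
    using has_vector_derivative_zero_constant[of UNIV "\<lambda>t. exp t *\<^sub>R (y t - y' t)"]
    by simp (metis exp_zero scaleR_one)
  have 3: "y t + y' t = exp t *\<^sub>R (y 0 + y' 0)" unfolding 1[symmetric] by (simp flip: exp_add)
  have 4: "y t - y' t = exp (-t) *\<^sub>R (y 0 - y' 0)" unfolding 2[symmetric] by (simp flip: exp_add)
  have "2 *\<^sub>R y t = (y t + y' t) + (y t - y' t)" by (simp add: scaleR_2)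
  also have "\<dots> = 2 *\<^sub>R (cosh t *\<^sub>R y 0 + sinh t *\<^sub>R y' 0)"
    unfolding 3 4 by (simp add: cosh_def sinh_def algebra_simps)
  finally show ?thesis by simp
qed

lemma inner_of_real_mult_right:
  fixes a b :: complex
  shows "a \<bullet> (of_real r * b) = r * (a \<bullet> b)"
  by (simp add: inner_complex_def algebra_simps)

lemma has_vector_derivative_inner_eq:
  assumes "(f has_vector_derivative f') (at x)" "(g has_vector_derivative g') (at x)"
    and "f x \<bullet> g' + f' \<bullet> g x = d"
  shows "((\<lambda>x. f x \<bullet> g x) has_vector_derivative d) (at x)"
  using bounded_bilinear.has_vector_derivative[OF bounded_bilinear_inner assms(1,2)] assms(3) by simp

text \<open>Unit speed is given only at time 0, while the linear equation in hyperboloid coordinates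
  uses it at all times.\<close>

lemma geodesic_speed_constant:
  assumes g: "\<And>t. \<gamma> t \<in> disk" "\<And>t. (\<gamma> has_vector_derivative \<gamma>' t) (at t)"
    "\<And>t. (\<gamma>' has_vector_derivative - (2 / (1 - (norm (\<gamma> t))\<^sup>2)) *\<^sub>R (cnj (\<gamma> t) * \<gamma>' t ^ 2)) (at t)"
  shows "\<gamma>' t \<bullet> \<gamma>' t / (1 - \<gamma> t \<bullet> \<gamma> t)\<^sup>2 = \<gamma>' 0 \<bullet> \<gamma>' 0 / (1 - \<gamma> 0 \<bullet> \<gamma> 0)\<^sup>2"
proof -
  define s where "s t = 1 - \<gamma> t \<bullet> \<gamma> t" for t
  have s: "s t > 0" for t using one_minus_norm_sq_pos[OF g(1)] by (simp add: s_def dot_square_norm)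
  have s': "(s has_real_derivative - 2 * (\<gamma> t \<bullet> \<gamma>' t)) (at t)" for t
    unfolding s_def has_real_derivative_iff_has_vector_derivative
    by (rule derivative_eq_intros has_vector_derivative_inner_eq g refl)+ (simp add: inner_commute)
  define a where "a t = - (2 / s t) *\<^sub>R (of_real (2 * (\<gamma> t \<bullet> \<gamma>' t)) * \<gamma>' t - of_real (\<gamma>' t \<bullet> \<gamma>' t) * \<gamma> t)" for t
  have a: "(\<gamma>' has_vector_derivative a t) (at t)" for t
    using g(3)[of t] unfolding a_def s_def cnj_mult_sq by (simp add: dot_square_norm)
  have ga: "\<gamma>' t \<bullet> a t = - (2 / s t) * (2 * (\<gamma> t \<bullet> \<gamma>' t) * (\<gamma>' t \<bullet> \<gamma>' t) - (\<gamma>' t \<bullet> \<gamma>' t) * (\<gamma> t \<bullet> \<gamma>' t))" for t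
    by (simp only: a_def inner_scaleR_right inner_diff_right inner_of_real_mult_right inner_commute[of "\<gamma>' t" "\<gamma> t"])
  have e: "((\<lambda>t. \<gamma>' t \<bullet> \<gamma>' t) has_real_derivative - 4 * (\<gamma> t \<bullet> \<gamma>' t) * (\<gamma>' t \<bullet> \<gamma>' t) / s t) (at t)" for t
    unfolding has_real_derivative_iff_has_vector_derivative
    apply (rule derivative_eq_intros has_vector_derivative_inner_eq a refl)+
    unfolding inner_commute[of "a _"] ga
    using s[of t] by (simp add: field_simps)
  have "((\<lambda>t. \<gamma>' t \<bullet> \<gamma>' t / (s t)\<^sup>2) has_real_derivative 0) (at t within UNIV)" for t
    apply (rule derivative_eq_intros e s' refl)+
    using s[of t] apply simp
    using s[of t] apply (simp add: power2_eq_square)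
    done
  thus ?thesis using DERIV_isconst_all[of "\<lambda>t. \<gamma>' t \<bullet> \<gamma>' t / (s t)\<^sup>2"] unfolding s_def by simp
qed

text \<open>In hyperboloid coordinates $(1 + |\gamma|^2, 2 \gamma) / (1 - |\gamma|^2)$ the geodesic equation for
  unit speed becomes $y'' = y$; this is what makes geodesics unique.\<close>

lemma geodesic_linearisation:
  assumes g: "\<And>t. \<gamma> t \<in> disk" "\<And>t. (\<gamma> has_vector_derivative \<gamma>' t) (at t)"
    "\<And>t. (\<gamma>' has_vector_derivative - (2 / (1 - (norm (\<gamma> t))\<^sup>2)) *\<^sub>R (cnj (\<gamma> t) * \<gamma>' t ^ 2)) (at t)"
    and unit: "metric (\<gamma> 0) (\<gamma>' 0) (\<gamma>' 0) = 1"
  defines "s \<equiv> \<lambda>t. 1 - \<gamma> t \<bullet> \<gamma> t"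
  defines "a' \<equiv> \<lambda>t. 2 * (\<gamma> t \<bullet> \<gamma>' t) / (s t)\<^sup>2"
  shows "2 / s t - 1 = cosh t * (2 / s 0 - 1) + sinh t * (2 * a' 0)" (is ?A)
    and "\<gamma> t /\<^sub>R s t = cosh t *\<^sub>R (\<gamma> 0 /\<^sub>R s 0) + sinh t *\<^sub>R (\<gamma>' 0 /\<^sub>R s 0 + a' 0 *\<^sub>R \<gamma> 0)" (is ?B)
proof -
  have s: "s t > 0" for t using one_minus_norm_sq_pos[OF g(1)] by (simp add: s_def dot_square_norm)
  have s': "(s has_real_derivative - 2 * (\<gamma> t \<bullet> \<gamma>' t)) (at t)" for t
    unfolding s_def has_real_derivative_iff_has_vector_derivative
    by (rule derivative_eq_intros has_vector_derivative_inner_eq g refl)+ (simp add: inner_commute)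
  define c where "c t = - (2 / s t) *\<^sub>R (of_real (2 * (\<gamma> t \<bullet> \<gamma>' t)) * \<gamma>' t - of_real (\<gamma>' t \<bullet> \<gamma>' t) * \<gamma> t)" for t
  have c: "(\<gamma>' has_vector_derivative c t) (at t)" for t
    using g(3)[of t] unfolding c_def s_def cnj_mult_sq by (simp add: dot_square_norm)
  have E: "\<gamma>' t \<bullet> \<gamma>' t = (s t)\<^sup>2 / 4" for t
  proof -
    have "\<gamma>' 0 \<bullet> \<gamma>' 0 / (s 0)\<^sup>2 = 1 / 4"
      using unit unfolding metric_def s_def power2_norm_eq_inner by linarith
    hence "\<gamma>' t \<bullet> \<gamma>' t / (s t)\<^sup>2 = 1 / 4"
      using geodesic_speed_constant[OF g(1-3), of t] unfolding s_def by (rule trans[rotated])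
    thus ?thesis using s[of t] by (simp add: divide_simps)
  qed
  \<comment> \<open>\<open>2 / s t - 1\<close> is the time coordinate (1 + |\<gamma>|^2) / (1 -
    |\<gamma>|^2) of the hyperboloid, \<open>\<gamma> t /\<^sub>R s t\<close> is half of the space
    coordinate, and \<open>a'\<close> is the derivative of 1 / s.\<close>
  have d1: "((\<lambda>t. 2 / s t - 1) has_real_derivative 2 * a' t) (at t)" for t
    apply (rule derivative_eq_intros s' refl)+
    using s[of t] by (auto simp: a'_def power2_eq_square)
  have gs: "\<gamma> t \<bullet> \<gamma> t = 1 - s t" for t by (simp add: s_def)
  have gc: "\<gamma> t \<bullet> c t = - (2 / s t) * (2 * (\<gamma> t \<bullet> \<gamma>' t)\<^sup>2 - (s t)\<^sup>2 / 4 * (1 - s t))" for t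
    by (simp only: c_def E gs inner_scaleR_right inner_diff_right inner_of_real_mult_right power2_eq_square mult.assoc)
  have gp: "((\<lambda>t. \<gamma> t \<bullet> \<gamma>' t) has_real_derivative (\<gamma> t \<bullet> c t + \<gamma>' t \<bullet> \<gamma>' t)) (at t)" for t
    unfolding has_real_derivative_iff_has_vector_derivative
    by (rule has_vector_derivative_inner_eq[OF g(2) c refl])
  have d2': "(a' has_real_derivative (2 / s t - 1) / 2) (at t)" for t
    unfolding a'_def
    apply (rule derivative_eq_intros gp s' refl | use s[of t] in \<open>simp; fail\<close>)+
    using s[of t] apply (simp add: E gc divide_simps)
    apply algebra
    done
  have d2: "((\<lambda>t. 2 * a' t) has_real_derivative 2 / s t - 1) (at t)" for t
    by (rule derivative_eq_intros d2' refl)+ simp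
  show ?A
    using second_order_linear_unique[of "\<lambda>t. 2 / s t - 1" "\<lambda>t. 2 * a' t" t] d1 d2
    by (simp add: has_real_derivative_iff_has_vector_derivative)
  have i: "((\<lambda>t. inverse (s t)) has_real_derivative a' t) (at t)" for t
    apply (rule derivative_eq_intros s' refl)+
    using s[of t] by (auto simp: a'_def power2_eq_square field_simps)
  have b1: "((\<lambda>t. \<gamma> t /\<^sub>R s t) has_vector_derivative (\<gamma>' t /\<^sub>R s t + a' t *\<^sub>R \<gamma> t)) (at t)" for t
    using has_vector_derivative_scaleR[OF i g(2)] by simp
  have b2: "((\<lambda>t. \<gamma>' t /\<^sub>R s t + a' t *\<^sub>R \<gamma> t) has_vector_derivative \<gamma> t /\<^sub>R s t) (at t)" for t
  proof -
    have "\<gamma>' t \<bullet> \<gamma>' t = (s t)\<^sup>2 / 4" by (rule E)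
    hence "(c t /\<^sub>R s t + a' t *\<^sub>R \<gamma>' t) + (a' t *\<^sub>R \<gamma>' t + ((2 / s t - 1) / 2) *\<^sub>R \<gamma> t) = \<gamma> t /\<^sub>R s t"
      using s[of t] unfolding c_def E a'_def complex_eq_iff
      by (simp add: divide_simps) (intro conjI; algebra)
    thus ?thesis
      using has_vector_derivative_add[OF has_vector_derivative_scaleR[OF i[of t] c[of t]]
          has_vector_derivative_scaleR[OF d2'[of t] g(2)[of t]]]
      by (simp only:)
  qed
  show ?B by (rule second_order_linear_unique[OF b1 b2])
qed

text \<open>Equal initial data give equal hyperboloid coordinates; the time coordinate determines 1
  - |\<gamma>|^2, and then the space coordinate determines \<gamma>. This settles the uniqueness
  half of the definite description in \<open>geodesic\<close>.\<close>

lemma geodesic_unique: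
  assumes "is_geodesic \<gamma>1" "\<gamma>1 0 = x" "(\<gamma>1 has_vector_derivative v) (at 0)"
    and "is_geodesic \<gamma>2" "\<gamma>2 0 = x" "(\<gamma>2 has_vector_derivative v) (at 0)"
    and "metric x v v = 1"
  shows "\<gamma>1 = \<gamma>2"
proof
  fix t
  obtain g1 h1 where 1: "\<And>t. \<gamma>1 t \<in> disk" "\<And>t. (\<gamma>1 has_vector_derivative g1 t) (at t)"
    "\<And>t. (g1 has_vector_derivative h1 t) (at t)"
    "\<And>t. \<forall>w. metric (\<gamma>1 t) (h1 t) w + christoffel (\<gamma>1 t) (g1 t) (g1 t) w = 0"
    using assms(1) unfolding is_geodesic_def by metis
  obtain g2 h2 where 2: "\<And>t. \<gamma>2 t \<in> disk" "\<And>t. (\<gamma>2 has_vector_derivative g2 t) (at t)"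
    "\<And>t. (g2 has_vector_derivative h2 t) (at t)"
    "\<And>t. \<forall>w. metric (\<gamma>2 t) (h2 t) w + christoffel (\<gamma>2 t) (g2 t) (g2 t) w = 0"
    using assms(4) unfolding is_geodesic_def by metis
  have v: "g1 0 = v" "g2 0 = v"
    using 1(2)[of 0] 2(2)[of 0] assms(3,6) vector_derivative_unique_at by blast+
  have h1: "h1 t = - (2 / (1 - (norm (\<gamma>1 t))\<^sup>2)) *\<^sub>R (cnj (\<gamma>1 t) * g1 t ^ 2)" for t
    using 1(4)[of t] geodesic_equation_iff[OF 1(1)] by blast
  have h2: "h2 t = - (2 / (1 - (norm (\<gamma>2 t))\<^sup>2)) *\<^sub>R (cnj (\<gamma>2 t) * g2 t ^ 2)" for t
    using 2(4)[of t] geodesic_equation_iff[OF 2(1)] by blast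
  note l1 = geodesic_linearisation[OF 1(1,2) 1(3)[unfolded h1], of t]
  note l2 = geodesic_linearisation[OF 2(1,2) 2(3)[unfolded h2], of t]
  have m: "metric (\<gamma>1 0) (g1 0) (g1 0) = 1" "metric (\<gamma>2 0) (g2 0) (g2 0) = 1"
    using assms v by auto
  have "2 / (1 - \<gamma>1 t \<bullet> \<gamma>1 t) - 1 = 2 / (1 - \<gamma>2 t \<bullet> \<gamma>2 t) - 1"
    unfolding l1(1)[OF m(1)] l2(1)[OF m(2)] by (simp add: v assms)
  hence "1 - \<gamma>1 t \<bullet> \<gamma>1 t = 1 - \<gamma>2 t \<bullet> \<gamma>2 t" by simp
  moreover have "\<gamma>1 t /\<^sub>R (1 - \<gamma>1 t \<bullet> \<gamma>1 t) = \<gamma>2 t /\<^sub>R (1 - \<gamma>2 t \<bullet> \<gamma>2 t)"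
    unfolding l1(2)[OF m(1)] l2(2)[OF m(2)] by (simp add: v assms)
  moreover have "1 - \<gamma>1 t \<bullet> \<gamma>1 t \<noteq> 0"
    using one_minus_norm_sq_pos[OF 1(1)[of t]] by (simp add: dot_square_norm)
  ultimately show "\<gamma>1 t = \<gamma>2 t" by auto
qed

text \<open>At y = 0 the derivative is the positive number 1 - |x|^2, so \<open>mob x\<close>
  carries a direction at 0 to the same direction at x. The angle that parametrises
  \<open>tangent_circle x\<close> can therefore be read off at 0.\<close>

lemma has_field_derivative_mob:
  assumes "1 + cnj x * y \<noteq> 0"
  shows "(mob x has_field_derivative of_real (1 - (norm x)\<^sup>2) / (1 + cnj x * y)\<^sup>2) (at y)"
proof -
  have "complex_of_real (1 - (norm x)\<^sup>2) = 1 - x * cnj x" by (simp only: of_real_diff complex_norm_square of_real_1)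
  thus ?thesis
    unfolding mob_def using assms
    by (auto intro!: derivative_eq_intros simp: power2_eq_square field_simps)
qed

lemma mob_tau_derivative:
  assumes "x \<in> disk" "norm e = 1"
  shows "((\<lambda>t. mob x (of_real (tau t) * e)) has_vector_derivative
     of_real ((1 - (norm x)\<^sup>2) * ((1 - (tau t)\<^sup>2) / 2)) * e / (1 + cnj x * (of_real (tau t) * e))\<^sup>2) (at t)"
proof -
  have nz: "1 + cnj x * (of_real (tau t) * e) \<noteq> 0"
    using mob_denom_nz assms tau_cis_in_disk[OF assms(2), of t] by (simp add: in_disk_iff)
  have "((\<lambda>t. of_real (tau t) * e) has_vector_derivative of_real ((1 - (tau t)\<^sup>2) / 2) * e) (at t)"
    by (rule has_vector_derivative_mult_left[OF has_vector_derivative_of_real_tau])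
  from field_vector_diff_chain_at[OF this has_field_derivative_mob[OF nz]]
  show ?thesis by (simp add: o_def mult_ac)
qed

lemma mob_tau_is_geodesic:
  assumes "x \<in> disk" "norm e = 1"
  shows "is_geodesic (\<lambda>t. mob x (of_real (tau t) * e))"
proof -
  define s where "s = 1 - (norm x)\<^sup>2"
  define D where "D t = 1 + cnj x * (of_real (tau t) * e)" for t
  define g where "g t = mob x (of_real (tau t) * e)" for t
  have D: "D t \<noteq> 0" for t
    using mob_denom_nz assms tau_cis_in_disk[OF assms(2), of t] by (simp add: in_disk_iff D_def)
  have s: "s > 0" using assms one_minus_norm_sq_pos s_def by simp
  have gd: "g t \<in> disk" for t
    using assms by (simp add: g_def mob_in_disk tau_cis_in_disk)
  define g' where "g' t = of_real (s * ((1 - (tau t)\<^sup>2) / 2)) * e / (D t)\<^sup>2" for t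
  define g'' where "g'' t = - (2 / (1 - (norm (g t))\<^sup>2)) *\<^sub>R (cnj (g t) * g' t ^ 2)" for t
  have 1: "(g has_vector_derivative g' t) (at t)" for t
    using mob_tau_derivative[OF assms, of t] unfolding g_def[abs_def] g'_def D_def s_def .
  \<comment> \<open>The velocity is differentiated as a holomorphic function of a complex radius and
    then composed with the real function \<open>tau\<close>.\<close>
  have "((\<lambda>\<tau>. of_real s * ((1 - \<tau>\<^sup>2) / 2) * e / (1 + cnj x * (\<tau> * e))\<^sup>2) has_field_derivative
      of_real s * e * (- \<tau> * (1 + cnj x * (\<tau> * e)) - (1 - \<tau>\<^sup>2) * cnj x * e) / (1 + cnj x * (\<tau> * e)) ^ 3) (at \<tau>)"
    if "1 + cnj x * (\<tau> * e) \<noteq> 0" for \<tau>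
    apply (rule derivative_eq_intros refl | use that in \<open>simp; fail\<close>)+
    using that apply (simp add: divide_simps)
    apply algebra
    done
  from field_vector_diff_chain_at[OF has_vector_derivative_of_real_tau this]
  have 2: "(g' has_vector_derivative of_real ((1 - (tau t)\<^sup>2) / 2) *
      (of_real s * e * (- of_real (tau t) * D t - of_real (1 - (tau t)\<^sup>2) * cnj x * e) / D t ^ 3)) (at t)" for t
    using D[of t] unfolding g'_def D_def o_def by simp
  have 3: "of_real ((1 - (tau t)\<^sup>2) / 2) *
      (of_real s * e * (- of_real (tau t) * D t - of_real (1 - (tau t)\<^sup>2) * cnj x * e) / D t ^ 3) = g'' t" for t
  proof -
    have ce: "cnj e * e = 1" using assms(2) complex_norm_square[of e] by (simp add: mult.commute)
    have sx: "complex_of_real s = 1 - cnj x * x"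
      by (simp only: s_def complex_norm_square of_real_diff of_real_1 mult.commute)
    have cD: "cnj (D t) = 1 + x * (of_real (tau t) * cnj e)" by (simp add: D_def)
    have nD: "complex_of_real ((norm (D t))\<^sup>2) = D t * cnj (D t)" by (rule complex_norm_square)
    define q where "q = 1 - (tau t)\<^sup>2"
    have q: "q > 0" using tau_sq q_def by simp
    have "1 - (norm (g t))\<^sup>2 = s * q / (norm (D t))\<^sup>2"
      using one_minus_mob[OF D[unfolded D_def]] assms(2)
      by (simp add: g_def D_def s_def q_def norm_mult power_mult_distrib)
    hence "2 / (1 - (norm (g t))\<^sup>2) = 2 * (norm (D t))\<^sup>2 / (s * q)" by simp
    hence c: "complex_of_real (2 / (1 - (norm (g t))\<^sup>2)) = 2 * (D t * cnj (D t)) / (of_real s * of_real q)"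
      using nD by simp
    have cg: "cnj (g t) = (cnj x + of_real (tau t) * cnj e) / cnj (D t)"
      by (simp add: g_def mob_def cD)
    have q': "complex_of_real q = 1 - (of_real (tau t))\<^sup>2" by (simp add: q_def)
    have nz: "complex_of_real s \<noteq> 0" "complex_of_real q \<noteq> 0" "D t \<noteq> 0" "cnj (D t) \<noteq> 0"
      using s q D[of t] by auto
    \<comment> \<open>The geodesic equation comes down to this identity: the left side arises from
      differentiating the velocity, the right side from the conjugate of \<open>g t\<close>. It
      rests on |e| = 1 and q = 1 - tau^2.\<close>
    have key: "of_real (tau t) * D t + of_real q * cnj x * e = (cnj x + of_real (tau t) * cnj e) * e"
      unfolding q' D_def using ce by algebra
    have "g'' t = - (complex_of_real (2 / (1 - (norm (g t))\<^sup>2)) * (cnj (g t) * g' t ^ 2))"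
      by (simp only: g''_def scaleR_conv_of_real of_real_minus mult_minus_left)
    also have "\<dots> = - (of_real s * of_real q / 2 * (cnj x + of_real (tau t) * cnj e) * e * e) / D t ^ 3"
      unfolding c cg g'_def q_def[symmetric] using nz by (simp add: field_simps eval_nat_numeral)
    also have "\<dots> = of_real (q / 2) * (of_real s * e * (- (of_real (tau t) * D t + of_real q * cnj x * e)) / D t ^ 3)"
      unfolding key using nz by (simp add: field_simps)
    finally show ?thesis by (simp add: q_def)
  qed
  have "metric (g t) (g'' t) w + christoffel (g t) (g' t) (g' t) w = 0" for t w
    using geodesic_equation_iff[OF gd] unfolding g''_def by blast
  thus ?thesis unfolding is_geodesic_def g_def[symmetric]
    using gd 1 2[unfolded 3] by blast
qed

text \<open>Scaling by 2 / (1 - |x|^2) turns a hyperbolic unit vector at x into a Euclidean unit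
  vector, which serves as the direction at 0 of the diameter that \<open>mob x\<close> moves to the
  geodesic.\<close>

lemma geodesic_eq_mob:
  assumes "x \<in> disk" "v \<in> unit_tangents x"
  shows "geodesic x v t = mob x (of_real (tau t) * (of_real (2 / (1 - (norm x)\<^sup>2)) * v))"
proof -
  define s where "s = 1 - (norm x)\<^sup>2"
  have s: "s > 0" using assms one_minus_norm_sq_pos s_def by simp
  define e where "e = complex_of_real (2 / s) * v"
  have m: "metric x v v = 1" using assms by (simp add: unit_tangents_def)
  hence "(norm v)\<^sup>2 = (s / 2)\<^sup>2" using s
    by (simp add: metric_def s_def[symmetric] dot_square_norm field_simps)
  hence "norm v = s / 2" using s by (simp add: power2_eq_iff_nonneg)
  hence e: "norm e = 1" using s by (simp add: e_def norm_mult norm_divide)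
  have v: "v = of_real (s / 2) * e" using s by (simp add: e_def)
  let ?g = "\<lambda>t. mob x (of_real (tau t) * e)"
  have 1: "is_geodesic ?g" by (rule mob_tau_is_geodesic[OF assms(1) e])
  have 2: "?g 0 = x" by (simp add: mob_def)
  have 3: "(?g has_vector_derivative v) (at 0)"
    using mob_tau_derivative[OF assms(1) e, of 0] by (simp add: v s_def)
  have "geodesic x v = ?g"
    unfolding geodesic_def
    using 1 2 3 geodesic_unique[OF _ _ _ 1 2 3 m] by (intro the_equality conjI) blast+
  thus ?thesis by (simp add: e_def s_def)
qed

section \<open>The Laplace-Beltrami operator in Euclidean coordinates\<close>

text \<open>The total derivative of a function with partial derivatives \<open>a\<close> and
  \<open>b\<close>; it is only real linear, as nothing here is holomorphic in general.\<close>

definition rlin :: "complex \<Rightarrow> complex \<Rightarrow> complex \<Rightarrow> complex" where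
  "rlin a b h = of_real (Re h) * a + of_real (Im h) * b"

lemma volume_density_eq:
  assumes "x \<in> disk"
  shows "volume_density x = 4 / (1 - (norm x)\<^sup>2)\<^sup>2"
proof -
  have "metric x 1 1 * metric x \<i> \<i> - (metric x 1 \<i>)\<^sup>2 = (4 / (1 - (norm x)\<^sup>2)\<^sup>2)\<^sup>2"
    by (simp add: metric_def inner_complex_def power2_eq_square)
  thus ?thesis by (simp add: volume_density_def real_sqrt_abs del: power_divide)
qed

lemma grad_eq:
  assumes "x \<in> disk" "(r has_derivative (\<lambda>h. G \<bullet> h)) (at x)"
  shows "grad r x = ((1 - (norm x)\<^sup>2)\<^sup>2 / 4) *\<^sub>R G"
proof -
  define s where "s = (1 - (norm x)\<^sup>2)\<^sup>2"
  have s: "s > 0" using one_minus_norm_sq_pos[OF assms(1)] by (simp add: s_def)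
  have m: "metric x H w = (4 / s) * (H \<bullet> w)" for H w by (simp add: metric_def s_def)
  have fd: "frechet_derivative r (at x) = (\<lambda>h. G \<bullet> h)"
    using frechet_derivative_at[OF assms(2)] by simp
  have "metric x ((s / 4) *\<^sub>R G) w = G \<bullet> w" for w using s by (simp add: m)
  moreover have "H = (s / 4) *\<^sub>R G" if "\<forall>w. metric x H w = G \<bullet> w" for H
  proof -
    have "(H - (s / 4) *\<^sub>R G) \<bullet> w = 0" for w
      using that[rule_format, of w] s by (simp add: m inner_diff_left field_simps)
    thus ?thesis using inner_eq_zero_iff[of "H - (s / 4) *\<^sub>R G"] by simp
  qed
  ultimately show ?thesis unfolding grad_def fd s_def[symmetric]
    by (intro the_equality) blast+
qed

text \<open>In dimension two the volume density cancels the inverse metric inside the gradient, so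
  the divergence sees the Euclidean gradient \<open>G\<close> and the metric survives only as a
  factor in front.\<close>

lemma laplace_beltrami_real_eq:
  assumes "x \<in> disk" and r: "\<And>y. y \<in> disk \<Longrightarrow> (r has_derivative (\<lambda>h. G y \<bullet> h)) (at y)"
    and "(G has_derivative G') (at x)"
  shows "laplace_beltrami_real r x = (1 - (norm x)\<^sup>2)\<^sup>2 / 4 * (G' 1 \<bullet> 1 + G' \<i> \<bullet> \<i>)"
proof -
  have "volume_density y *\<^sub>R grad r y = G y" if "y \<in> disk" for y
    using one_minus_norm_sq_pos[OF that] by (simp add: volume_density_eq[OF that] grad_eq[OF that r[OF that]])
  hence "((\<lambda>y. volume_density y *\<^sub>R grad r y) has_derivative G') (at x)"
    by (intro has_derivative_transform_within_open[OF assms(3) open_disk assms(1)]) simp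
  hence "frechet_derivative (\<lambda>y. volume_density y *\<^sub>R grad r y) (at x) = G'"
    using frechet_derivative_at by metis
  thus ?thesis
    by (simp add: laplace_beltrami_real_def divergence_def volume_density_eq[OF assms(1)] Basis_complex_def)
qed

lemma laplace_beltrami_eq:
  assumes x: "x \<in> disk" and u: "\<And>y. y \<in> disk \<Longrightarrow> (u has_derivative rlin (u1 y) (u2 y)) (at y)"
    and u1: "(u1 has_derivative u1') (at x)" and u2: "(u2 has_derivative u2') (at x)"
  shows "laplace_beltrami u x = of_real ((1 - (norm x)\<^sup>2)\<^sup>2 / 4) * (u1' 1 + u2' \<i>)"
proof -
  have Re: "laplace_beltrami_real (\<lambda>y. Re (u y)) x = (1 - (norm x)\<^sup>2)\<^sup>2 / 4 *
      (Complex (Re (u1' 1)) (Re (u2' 1)) \<bullet> 1 + Complex (Re (u1' \<i>)) (Re (u2' \<i>)) \<bullet> \<i>)"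
  proof (rule laplace_beltrami_real_eq[OF x, where G = "\<lambda>y. Complex (Re (u1 y)) (Re (u2 y))"])
    show "((\<lambda>y. Re (u y)) has_derivative (\<lambda>h. Complex (Re (u1 y)) (Re (u2 y)) \<bullet> h)) (at y)"
      if "y \<in> disk" for y
      using has_derivative_Re[OF u[OF that]]
      by (rule has_derivative_eq_rhs) (simp add: fun_eq_iff rlin_def inner_complex_def mult.commute)
    show "((\<lambda>y. Complex (Re (u1 y)) (Re (u2 y))) has_derivative
        (\<lambda>h. Complex (Re (u1' h)) (Re (u2' h)))) (at x)"
      unfolding Complex_eq using u1 u2 by (intro derivative_intros)
  qed
  have Im: "laplace_beltrami_real (\<lambda>y. Im (u y)) x = (1 - (norm x)\<^sup>2)\<^sup>2 / 4 *
      (Complex (Im (u1' 1)) (Im (u2' 1)) \<bullet> 1 + Complex (Im (u1' \<i>)) (Im (u2' \<i>)) \<bullet> \<i>)"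
  proof (rule laplace_beltrami_real_eq[OF x, where G = "\<lambda>y. Complex (Im (u1 y)) (Im (u2 y))"])
    show "((\<lambda>y. Im (u y)) has_derivative (\<lambda>h. Complex (Im (u1 y)) (Im (u2 y)) \<bullet> h)) (at y)"
      if "y \<in> disk" for y
      using has_derivative_Im[OF u[OF that]]
      by (rule has_derivative_eq_rhs) (simp add: fun_eq_iff rlin_def inner_complex_def mult.commute)
    show "((\<lambda>y. Complex (Im (u1 y)) (Im (u2 y))) has_derivative
        (\<lambda>h. Complex (Im (u1' h)) (Im (u2' h)))) (at x)"
      unfolding Complex_eq using u1 u2 by (intro derivative_intros)
  qed
  show ?thesis unfolding laplace_beltrami_def Re Im
    by (simp add: complex_eq_iff inner_complex_def)
qed

section \<open>Integration over the circle and the half line\<close>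

text \<open>A density on the whole line instead of a restricted space: the underlying sigma-algebra
  stays \<open>borel\<close>, so functions of the angle need no domain condition.\<close>

definition circle :: "real measure" where
  "circle = density lborel (indicator {0..<2*pi})"

lemma sets_circle [measurable_cong, simp]: "sets circle = sets borel"
  by (simp add: circle_def)

lemma space_circle [simp]: "space circle = UNIV"
  by (simp add: circle_def)

lemma emeasure_circle: "emeasure circle UNIV = ennreal (2 * pi)"
  by (simp add: circle_def emeasure_density)

lemma finite_measure_circle: "finite_measure circle"
  by (rule finite_measureI) (simp add: emeasure_circle)

lemma measure_circle: "measure circle UNIV = 2 * pi"
  by (simp add: measure_def emeasure_circle)

lemma sigma_finite_circle: "sigma_finite_measure circle"
  using finite_measure_circle by (rule finite_measure.axioms(1))

interpretation circle: finite_measure circle by (rule finite_measure_circle)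

lemma integral_circle_set:
  fixes g :: "real \<Rightarrow> complex"
  assumes "g \<in> borel_measurable borel"
  shows "(LINT \<theta>|circle. g \<theta>) = (LINT \<theta>:{0..<2*pi}|lborel. g \<theta>)"
proof -
  have c: "circle = density lborel (\<lambda>x. ennreal (indicator {0..<2*pi} x))"
    by (simp add: circle_def ennreal_indicator)
  show ?thesis unfolding set_lebesgue_integral_def c
    by (rule integral_density) (use assms in auto)
qed

lemma integral_circle:
  fixes g :: "real \<Rightarrow> complex"
  assumes "continuous_on UNIV g"
  shows "(LINT \<theta>|circle. g \<theta>) = integral {0..2*pi} g"
proof -
  have m: "g \<in> borel_measurable borel" using assms by (rule borel_measurable_continuous_onI)
  have si: "set_integrable lborel {0..2*pi} g"
    using assms borel_integrable_atLeastAtMost'[of 0 "2*pi" g] continuous_on_subset by blast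
  have "(LINT \<theta>:{0..<2*pi}|lborel. g \<theta>) = (LINT \<theta>:{0..2*pi}|lborel. g \<theta>)"
    unfolding set_lebesgue_integral_def
    using m AE_lborel_singleton[of "2*pi"]
    by (intro integral_cong_AE) (auto simp: indicator_def intro!: borel_measurable_scaleR elim!: eventually_mono)
  thus ?thesis using set_borel_integral_eq_integral(2)[OF si] integral_circle_set[OF m] by simp
qed

text \<open>Intended for functions with period 2 pi, where it shows that the mean of an angular
  derivative vanishes.\<close>

lemma integral_circle_derivative:
  fixes F :: "real \<Rightarrow> complex"
  assumes "\<And>t. (F has_vector_derivative F' t) (at t)" "continuous_on UNIV F'"
  shows "(LINT \<theta>|circle. F' \<theta>) = F (2*pi) - F 0"
  using assms fundamental_theorem_of_calculus[of 0 "2*pi" F F']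
  by (simp add: integral_circle has_vector_derivative_at_within integral_unique)

lemma integral_circle_shift:
  fixes p :: "real \<Rightarrow> complex"
  assumes p: "continuous_on UNIV p" and per: "\<And>\<theta>. p (\<theta> + 2*pi) = p \<theta>"
  shows "(LINT \<theta>|circle. p (\<theta> + d)) = (LINT \<theta>|circle. p \<theta>)"
proof -
  define D where "D = \<bar>d\<bar>"
  have D: "D \<ge> 0" by (simp add: D_def)
  \<comment> \<open>The extra 1 keeps every point that is used inside the open interval, where
    \<open>P\<close> has a two-sided derivative.\<close>
  let ?R = "D + 1"
  obtain P where P: "\<And>x. x \<in> {-?R..?R+2*pi} \<Longrightarrow> (P has_vector_derivative p x) (at x within {-?R..?R+2*pi})"
    using antiderivative_continuous[of "-?R" "?R+2*pi" p] p continuous_on_subset by blast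
  have P': "(P has_vector_derivative p x) (at x)" if "x \<in> {-?R<..<?R+2*pi}" for x
    using P[of x] that at_within_interior[of x "{-?R..?R+2*pi}"] by (simp add: interior_atLeastAtMost_real)
  have shift: "((\<lambda>x. P (x + c)) has_vector_derivative p (x + c)) (at x)" if "x + c \<in> {-?R<..<?R+2*pi}" for x c
    using vector_diff_chain_at[of "\<lambda>x. x + c" 1 x P "p (x + c)"] P'[OF that]
    by (simp add: o_def has_vector_derivative_add_const)
  have val: "(LINT \<theta>|circle. p (\<theta> + c)) = P (2*pi + c) - P c" if "-D \<le> c" "c \<le> D" for c
  proof -
    have "continuous_on UNIV (\<lambda>\<theta>. p (\<theta> + c))"
      by (rule continuous_on_compose2[OF p]) (auto intro!: continuous_intros)
    hence "(LINT \<theta>|circle. p (\<theta> + c)) = integral {0..2*pi} (\<lambda>\<theta>. p (\<theta> + c))"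
      by (rule integral_circle)
    also have "\<dots> = P (2*pi + c) - P (0 + c)"
    proof (rule integral_unique, rule fundamental_theorem_of_calculus)
      fix x assume "x \<in> {0..2*pi}"
      hence "x + c \<in> {-?R<..<?R+2*pi}" using that by simp
      thus "((\<lambda>\<theta>. P (\<theta> + c)) has_vector_derivative p (x + c)) (at x within {0..2*pi})"
        by (intro has_vector_derivative_at_within[OF shift])
    qed simp
    finally show ?thesis by simp
  qed
  \<comment> \<open>By periodicity the derivative of P (x + 2 pi) - P x is zero, so the integral
    over one period does not depend on its starting point.\<close>
  obtain e where e: "\<And>x. x \<in> {-D..D} \<Longrightarrow> P (x + 2*pi) - P x = e"
  proof (rule has_vector_derivative_zero_constant[of "{-D..D}" "\<lambda>x. P (x + 2*pi) - P x"])
    show "((\<lambda>x. P (x + 2*pi) - P x) has_vector_derivative 0) (at x within {-D..D})"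
      if "x \<in> {-D..D}" for x
    proof -
      have 1: "x + 2*pi \<in> {-?R<..<?R+2*pi}" "x + 0 \<in> {-?R<..<?R+2*pi}"
        using that pi_gt_zero unfolding atLeastAtMost_iff greaterThanLessThan_iff by linarith+
      have "((\<lambda>x. P (x + 2*pi) - P (x + 0)) has_vector_derivative p (x + 2*pi) - p (x + 0)) (at x)"
        by (rule has_vector_derivative_diff[OF shift[OF 1(1)] shift[OF 1(2)]])
      thus ?thesis using per[of x] by (simp add: has_vector_derivative_at_within)
    qed
  qed auto
  have "P (d + 2*pi) - P d = P (0 + 2*pi) - P 0" using e[of d] e[of 0] D abs_ge_self[of d] abs_ge_minus_self[of d]
    unfolding D_def atLeastAtMost_iff by auto
  thus ?thesis using val[of d] val[of 0] D by (simp add: add.commute D_def)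
qed

lemma integrable_circle_bounded:
  fixes g :: "real \<Rightarrow> complex"
  assumes "g \<in> borel_measurable borel" "\<And>\<theta>. norm (g \<theta>) \<le> B"
  shows "integrable circle g"
  using assms by (intro circle.integrable_const_bound[where B = B]) auto

text \<open>A function that is not integrable has integral 0, and the bound survives because
  \<open>g\<close> is nonnegative. Thus later estimates owe no measurability proof for
  \<open>f\<close>.\<close>

lemma norm_integral_le:
  fixes f :: "'a \<Rightarrow> complex"
  assumes "integrable M g" "\<And>x. norm (f x) \<le> g x"
  shows "norm (integral\<^sup>L M f) \<le> integral\<^sup>L M g"
proof (cases "integrable M f")
  case True
  have "norm (integral\<^sup>L M f) \<le> (LINT x|M. norm (f x))" by (rule integral_norm_bound)
  also have "\<dots> \<le> integral\<^sup>L M g"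
    by (rule integral_mono) (use True assms in auto)
  finally show ?thesis .
next
  case False
  have "0 \<le> g x" for x using assms(2)[of x] norm_ge_zero order_trans by blast
  hence "0 \<le> integral\<^sup>L M g" by simp
  thus ?thesis using False by (simp add: not_integrable_integral_eq)
qed

lemma norm_integral_circle_le:
  fixes g :: "real \<Rightarrow> complex"
  assumes "\<And>\<theta>. norm (g \<theta>) \<le> B"
  shows "norm (LINT \<theta>|circle. g \<theta>) \<le> 2 * pi * B"
  using norm_integral_le[of circle "\<lambda>_. B" g] assms by (simp add: measure_circle)

section \<open>Exponential weights on the half line\<close>

text \<open>With the cut-off built into the weight, half line integrals become integrals over all of
  \<open>lborel\<close>, to which Fubini applies directly.\<close>

definition wt :: "complex \<Rightarrow> real \<Rightarrow> complex" where
  "wt z t = (if t \<ge> 0 then exp (- z * of_real t) else 0)"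

lemma wt_measurable [measurable]: "wt z \<in> borel_measurable borel"
  unfolding wt_def[abs_def] by measurable

lemma norm_wt: "norm (wt z t) = indicator {0..} t * exp (- Re z * t)"
  by (simp add: wt_def)

lemma tendsto_exp_minus_at_top:
  fixes a :: real
  assumes "a > 0"
  shows "((\<lambda>t. exp (- (a * t))) \<longlongrightarrow> 0) at_top"
proof -
  have "filterlim (\<lambda>t. a * t) at_top at_top"
    using assms by (intro filterlim_tendsto_pos_mult_at_top[OF tendsto_const] filterlim_ident)
  thus ?thesis
    by (intro filterlim_compose[OF exp_at_bot]) (simp add: filterlim_uminus_at_bot)
qed

lemma integral_exp_half_line:
  fixes a :: real
  assumes "a > 0"
  shows "integrable lborel (\<lambda>t. indicator {0..} t * exp (- a * t))"
    and "(LINT t|lborel. indicator {0..} t * exp (- a * t)) = 1 / a"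
proof -
  have lim: "((\<lambda>t. - exp (- a * t) / a) \<longlongrightarrow> 0) at_top"
    using tendsto_divide[OF tendsto_minus[OF tendsto_exp_minus_at_top[OF assms]] tendsto_const[of a]] assms
    by simp
  have "(\<integral>\<^sup>+t. ennreal (exp (- a * t)) * indicator {0..} t \<partial>lborel) = 0 - (- exp (- a * 0) / a)"
    by (rule nn_integral_FTC_atLeast[OF _ _ _ lim]) (use assms in \<open>auto intro!: derivative_eq_intros\<close>)
  hence nn: "(\<integral>\<^sup>+t. ennreal (indicator {0..} t * exp (- a * t)) \<partial>lborel) = ennreal (1 / a)"
    by (simp add: ennreal_mult' mult.commute flip: ennreal_indicator)
  show 1: "integrable lborel (\<lambda>t. indicator {0..} t * exp (- a * t))"
    by (rule integrableI_nonneg) (use nn in auto)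
  show "(LINT t|lborel. indicator {0..} t * exp (- a * t)) = 1 / a"
    by (subst integral_eq_nn_integral) (use nn assms in auto)
qed

lemma integrable_wt: "Re z > 0 \<Longrightarrow> integrable lborel (wt z)"
  using integral_exp_half_line[of "Re z"] by (subst integrable_norm_iff[symmetric]) (simp_all add: norm_wt)

lemma integral_norm_wt: "Re z > 0 \<Longrightarrow> (LINT t|lborel. norm (wt z t)) = 1 / Re z"
  using integral_exp_half_line[of "Re z"] by (simp add: norm_wt)

text \<open>The fundamental theorem on [0, b], followed by b to infinity. Integrability is a
  separate assumption, since decay of \<open>F\<close> alone would give only an improper
  integral.\<close>

lemma integral_half_line_derivative:
  fixes F :: "real \<Rightarrow> complex"
  assumes "\<And>t. (F has_vector_derivative F' t) (at t)" "continuous_on UNIV F'"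
    and int: "integrable lborel (\<lambda>t. indicator {0..} t *\<^sub>R F' t)" and lim: "(F \<longlongrightarrow> 0) at_top"
  shows "(LINT t|lborel. indicator {0..} t *\<^sub>R F' t) = - F 0"
proof -
  have "((\<lambda>b. LINT t:{0..b}|lborel. F' t) \<longlongrightarrow> (LINT t:{0..}|lborel. F' t)) at_top"
    by (rule tendsto_set_lebesgue_integral_at_top) (use int in \<open>auto simp: set_integrable_def\<close>)
  moreover have "\<forall>\<^sub>F b in at_top. (LINT t:{0..b}|lborel. F' t) = F b - F 0"
    using eventually_ge_at_top[of "0::real"]
  proof eventually_elim
    case (elim b)
    show ?case unfolding set_lebesgue_integral_def
      by (rule integral_FTC_atLeastAtMost)
        (use elim assms in \<open>auto intro: has_vector_derivative_at_within continuous_on_subset\<close>)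
  qed
  ultimately have "((\<lambda>b. F b - F 0) \<longlongrightarrow> (LINT t:{0..}|lborel. F' t)) at_top"
    by (rule Lim_transform_eventually)
  moreover have "((\<lambda>b. F b - F 0) \<longlongrightarrow> 0 - F 0) at_top"
    by (intro tendsto_diff lim tendsto_const)
  ultimately show ?thesis
    using tendsto_unique[OF trivial_limit_at_top_linorder] by (fastforce simp: set_lebesgue_integral_def)
qed

lemma integrable_pair_mult:
  fixes a :: "'a \<Rightarrow> complex" and b :: "'b \<Rightarrow> complex"
  assumes "sigma_finite_measure M" "sigma_finite_measure N" "integrable M a" "integrable N b"
  shows "integrable (M \<Otimes>\<^sub>M N) (\<lambda>p. a (fst p) * b (snd p))"
proof -
  interpret pair_sigma_finite M N using assms by (simp add: pair_sigma_finite_def)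
  have [measurable]: "a \<in> borel_measurable M" "b \<in> borel_measurable N" using assms by auto
  show ?thesis
  proof (rule Fubini_integrable)
    show "integrable M (\<lambda>x. LINT y|N. norm (a (fst (x, y)) * b (snd (x, y))))"
      using assms by (simp add: norm_mult)
    show "AE x in M. integrable N (\<lambda>y. a (fst (x, y)) * b (snd (x, y)))"
      using assms by simp
  qed measurable
qed

lemma sigma_finite_pair:
  "sigma_finite_measure M \<Longrightarrow> sigma_finite_measure N \<Longrightarrow> sigma_finite_measure (M \<Otimes>\<^sub>M N)"
proof -
  assume "sigma_finite_measure M" "sigma_finite_measure N"
  then interpret pair_sigma_finite M N by (simp add: pair_sigma_finite_def)
  show ?thesis by (rule P.sigma_finite_measure_axioms)
qed

section \<open>Integrals depending on a parameter\<close>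

lemma continuous_on_integral:
  fixes F :: "'a::metric_space \<Rightarrow> 'b \<Rightarrow> complex"
  assumes "\<And>x. x \<in> S \<Longrightarrow> F x \<in> borel_measurable M" "integrable M g"
    and "\<And>x \<omega>. x \<in> S \<Longrightarrow> norm (F x \<omega>) \<le> g \<omega>" "\<And>\<omega>. continuous_on S (\<lambda>x. F x \<omega>)"
  shows "continuous_on S (\<lambda>x. integral\<^sup>L M (F x))"
  unfolding continuous_on_sequentially
proof (intro allI ballI impI, elim conjE)
  fix X :: "nat \<Rightarrow> 'a" and a assume a: "a \<in> S" "\<forall>n. X n \<in> S" "X \<longlonglongrightarrow> a"
  have "(\<lambda>n. integral\<^sup>L M (F (X n))) \<longlonglongrightarrow> integral\<^sup>L M (F a)"
  proof (rule integral_dominated_convergence[where w = g])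
    show "AE \<omega> in M. (\<lambda>n. F (X n) \<omega>) \<longlonglongrightarrow> F a \<omega>"
      using assms(4) a unfolding continuous_on_sequentially o_def by blast
  qed (use assms a in auto)
  thus "((\<lambda>x. integral\<^sup>L M (F x)) \<circ> X) \<longlonglongrightarrow> integral\<^sup>L M (F a)" by (simp add: o_def)
qed

text \<open>Dominated convergence for the whole remainder quotient along sequences. Convexity of
  \<open>U\<close> supplies the mean value inequality, so a pointwise bound on the derivative
  already controls the increments of \<open>F\<close>.\<close>

lemma has_derivative_integral:
  fixes F :: "'a::real_normed_vector \<Rightarrow> 'b \<Rightarrow> complex"
  assumes U: "open U" "convex U" "x0 \<in> U"
    and F: "\<And>x \<omega>. x \<in> U \<Longrightarrow> ((\<lambda>x. F x \<omega>) has_derivative F' x \<omega>) (at x)"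
    and bound: "\<And>x \<omega> h. x \<in> U \<Longrightarrow> norm (F' x \<omega> h) \<le> g \<omega> * norm h"
    and g: "integrable M g" and int: "\<And>x. x \<in> U \<Longrightarrow> integrable M (F x)"
    and meas: "\<And>h. (\<lambda>\<omega>. F' x0 \<omega> h) \<in> borel_measurable M"
  shows "((\<lambda>x. integral\<^sup>L M (F x)) has_derivative (\<lambda>h. LINT \<omega>|M. F' x0 \<omega> h)) (at x0)"
proof -
  have lin: "bounded_linear (F' x0 \<omega>)" for \<omega> using F[OF U(3)] by (rule has_derivative_bounded_linear)
  have int': "integrable M (\<lambda>\<omega>. F' x0 \<omega> h)" for h
    by (rule Bochner_Integration.integrable_bound[of _ "\<lambda>\<omega>. g \<omega> * norm h"])
      (use g meas in \<open>auto intro!: order_trans[OF bound[OF U(3)] abs_ge_self]\<close>)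
  have bl: "bounded_linear (\<lambda>h. LINT \<omega>|M. F' x0 \<omega> h)"
  proof (rule bounded_linear_intro[of _ "integral\<^sup>L M g"])
    fix h k r
    show "(LINT \<omega>|M. F' x0 \<omega> (h + k)) = (LINT \<omega>|M. F' x0 \<omega> h) + (LINT \<omega>|M. F' x0 \<omega> k)"
      using int' by (simp add: linear_add[OF bounded_linear.linear[OF lin]])
    show "(LINT \<omega>|M. F' x0 \<omega> (r *\<^sub>R h)) = r *\<^sub>R (LINT \<omega>|M. F' x0 \<omega> h)"
      using int' by (simp add: linear_scale[OF bounded_linear.linear[OF lin]])
    have "norm (LINT \<omega>|M. F' x0 \<omega> h) \<le> (LINT \<omega>|M. g \<omega> * norm h)"
      by (rule norm_integral_le) (use g bound[OF U(3)] in auto)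
    thus "norm (LINT \<omega>|M. F' x0 \<omega> h) \<le> norm h * integral\<^sup>L M g" by (simp add: mult.commute)
  qed
  have "((\<lambda>y. (1 / norm (y - x0)) *\<^sub>R (integral\<^sup>L M (F y) - (integral\<^sup>L M (F x0) +
      (LINT \<omega>|M. F' x0 \<omega> (y - x0))))) \<longlongrightarrow> 0) (at x0 within U)"
    unfolding tendsto_at_iff_sequentially
  proof (intro allI impI)
    fix X :: "nat \<Rightarrow> 'a" assume X: "\<forall>i. X i \<in> U - {x0}" "X \<longlonglongrightarrow> x0"
    let ?q = "\<lambda>y \<omega>. (1 / norm (y - x0)) *\<^sub>R (F y \<omega> - (F x0 \<omega> + F' x0 \<omega> (y - x0)))"
    have "(\<lambda>n. integral\<^sup>L M (?q (X n))) \<longlonglongrightarrow> (LINT \<omega>|M. 0)"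
    \<comment> \<open>One \<open>g\<close> bounds the increment of \<open>F\<close>, the other
      bounds the linear term.\<close>
    proof (rule integral_dominated_convergence[where w = "\<lambda>\<omega>. 2 * g \<omega>"])
      show "?q (X n) \<in> borel_measurable M" for n
        using int[of "X n"] int[OF U(3)] meas X by auto
      show "AE \<omega> in M. (\<lambda>n. ?q (X n) \<omega>) \<longlonglongrightarrow> 0"
      proof (rule AE_I2)
        fix \<omega>
        have "((\<lambda>x. F x \<omega>) has_derivative F' x0 \<omega>) (at x0 within U)"
          using F[OF U(3)] by (rule has_derivative_at_withinI)
        hence "((\<lambda>y. ?q y \<omega>) \<longlongrightarrow> 0) (at x0 within U)"
          unfolding has_derivative_within by blast
        thus "(\<lambda>n. ?q (X n) \<omega>) \<longlonglongrightarrow> 0"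
          using X unfolding tendsto_at_iff_sequentially o_def by blast
      qed
      show "AE \<omega> in M. norm (?q (X n) \<omega>) \<le> 2 * g \<omega>" for n
      proof (rule AE_I2)
        fix \<omega>
        have n: "norm (X n - x0) > 0" "X n \<in> U" using X by auto
        have "0 \<le> g \<omega> * norm (X n - x0)" using bound[OF U(3)] norm_ge_zero order_trans by blast
        hence g0: "0 \<le> g \<omega>" using n(1) by (simp add: zero_le_mult_iff)
        have "norm (F (X n) \<omega> - F x0 \<omega>) \<le> g \<omega> * norm (X n - x0)"
          by (rule differentiable_bound[OF U(2), of "\<lambda>x. F x \<omega>" "\<lambda>x. F' x \<omega>"])
            (use n U F bound g0 in \<open>auto intro: has_derivative_at_withinI onorm_bound\<close>)
        moreover have "norm (F' x0 \<omega> (X n - x0)) \<le> g \<omega> * norm (X n - x0)" by (rule bound[OF U(3)])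
        moreover have "norm (F (X n) \<omega> - (F x0 \<omega> + F' x0 \<omega> (X n - x0)))
            \<le> norm (F (X n) \<omega> - F x0 \<omega>) + norm (F' x0 \<omega> (X n - x0))"
          using norm_triangle_ineq4[of "F (X n) \<omega> - F x0 \<omega>"] by (simp add: diff_diff_eq)
        ultimately have "norm (F (X n) \<omega> - (F x0 \<omega> + F' x0 \<omega> (X n - x0))) \<le> 2 * g \<omega> * norm (X n - x0)"
          by simp
        thus "norm (?q (X n) \<omega>) \<le> 2 * g \<omega>" using n by (simp add: divide_simps)
      qed
    qed (use g in auto)
    moreover have "integral\<^sup>L M (?q (X n)) = (1 / norm (X n - x0)) *\<^sub>R (integral\<^sup>L M (F (X n)) -
        (integral\<^sup>L M (F x0) + (LINT \<omega>|M. F' x0 \<omega> (X n - x0))))" for n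
      using X int[of "X n"] int[OF U(3)] int' by simp
    ultimately have "(\<lambda>n. (1 / norm (X n - x0)) *\<^sub>R (integral\<^sup>L M (F (X n)) - (integral\<^sup>L M (F x0) +
      (LINT \<omega>|M. F' x0 \<omega> (X n - x0))))) \<longlonglongrightarrow> (LINT \<omega>|M. 0)"
      by (simp only:)
    thus "((\<lambda>y. (1 / norm (y - x0)) *\<^sub>R (integral\<^sup>L M (F y) - (integral\<^sup>L M (F x0) +
      (LINT \<omega>|M. F' x0 \<omega> (y - x0))))) \<circ> X) \<longlonglongrightarrow> 0"
      by (simp add: o_def)
  qed
  hence "((\<lambda>x. integral\<^sup>L M (F x)) has_derivative (\<lambda>h. LINT \<omega>|M. F' x0 \<omega> h)) (at x0 within U)"
    using bl unfolding has_derivative_within by blast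
  thus ?thesis using at_within_open[OF U(3,1)] by simp
qed

section \<open>Radial integral operators\<close>

text \<open>The operator $A(z)$ in geodesic polar coordinates about x, with distance
  \<open>t\<close> and direction \<open>\<theta>\<close>.\<close>

definition radial_op :: "complex \<Rightarrow> (complex \<Rightarrow> complex) \<Rightarrow> complex \<Rightarrow> complex" where
  "radial_op z h x =
     (LINT t|lborel. wt z t * (LINT \<theta>|circle. h (mob x (of_real (tau t) * cis \<theta>))))"

lemma tau_measurable [measurable]: "tau \<in> borel_measurable borel"
  by (intro borel_measurable_continuous_onI continuous_intros)

lemma cis_measurable [measurable]: "cis \<in> borel_measurable borel"
  by (intro borel_measurable_continuous_onI continuous_intros)

lemma mob_measurable [measurable (raw)]:
  "f \<in> borel_measurable M \<Longrightarrow> g \<in> borel_measurable M \<Longrightarrow> (\<lambda>\<omega>. mob (f \<omega>) (g \<omega>)) \<in> borel_measurable M"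
  unfolding mob_def
  by (intro borel_measurable_divide borel_measurable_add borel_measurable_times
        borel_measurable_const measurable_compose[of f M borel cnj])
     (auto intro!: borel_measurable_continuous_onI continuous_intros)

text \<open>Makes a function that is controlled only on the disk into a Borel function on the plane,
  so that measurability of compositions need not track where the arguments lie. For functions
  supported in a compact part of the disk it also preserves smoothness.\<close>

definition zero_ext :: "(complex \<Rightarrow> complex) \<Rightarrow> complex \<Rightarrow> complex" where
  "zero_ext h y = (if y \<in> disk then h y else 0)"

lemma zero_ext_measurable:
  assumes "continuous_on disk h"
  shows "zero_ext h \<in> borel_measurable borel"
  unfolding zero_ext_def[abs_def]
  by (rule borel_measurable_continuous_on_if) (use assms open_disk in \<open>auto intro: continuous_intros\<close>)

lemma mob_tau_cis_in_disk: "x \<in> disk \<Longrightarrow> mob x (of_real (tau t) * cis \<theta>) \<in> disk"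
  by (simp add: mob_in_disk tau_cis_in_disk)

lemma zero_ext_mob: "x \<in> disk \<Longrightarrow> zero_ext h (mob x (of_real (tau t) * cis \<theta>)) = h (mob x (of_real (tau t) * cis \<theta>))"
  by (simp add: zero_ext_def mob_tau_cis_in_disk)

lemma continuous_on_mob:
  assumes "continuous_on S f" "continuous_on S g" "\<And>s. s \<in> S \<Longrightarrow> f s \<in> disk" "\<And>s. s \<in> S \<Longrightarrow> g s \<in> disk"
  shows "continuous_on S (\<lambda>s. mob (f s) (g s))"
  unfolding mob_def using assms mob_denom_nz by (intro continuous_intros) (force simp: in_disk_iff)+

lemma fubini_circle:
  fixes H :: "real \<Rightarrow> real \<Rightarrow> complex"
  assumes H [measurable]: "(\<lambda>p. H (fst p) (snd p)) \<in> borel_measurable (lborel \<Otimes>\<^sub>M circle)"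
    and B: "\<And>t \<theta>. norm (H t \<theta>) \<le> B" and w: "integrable lborel w"
  shows "integrable (lborel \<Otimes>\<^sub>M circle) (\<lambda>p. w (fst p) * H (fst p) (snd p))"
    and "(LINT \<theta>|circle. LINT t|lborel. w t * H t \<theta>) = (LINT t|lborel. w t * (LINT \<theta>|circle. H t \<theta>))"
    and "integrable circle (\<lambda>\<theta>. LINT t|lborel. w t * H t \<theta>)"
proof -
  interpret pair_sigma_finite lborel circle
    by (simp add: pair_sigma_finite_def sigma_finite_circle lborel.sigma_finite_measure_axioms)
  have [measurable]: "w \<in> borel_measurable borel" using w by auto
  have "integrable (lborel \<Otimes>\<^sub>M circle) (\<lambda>p. w (fst p) * of_real B)"
    using integrable_pair_mult[OF lborel.sigma_finite_measure_axioms sigma_finite_circle w, of "\<lambda>_. of_real B"] by simp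
  thus 1: "integrable (lborel \<Otimes>\<^sub>M circle) (\<lambda>p. w (fst p) * H (fst p) (snd p))"
    by (rule Bochner_Integration.integrable_bound)
      (auto simp: norm_mult intro!: mult_left_mono order_trans[OF B abs_ge_self])
  hence 2: "integrable (lborel \<Otimes>\<^sub>M circle) (\<lambda>(t, \<theta>). w t * H t \<theta>)" by (simp add: case_prod_beta')
  show "(LINT \<theta>|circle. LINT t|lborel. w t * H t \<theta>) = (LINT t|lborel. w t * (LINT \<theta>|circle. H t \<theta>))"
    using Fubini_integral[OF 2] by simp
  show "integrable circle (\<lambda>\<theta>. LINT t|lborel. w t * H t \<theta>)" by (rule integrable_snd[OF 2])
qed

section \<open>From unit tangent circles to polar coordinates\<close>

lemma integral_tangent_circle:
  fixes k :: "complex \<Rightarrow> complex"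
  assumes "x \<in> disk" and k: "k \<in> borel_measurable (restrict_space borel (unit_tangents x))"
  shows "(LINT v|tangent_circle x. k v) = (LINT \<theta>|circle. k (of_real ((1 - (norm x)\<^sup>2) / 2) * cis \<theta>))"
proof -
  let ?p = "\<lambda>\<theta>. of_real ((1 - (norm x)\<^sup>2) / 2) * cis \<theta> :: complex"
  have p: "?p \<in> measurable borel (restrict_space borel (unit_tangents x))"
    using unit_tangents_param[OF assms(1)] by (intro measurable_restrict_space2) auto
  hence p': "?p \<in> measurable (restrict_space lborel {0..<2*pi}) (restrict_space borel (unit_tangents x))"
    by (auto intro: measurable_restrict_space1)
  have kp: "(\<lambda>\<theta>. k (?p \<theta>)) \<in> borel_measurable borel" using measurable_compose[OF p k] .
  have "(LINT v|tangent_circle x. k v) = (LINT \<theta>|restrict_space lborel {0..<2*pi}. k (?p \<theta>))"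
    unfolding tangent_circle_def by (rule integral_distr[OF p' k])
  also have "\<dots> = (LINT \<theta>:{0..<2*pi}|lborel. k (?p \<theta>))"
    by (subst integral_restrict_space) (auto simp: set_lebesgue_integral_def)
  finally show ?thesis using integral_circle_set[OF kp] by simp
qed

lemma finite_measure_tangent_circle: "x \<in> disk \<Longrightarrow> finite_measure (tangent_circle x)"
  by (rule finite_measureI) (simp add: emeasure_tangent_circle)

lemma sets_tangent_circle [measurable_cong]:
  "sets (tangent_circle x) = sets (restrict_space borel (unit_tangents x))"
  by (simp add: tangent_circle_def)

text \<open>The weight \<open>w\<close> is arbitrary, so that the same change of variables serves
  the two-sided weight of \<open>Pi0\<close> and the one-sided weight of
  \<open>S_op\<close>.\<close>

lemma geodesic_integral:
  fixes h :: "complex \<Rightarrow> complex" and w :: "real \<Rightarrow> complex"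
  assumes x: "x \<in> disk" and h: "continuous_on disk h" "\<And>y. y \<in> disk \<Longrightarrow> norm (h y) \<le> B"
    and w: "integrable lborel w"
  shows "integrable (tangent_circle x \<Otimes>\<^sub>M lborel) (\<lambda>(v, t). w t * h (geodesic x v t))"
    and "(LINT v|tangent_circle x. LINT t|lborel. w t * h (geodesic x v t)) =
      (LINT t|lborel. w t * (LINT \<theta>|circle. h (mob x (of_real (tau t) * cis \<theta>))))"
proof -
  let ?U = "unit_tangents x" and ?c = "complex_of_real (2 / (1 - (norm x)\<^sup>2))"
  note [measurable] = zero_ext_measurable[OF h(1)]
  have [measurable]: "w \<in> borel_measurable borel" using w by auto
  have [measurable]: "(\<lambda>v. v) \<in> measurable (restrict_space borel ?U) borel" by (rule measurable_restrict_space1) simp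
  have B: "norm (zero_ext h y) \<le> B" for y
  proof -
    have "B \<ge> 0" using h(2)[OF x] norm_ge_zero order_trans by blast
    thus ?thesis using h(2) by (simp add: zero_ext_def)
  qed
  have s: "1 - (norm x)\<^sup>2 > 0" using x by (rule one_minus_norm_sq_pos)
  have nv: "norm (?c * v) = 1" if "v \<in> ?U" for v
  proof -
    have "(norm v)\<^sup>2 = ((1 - (norm x)\<^sup>2) / 2)\<^sup>2" using s that
      by (simp add: metric_def unit_tangents_def dot_square_norm power_divide divide_simps)
    hence "norm v = (1 - (norm x)\<^sup>2) / 2" using s by (simp add: power2_eq_iff_nonneg)
    thus ?thesis using s by (simp add: norm_mult norm_divide del: of_real_divide of_real_diff of_real_power)
  qed
  \<comment> \<open>\<open>?H\<close> agrees with the integrand on the unit tangents only, but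
    unlike it is visibly measurable in both variables.\<close>
  let ?H = "\<lambda>v t. w t * zero_ext h (mob x (of_real (tau t) * (?c * v)))"
  have eq: "w t * h (geodesic x v t) = ?H v t" if "v \<in> ?U" for v t
    using geodesic_eq_mob[OF x that] mob_in_disk[OF x tau_cis_in_disk[OF nv[OF that]], of t]
    by (simp add: zero_ext_def)
  have Hm: "(\<lambda>p. ?H (fst p) (snd p)) \<in> borel_measurable (restrict_space borel ?U \<Otimes>\<^sub>M lborel)"
    by measurable
  have "integrable (tangent_circle x \<Otimes>\<^sub>M lborel) (\<lambda>p. 1 * w (snd p))"
    by (rule integrable_pair_mult[OF _ lborel.sigma_finite_measure_axioms _ w])
      (use finite_measure_tangent_circle[OF x] in \<open>auto simp: finite_measure_def intro: finite_measure.integrable_const\<close>)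
  hence "integrable (tangent_circle x \<Otimes>\<^sub>M lborel) (\<lambda>p. w (snd p) * of_real B)" by simp
  hence "integrable (tangent_circle x \<Otimes>\<^sub>M lborel) (\<lambda>p. ?H (fst p) (snd p))"
    by (rule Bochner_Integration.integrable_bound)
      (use Hm in \<open>auto simp: norm_mult sets_tangent_circle cong: measurable_cong_sets sets_pair_measure_cong
         intro!: mult_left_mono order_trans[OF B abs_ge_self]\<close>)
  thus "integrable (tangent_circle x \<Otimes>\<^sub>M lborel) (\<lambda>(v, t). w t * h (geodesic x v t))"
    by (subst Bochner_Integration.integrable_cong[OF refl]) (auto simp: space_pair_measure eq)
  have "(LINT v|tangent_circle x. LINT t|lborel. w t * h (geodesic x v t)) =
      (LINT v|tangent_circle x. LINT t|lborel. ?H v t)"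
    by (rule Bochner_Integration.integral_cong) (auto simp: eq)
  also have "\<dots> = (LINT \<theta>|circle. LINT t|lborel. ?H (of_real ((1 - (norm x)\<^sup>2) / 2) * cis \<theta>) t)"
    by (rule integral_tangent_circle[OF x]) measurable
  also have "\<dots> = (LINT \<theta>|circle. LINT t|lborel. w t * zero_ext h (mob x (of_real (tau t) * cis \<theta>)))"
  proof -
    \<comment> \<open>\<open>?c\<close> is the reciprocal of the Euclidean radius of the tangent
      circle, so only the direction remains.\<close>
    have "?c * (of_real ((1 - (norm x)\<^sup>2) / 2) * e) = e" for e
    proof -
      have "?c * of_real ((1 - (norm x)\<^sup>2) / 2) = of_real (2 / (1 - (norm x)\<^sup>2) * ((1 - (norm x)\<^sup>2) / 2))"
        by (simp only: of_real_mult)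
      also have "2 / (1 - (norm x)\<^sup>2) * ((1 - (norm x)\<^sup>2) / 2) = 1" using s by simp
      finally show ?thesis by (simp only: mult.assoc[symmetric] of_real_1 mult_1)
    qed
    thus ?thesis by (simp only:)
  qed
  also have "\<dots> = (LINT t|lborel. w t * (LINT \<theta>|circle. zero_ext h (mob x (of_real (tau t) * cis \<theta>))))"
    by (rule fubini_circle[OF _ B w]) measurable
  finally show "(LINT v|tangent_circle x. LINT t|lborel. w t * h (geodesic x v t)) =
      (LINT t|lborel. w t * (LINT \<theta>|circle. h (mob x (of_real (tau t) * cis \<theta>))))"
    by (simp add: zero_ext_mob[OF x])
qed

lemma S_op_eq_radial_op:
  fixes h :: "complex \<Rightarrow> complex"
  assumes x: "x \<in> disk" and h: "continuous_on disk h" "\<And>y. y \<in> disk \<Longrightarrow> norm (h y) \<le> B"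
    and z: "Re z > - 1"
  shows "S_converges z h x" "S_op z h x = radial_op (z + 1) h x"
proof -
  have w: "integrable lborel (wt (z + 1))" using z by (intro integrable_wt) simp
  have eq: "indicator {0..} t *\<^sub>R S_integrand z h x v t = wt (z + 1) t * h (geodesic x v t)" for v t
    by (simp add: S_integrand_def wt_def)
  show "S_op z h x = radial_op (z + 1) h x"
    using geodesic_integral(2)[OF x h w]
    by (simp add: S_op_def set_lebesgue_integral_def eq radial_op_def)
  have "integrable (tangent_circle x \<Otimes>\<^sub>M lborel)
     (\<lambda>p. indicator (unit_tangents x \<times> {0..}) p *\<^sub>R (case p of (v, t) \<Rightarrow> S_integrand z h x v t))
    \<longleftrightarrow> integrable (tangent_circle x \<Otimes>\<^sub>M lborel) (\<lambda>(v, t). wt (z + 1) t * h (geodesic x v t))"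
    by (intro Bochner_Integration.integrable_cong)
      (auto simp: space_pair_measure eq[symmetric] indicator_def)
  thus "S_converges z h x" unfolding S_converges_def set_integrable_def
    using geodesic_integral(1)[OF x h w] by simp
qed

text \<open>Reversing a geodesic turns its initial direction by pi, which the mean over all
  directions does not notice. Negative times therefore contribute as much as positive ones.\<close>

lemma Pi0_eq_radial_op:
  fixes h :: "complex \<Rightarrow> complex"
  assumes x: "x \<in> disk" and h: "continuous_on disk h" "\<And>y. y \<in> disk \<Longrightarrow> norm (h y) \<le> B"
    and z: "Re z > 0"
  shows "Pi0_converges z h x" "Pi0 z h x = 2 * radial_op z h x"
proof -
  let ?w = "\<lambda>t::real. exp (- z * of_real \<bar>t\<bar>)"
  let ?K = "\<lambda>t. LINT \<theta>|circle. h (mob x (of_real (tau t) * cis \<theta>))"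
  have w1: "integrable lborel (wt z)" using z by (rule integrable_wt)
  have w2: "integrable lborel (\<lambda>t. wt z (- t))"
    using lborel_integrable_real_affine[OF w1, of "-1" 0] by simp
  \<comment> \<open>Only almost everywhere: at t = 0 both halves contribute 1.\<close>
  have ae: "AE t in lborel. ?w t = wt z t + wt z (- t)"
    using AE_lborel_singleton[of "0::real"] by eventually_elim (auto simp: wt_def)
  have w: "integrable lborel ?w"
    by (subst integrable_cong_AE[OF _ _ ae]) (use w1 w2 in auto)
  show "Pi0_converges z h x" unfolding Pi0_converges_def Pi0_integrand_def
    using geodesic_integral(1)[OF x h w] .
  note [measurable] = zero_ext_measurable[OF h(1)]
  have B: "norm (zero_ext h y) \<le> B" for y
  proof -
    have "B \<ge> 0" using h(2)[OF x] norm_ge_zero order_trans by blast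
    thus ?thesis using h(2) by (simp add: zero_ext_def)
  qed
  have K: "?K t = (LINT \<theta>|circle. zero_ext h (mob x (of_real (tau t) * cis \<theta>)))" for t
    by (simp add: zero_ext_mob[OF x])
  have Km: "?K \<in> borel_measurable borel" unfolding K
    using circle.borel_measurable_lebesgue_integral by measurable
  have Kb: "norm (?K t) \<le> 2 * pi * B" for t
    unfolding K by (rule norm_integral_circle_le[OF B])
  have Ki: "integrable lborel (\<lambda>t. v t * ?K t)" if "integrable lborel v" for v :: "real \<Rightarrow> complex"
  proof (rule Bochner_Integration.integrable_bound[of lborel "\<lambda>t. v t * of_real (2 * pi * B)"])
    show "AE t in lborel. norm (v t * ?K t) \<le> norm (v t * of_real (2 * pi * B))"
      unfolding norm_mult[of "v _"] norm_of_real
      by (intro AE_I2 mult_left_mono order_trans[OF Kb abs_ge_self] norm_ge_zero)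
  qed (use that Km in auto)
  \<comment> \<open>\<open>tau\<close> is odd, and a sign change of the radius is a shift of the
    angle by pi.\<close>
  have Ks: "?K (- t) = ?K t" for t
  proof -
    have c: "continuous_on UNIV (\<lambda>\<theta>. h (mob x (of_real (tau t) * cis \<theta>)))"
      by (rule continuous_on_compose2[OF h(1)])
        (use x in \<open>auto intro!: continuous_on_mob continuous_intros mob_tau_cis_in_disk tau_cis_in_disk\<close>)
    have "of_real (tau (- t)) * cis \<theta> = of_real (tau t) * cis (\<theta> + pi)" for \<theta>
      by (simp add: tau_minus flip: cis_mult)
    hence "?K (- t) = (LINT \<theta>|circle. h (mob x (of_real (tau t) * cis (\<theta> + pi))))" by simp
    also have "\<dots> = ?K t"
      by (rule integral_circle_shift[OF c]) (simp flip: cis_mult)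
    finally show ?thesis .
  qed
  have "Pi0 z h x = (LINT t|lborel. ?w t * ?K t)"
    unfolding Pi0_def Pi0_integrand_def by (rule geodesic_integral(2)[OF x h w])
  also have "\<dots> = (LINT t|lborel. wt z t * ?K t + wt z (- t) * ?K t)"
    by (rule integral_cong_AE) (use ae Km w w1 w2 in \<open>auto simp: distrib_right elim: eventually_mono\<close>)
  also have "\<dots> = (LINT t|lborel. wt z t * ?K t) + (LINT t|lborel. wt z (- t) * ?K (- t))"
    unfolding Ks using Ki[OF w1] Ki[OF w2] by (rule Bochner_Integration.integral_add)
  also have "(LINT t|lborel. wt z (- t) * ?K (- t)) = (LINT t|lborel. wt z t * ?K t)"
    using lborel_integral_real_affine[of "-1" "\<lambda>t. wt z t * ?K t" 0] by simp
  finally show "Pi0 z h x = 2 * radial_op z h x" by (simp add: radial_op_def)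
qed

section \<open>Bounded functions with two bounded derivatives\<close>

text \<open>The second difference of \<open>r\<close> over a square of side s with corner w is s^2
  times a value of \<open>r12\<close> and, by taking the mean values in the other order, s^2 times a
  value of \<open>r21\<close>. Both points are within 2 s of w, and continuity finishes.\<close>

lemma mixed_partials_eq_real:
  fixes r r1 r2 r12 r21 :: "complex \<Rightarrow> real"
  assumes r: "\<And>w. (r has_derivative (\<lambda>h. Re h * r1 w + Im h * r2 w)) (at w)"
    and r1: "\<And>w. (r1 has_derivative (\<lambda>h. Re h * r11 w + Im h * r12 w)) (at w)"
    and r2: "\<And>w. (r2 has_derivative (\<lambda>h. Re h * r21 w + Im h * r22 w)) (at w)"
    and c: "continuous_on UNIV r12" "continuous_on UNIV r21"
  shows "r12 w = r21 w"
proof -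
  have hx: "((\<lambda>x. g (Complex x b)) has_real_derivative g1) (at x)"
    if "(g has_derivative (\<lambda>h. Re h * g1 + Im h * g2)) (at (Complex x b))" for g :: "complex \<Rightarrow> real" and g1 g2 x b
  proof -
    have "((\<lambda>x. Complex x b) has_derivative (\<lambda>h. of_real h)) (at x)"
      unfolding Complex_eq by (auto intro!: derivative_eq_intros)
    from diff_chain_at[OF this that] show ?thesis
      by (simp add: o_def has_field_derivative_def mult.commute[of _ g1])
  qed
  have hy: "((\<lambda>y. g (Complex a y)) has_real_derivative g2) (at y)"
    if "(g has_derivative (\<lambda>h. Re h * g1 + Im h * g2)) (at (Complex a y))" for g :: "complex \<Rightarrow> real" and g1 g2 a y
  proof -
    have "((\<lambda>y. Complex a y) has_derivative (\<lambda>h. \<i> * of_real h)) (at y)"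
      unfolding Complex_eq by (auto intro!: derivative_eq_intros)
    from diff_chain_at[OF this that] show ?thesis
      by (simp add: o_def has_field_derivative_def mult.commute[of _ g2])
  qed
  define a b where "a = Re w" and "b = Im w"
  have "\<exists>P Q. norm (P - w) \<le> 2 * s \<and> norm (Q - w) \<le> 2 * s \<and> r12 P = r21 Q" if s: "s > 0" for s
  proof -
    have close: "norm (Complex x y - w) \<le> 2 * s" if "a < x" "x < a + s" "b < y" "y < b + s" for x y
      using cmod_le[of "Complex x y - w"] that by (simp add: a_def b_def)
    let ?E = "r (Complex (a+s) (b+s)) - r (Complex (a+s) b) - r (Complex a (b+s)) + r (Complex a b)"
    have "\<exists>x>a. x < a + s \<and> (r (Complex (a+s) (b+s)) - r (Complex (a+s) b)) - (r (Complex a (b+s)) - r (Complex a b))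
        = (a + s - a) * (r1 (Complex x (b+s)) - r1 (Complex x b))"
      by (rule MVT2) (use s in \<open>auto intro!: DERIV_diff hx[OF r]\<close>)
    then obtain x where x: "a < x" "x < a + s" "?E = s * (r1 (Complex x (b+s)) - r1 (Complex x b))" by auto
    have "\<exists>y>b. y < b + s \<and> r1 (Complex x (b+s)) - r1 (Complex x b) = (b + s - b) * r12 (Complex x y)"
      by (rule MVT2) (use s in \<open>auto intro!: hy[OF r1]\<close>)
    then obtain y where y: "b < y" "y < b + s" "?E = s * s * r12 (Complex x y)" using x by auto
    have "\<exists>y>b. y < b + s \<and> (r (Complex (a+s) (b+s)) - r (Complex a (b+s))) - (r (Complex (a+s) b) - r (Complex a b))
        = (b + s - b) * (r2 (Complex (a+s) y) - r2 (Complex a y))"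
      by (rule MVT2) (use s in \<open>auto intro!: DERIV_diff hy[OF r]\<close>)
    then obtain y' where y': "b < y'" "y' < b + s" "?E = s * (r2 (Complex (a+s) y') - r2 (Complex a y'))" by auto
    have "\<exists>x>a. x < a + s \<and> r2 (Complex (a+s) y') - r2 (Complex a y') = (a + s - a) * r21 (Complex x y')"
      by (rule MVT2) (use s in \<open>auto intro!: hx[OF r2]\<close>)
    then obtain x' where x': "a < x'" "x' < a + s" "?E = s * s * r21 (Complex x' y')" using y' by auto
    have "r12 (Complex x y) = r21 (Complex x' y')" using y(3) x'(3) s by simp
    thus ?thesis using close[OF x(1,2) y(1,2)] close[OF x'(1,2) y'(1,2)] by blast
  qed
  hence "\<forall>n. \<exists>P Q. norm (P - w) \<le> 2 * inverse (real (Suc n)) \<and> norm (Q - w) \<le> 2 * inverse (real (Suc n)) \<and> r12 P = r21 Q"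
    by simp
  then obtain P Q where PQ: "\<And>n. norm (P n - w) \<le> 2 * inverse (real (Suc n))"
      "\<And>n. norm (Q n - w) \<le> 2 * inverse (real (Suc n))" "\<And>n. r12 (P n) = r21 (Q n)" by metis
  have lim: "(\<lambda>n. 2 * inverse (real (Suc n))) \<longlonglongrightarrow> 0"
    using tendsto_mult_right_zero[OF LIMSEQ_inverse_real_of_nat] .
  have "(\<lambda>n. P n - w) \<longlonglongrightarrow> 0" "(\<lambda>n. Q n - w) \<longlonglongrightarrow> 0"
    by (rule Lim_null_comparison[OF _ lim], use PQ in simp)+
  hence "P \<longlonglongrightarrow> w" "Q \<longlonglongrightarrow> w" by (simp_all add: LIM_zero_iff)
  hence "(\<lambda>n. r12 (P n)) \<longlonglongrightarrow> r12 w" "(\<lambda>n. r21 (Q n)) \<longlonglongrightarrow> r21 w"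
    using c unfolding continuous_on_sequentially o_def by blast+
  thus ?thesis unfolding PQ(3) by (rule LIMSEQ_unique)
qed

text \<open>Met by the extension by zero of a test function. The first index is the variable
  differentiated first. All bounds share one \<open>B\<close> and hold on the whole plane, so that
  estimates of averages are uniform.\<close>

locale C2_bounded =
  fixes f f1 f2 f11 f12 f21 f22 :: "complex \<Rightarrow> complex" and B :: real
  assumes f_deriv: "\<And>w. (f has_derivative rlin (f1 w) (f2 w)) (at w)"
    and f1_deriv: "\<And>w. (f1 has_derivative rlin (f11 w) (f12 w)) (at w)"
    and f2_deriv: "\<And>w. (f2 has_derivative rlin (f21 w) (f22 w)) (at w)"
    and cont2: "continuous_on UNIV f11" "continuous_on UNIV f12" "continuous_on UNIV f21" "continuous_on UNIV f22"
    and bound: "\<And>w. norm (f w) \<le> B" "\<And>w. norm (f1 w) \<le> B" "\<And>w. norm (f2 w) \<le> B"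
      "\<And>w. norm (f11 w) \<le> B" "\<And>w. norm (f12 w) \<le> B" "\<And>w. norm (f21 w) \<le> B" "\<And>w. norm (f22 w) \<le> B"
begin

lemma mixed_partials_eq: "f12 w = f21 w"
proof (rule complex_eqI)
  show "Re (f12 w) = Re (f21 w)"
  proof (rule mixed_partials_eq_real[where r = "\<lambda>w. Re (f w)" and ?r12.0 = "\<lambda>w. Re (f12 w)" and ?r21.0 = "\<lambda>w. Re (f21 w)"])
    show "((\<lambda>w. Re (f w)) has_derivative (\<lambda>h. Re h * Re (f1 w) + Im h * Re (f2 w))) (at w)" for w
      using has_derivative_Re[OF f_deriv] by (simp add: rlin_def)
    show "((\<lambda>w. Re (f1 w)) has_derivative (\<lambda>h. Re h * Re (f11 w) + Im h * Re (f12 w))) (at w)" for w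
      using has_derivative_Re[OF f1_deriv] by (simp add: rlin_def)
    show "((\<lambda>w. Re (f2 w)) has_derivative (\<lambda>h. Re h * Re (f21 w) + Im h * Re (f22 w))) (at w)" for w
      using has_derivative_Re[OF f2_deriv] by (simp add: rlin_def)
  qed (use cont2 in \<open>auto intro!: continuous_intros\<close>)
  show "Im (f12 w) = Im (f21 w)"
  proof (rule mixed_partials_eq_real[where r = "\<lambda>w. Im (f w)" and ?r12.0 = "\<lambda>w. Im (f12 w)" and ?r21.0 = "\<lambda>w. Im (f21 w)"])
    show "((\<lambda>w. Im (f w)) has_derivative (\<lambda>h. Re h * Im (f1 w) + Im h * Im (f2 w))) (at w)" for w
      using has_derivative_Im[OF f_deriv] by (simp add: rlin_def)
    show "((\<lambda>w. Im (f1 w)) has_derivative (\<lambda>h. Re h * Im (f11 w) + Im h * Im (f12 w))) (at w)" for w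
      using has_derivative_Im[OF f1_deriv] by (simp add: rlin_def)
    show "((\<lambda>w. Im (f2 w)) has_derivative (\<lambda>h. Re h * Im (f21 w) + Im h * Im (f22 w))) (at w)" for w
      using has_derivative_Im[OF f2_deriv] by (simp add: rlin_def)
  qed (use cont2 in \<open>auto intro!: continuous_intros\<close>)
qed

lemma cont: "continuous_on UNIV f" "continuous_on UNIV f1" "continuous_on UNIV f2"
  using has_derivative_continuous[OF f_deriv] has_derivative_continuous[OF f1_deriv]
    has_derivative_continuous[OF f2_deriv]
  by (simp_all add: continuous_on_eq_continuous_at)

lemmas cont_compose = cont[THEN continuous_on_compose2] cont2[THEN continuous_on_compose2]

lemma B_nonneg: "B \<ge> 0"
  using bound(1) norm_ge_zero order_trans by blast

definition Df :: "complex \<Rightarrow> complex \<Rightarrow> complex" where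
  "Df w h = rlin (f1 w) (f2 w) h"

definition hess :: "complex \<Rightarrow> complex \<Rightarrow> complex \<Rightarrow> complex" where
  "hess w h k = of_real (Re h) * rlin (f11 w) (f12 w) k + of_real (Im h) * rlin (f21 w) (f22 w) k"

text \<open>On the disk this is the Laplace-Beltrami operator in the form given by
  \<open>laplace_beltrami_eq\<close>; as a formula it is continuous on the whole plane.\<close>

definition lap :: "complex \<Rightarrow> complex" where
  "lap w = of_real ((1 - (norm w)\<^sup>2)\<^sup>2 / 4) * (f11 w + f22 w)"

lemma Df_add: "Df w (h + k) = Df w h + Df w k"
  by (simp add: Df_def rlin_def algebra_simps)

lemma Df_of_real: "Df w (of_real r * h) = of_real r * Df w h"
  by (simp add: Df_def rlin_def algebra_simps)

lemma Df_minus: "Df w (- h) = - Df w h"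
  by (simp add: Df_def rlin_def algebra_simps)

lemma hess_of_real_right: "hess w h (of_real r * k) = of_real r * hess w h k"
  by (simp add: hess_def rlin_def algebra_simps)

text \<open>The coefficients are the Wirtinger derivatives of type (2,0), (1,1) and (0,2). This form
  shows at a glance what remains in a sum over conformal directions: on \<open>h\<close> and
  \<open>\<i> * h\<close> the outer two cancel and the Euclidean Laplacian is left.\<close>

lemma hess_wirtinger:
  "hess w h k = (f11 w - f22 w - 2 * \<i> * f12 w) / 4 * (h * k)
     + (f11 w + f22 w) / 4 * (h * cnj k + cnj h * k)
     + (f11 w - f22 w + 2 * \<i> * f12 w) / 4 * (cnj h * cnj k)"
  unfolding hess_def rlin_def mixed_partials_eq[symmetric]
  by (simp add: complex_eq_iff field_simps)

lemma norm_rlin_le: "norm a \<le> C \<Longrightarrow> norm b \<le> C \<Longrightarrow> norm (rlin a b h) \<le> 2 * C * norm h"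
proof -
  assume "norm a \<le> C" "norm b \<le> C"
  hence "\<bar>Re h\<bar> * norm a \<le> norm h * C" "\<bar>Im h\<bar> * norm b \<le> norm h * C"
    using abs_Re_le_cmod[of h] abs_Im_le_cmod[of h] by (auto intro: mult_mono)
  thus ?thesis
    unfolding rlin_def by (intro norm_triangle_le) (simp add: norm_mult algebra_simps)
qed

lemma norm_Df_le: "norm (Df w h) \<le> 2 * B * norm h"
  unfolding Df_def by (rule norm_rlin_le[OF bound(2,3)])

lemma norm_hess_le: "norm (hess w h k) \<le> 4 * B * norm h * norm k"
proof -
  have "hess w h k = rlin (rlin (f11 w) (f12 w) k) (rlin (f21 w) (f22 w) k) h"
    by (simp add: hess_def rlin_def)
  hence "norm (hess w h k) \<le> 2 * (2 * B * norm k) * norm h"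
    using norm_rlin_le[OF norm_rlin_le[OF bound(4,5)] norm_rlin_le[OF bound(6,7)]] by metis
  thus ?thesis by (simp add: mult_ac)
qed

lemma norm_lap_le: "w \<in> disk \<Longrightarrow> norm (lap w) \<le> B"
proof -
  assume w: "w \<in> disk"
  have "(1 - (norm w)\<^sup>2)\<^sup>2 \<le> 1" using one_minus_norm_sq_pos[OF w] by (simp add: power_le_one)
  hence "norm (lap w) \<le> 1 / 4 * norm (f11 w + f22 w)"
    unfolding lap_def norm_mult norm_of_real by (intro mult_right_mono) auto
  also have "norm (f11 w + f22 w) \<le> B + B" by (intro norm_triangle_mono bound)
  finally show ?thesis using B_nonneg by simp
qed

lemma has_derivative_Df:
  assumes "(g has_derivative g') (at x)" "(p has_derivative p') (at x)"
  shows "((\<lambda>x. Df (g x) (p x)) has_derivative (\<lambda>k. hess (g x) (p x) (g' k) + Df (g x) (p' k))) (at x)"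
proof -
  have 1: "((\<lambda>x. f1 (g x)) has_derivative (\<lambda>k. rlin (f11 (g x)) (f12 (g x)) (g' k))) (at x)"
    using diff_chain_at[OF assms(1) f1_deriv] by (simp add: o_def)
  have 2: "((\<lambda>x. f2 (g x)) has_derivative (\<lambda>k. rlin (f21 (g x)) (f22 (g x)) (g' k))) (at x)"
    using diff_chain_at[OF assms(1) f2_deriv] by (simp add: o_def)
  show ?thesis unfolding Df_def rlin_def
    by (rule derivative_eq_intros 1[unfolded rlin_def] 2[unfolded rlin_def] assms refl)+
      (simp add: fun_eq_iff hess_def rlin_def algebra_simps)
qed

lemma has_derivative_f_compose:
  assumes "(g has_derivative g') (at x)"
  shows "((\<lambda>x. f (g x)) has_derivative (\<lambda>k. Df (g x) (g' k))) (at x)"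
  using diff_chain_at[OF assms f_deriv] by (simp add: o_def Df_def)

lemma rlin_scaleR: "rlin a b (r *\<^sub>R h) = r *\<^sub>R rlin a b h"
  by (simp add: rlin_def scaleR_conv_of_real algebra_simps)

lemma has_vector_derivative_Df:
  assumes "(g has_vector_derivative g') (at x)" "(p has_vector_derivative p') (at x)"
  shows "((\<lambda>x. Df (g x) (p x)) has_vector_derivative (hess (g x) (p x) g' + Df (g x) p')) (at x)"
  using has_derivative_Df[OF assms[unfolded has_vector_derivative_def]]
  unfolding has_vector_derivative_def
  by (simp add: hess_def Df_def rlin_scaleR scaleR_add_right)

lemma has_vector_derivative_f_compose:
  assumes "(g has_vector_derivative g') (at x)"
  shows "((\<lambda>x. f (g x)) has_vector_derivative Df (g x) g') (at x)"
  using has_derivative_f_compose[OF assms[unfolded has_vector_derivative_def]]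
  unfolding has_vector_derivative_def by (simp add: Df_def rlin_scaleR)

lemma continuous_on_Df:
  assumes "continuous_on S g" "continuous_on S p"
  shows "continuous_on S (\<lambda>x. Df (g x) (p x))"
  unfolding Df_def rlin_def using assms by (intro continuous_intros cont_compose) auto

lemma continuous_on_hess:
  assumes "continuous_on S g" "continuous_on S p" "continuous_on S q"
  shows "continuous_on S (\<lambda>x. hess (g x) (p x) (q x))"
  unfolding hess_def rlin_def using assms by (intro continuous_intros cont_compose) auto

lemma continuous_on_lap: "continuous_on S g \<Longrightarrow> continuous_on S (\<lambda>x. lap (g x))"
  unfolding lap_def by (intro continuous_intros cont_compose) auto

end

section \<open>Derivatives of the Moebius action\<close>

text \<open>First derivative of the Moebius map in its parameter \<open>x\<close>;
  \<open>mob_dxx\<close> is the second. Because the denominator contains \<open>cnj x\<close>, they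
  are real linear but not complex linear in the increments.\<close>

definition mob_dx :: "complex \<Rightarrow> complex \<Rightarrow> complex \<Rightarrow> complex" where
  "mob_dx x y h = h / (1 + cnj x * y) - (x + y) * y * cnj h / (1 + cnj x * y)\<^sup>2"

definition mob_dxx :: "complex \<Rightarrow> complex \<Rightarrow> complex \<Rightarrow> complex \<Rightarrow> complex" where
  "mob_dxx x y h k = 2 * (x + y) * y\<^sup>2 * cnj h * cnj k / (1 + cnj x * y) ^ 3
     - (h * y * cnj k + k * y * cnj h) / (1 + cnj x * y)\<^sup>2"

lemma mob_has_derivative:
  assumes "1 + cnj x * y \<noteq> 0"
  shows "((\<lambda>x. mob x y) has_derivative mob_dx x y) (at x)"
  unfolding mob_def using assms
  apply (auto intro!: derivative_eq_intros simp: fun_eq_iff mob_dx_def)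
  apply (simp add: divide_simps)
  apply algebra
  done

lemma mob_dx_has_derivative:
  assumes "1 + cnj x * y \<noteq> 0"
  shows "((\<lambda>x. mob_dx x y h) has_derivative mob_dxx x y h) (at x)"
  unfolding mob_dx_def using assms
  apply (auto intro!: derivative_eq_intros simp: fun_eq_iff mob_dxx_def)
  apply (simp add: divide_simps)
  apply algebra
  done

text \<open>Velocity of the geodesic through x when the Euclidean radius \<open>tau t\<close>, not
  arc length, is the parameter; \<open>mob_dir2\<close> is the corresponding acceleration. The
  factor (1 - tau^2) / 2 converts to arc length.\<close>

definition mob_dir :: "complex \<Rightarrow> real \<Rightarrow> real \<Rightarrow> complex" where
  "mob_dir x t \<theta> = of_real (1 - (norm x)\<^sup>2) * cis \<theta> / (1 + cnj x * (of_real (tau t) * cis \<theta>))\<^sup>2"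

definition mob_dir2 :: "complex \<Rightarrow> real \<Rightarrow> real \<Rightarrow> complex" where
  "mob_dir2 x t \<theta> = - 2 * of_real (1 - (norm x)\<^sup>2) * cnj x * (cis \<theta>)\<^sup>2 / (1 + cnj x * (of_real (tau t) * cis \<theta>)) ^ 3"

text \<open>Keeping x in a smaller ball keeps the denominator away from 0 even as y approaches the
  boundary; all bounds that are uniform in y come from here.\<close>

lemma norm_mob_denom_ge:
  assumes "norm x \<le> r" "r < 1" "y \<in> disk"
  shows "1 - r \<le> norm (1 + cnj x * y)"
proof -
  have "norm (cnj x * y) \<le> r * 1" unfolding norm_mult
    using assms order_trans[OF norm_ge_zero assms(1)] by (intro mult_mono) (auto simp: in_disk_iff)
  thus ?thesis using norm_diff_ineq[of 1 "cnj x * y"] by simp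
qed

text \<open>The 3 is 1 + 2, from the two terms of the derivative after both are put over the square
  of 1 - r, which is at most 1.\<close>

lemma norm_mob_dx_le:
  assumes "norm x \<le> r" "r < 1" "y \<in> disk"
  shows "norm (mob_dx x y h) \<le> 3 / (1 - r)\<^sup>2 * norm h"
proof -
  define d where "d = 1 - r"
  have d: "0 < d" "d \<le> 1" using assms order_trans[OF norm_ge_zero assms(1)] by (auto simp: d_def)
  have D: "d \<le> norm (1 + cnj x * y)" using norm_mob_denom_ge[OF assms] by (simp add: d_def)
  have xy: "norm ((x + y) * y) \<le> 2 * 1" unfolding norm_mult
    by (intro mult_mono norm_triangle_le) (use assms in \<open>auto simp: in_disk_iff\<close>)
  have "norm (mob_dx x y h) \<le> norm (h / (1 + cnj x * y)) + norm ((x + y) * y * cnj h / (1 + cnj x * y)\<^sup>2)"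
    unfolding mob_dx_def by (rule norm_triangle_ineq4)
  also have "norm (h / (1 + cnj x * y)) \<le> norm h / d"
    unfolding norm_divide using d D by (intro divide_left_mono mult_pos_pos) auto
  also have "norm h / d \<le> norm h / d\<^sup>2"
    using d by (intro divide_left_mono) (auto simp: power2_eq_square mult_left_le)
  also have "norm ((x + y) * y * cnj h / (1 + cnj x * y)\<^sup>2) \<le> (2 * 1) * norm h / d\<^sup>2"
    unfolding norm_divide norm_mult[of "(x + y) * y"] norm_power using d D xy
    by (intro frac_le mult_mono power_mono) auto
  finally show ?thesis by (simp add: d_def field_simps)
qed

text \<open>The cubic term contributes 4, as |2 (x + y) y^2| is at most 4, and the quadratic term
  contributes 2 after its denominator is shrunk to the cube.\<close>

lemma norm_mob_dxx_le:
  assumes "norm x \<le> r" "r < 1" "y \<in> disk"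
  shows "norm (mob_dxx x y h k) \<le> 6 / (1 - r) ^ 3 * norm h * norm k"
proof -
  define d where "d = 1 - r"
  have d: "0 < d" "d \<le> 1" using assms order_trans[OF norm_ge_zero assms(1)] by (auto simp: d_def)
  have D: "d \<le> norm (1 + cnj x * y)" using norm_mob_denom_ge[OF assms] by (simp add: d_def)
  have y: "norm y \<le> 1" using assms by (simp add: in_disk_iff)
  have xy: "norm (2 * (x + y) * y\<^sup>2) \<le> 2 * 2 * 1" unfolding norm_mult norm_power
    by (intro mult_mono norm_triangle_le) (use assms y in \<open>auto intro: power_le_one\<close>)
  have "norm (mob_dxx x y h k) \<le> norm (2 * (x + y) * y\<^sup>2 * cnj h * cnj k / (1 + cnj x * y) ^ 3)
     + norm ((h * y * cnj k + k * y * cnj h) / (1 + cnj x * y)\<^sup>2)"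
    unfolding mob_dxx_def by (rule norm_triangle_ineq4)
  also have "norm (2 * (x + y) * y\<^sup>2 * cnj h * cnj k / (1 + cnj x * y) ^ 3) \<le> (2 * 2 * 1) * norm h * norm k / d ^ 3"
    unfolding norm_divide norm_mult[of "2 * (x + y) * y\<^sup>2 * cnj h"] norm_mult[of "2 * (x + y) * y\<^sup>2"] norm_power complex_mod_cnj using d D xy
    by (intro frac_le mult_mono power_mono) auto
  also have "norm ((h * y * cnj k + k * y * cnj h) / (1 + cnj x * y)\<^sup>2) \<le> (norm h * norm k + norm h * norm k) / d\<^sup>2"
  proof -
    have "norm h * norm y * norm k \<le> norm h * 1 * norm k" "norm k * norm y * norm h \<le> norm k * 1 * norm h"
      using y by (intro mult_mono; simp)+
    hence "norm (h * y * cnj k + k * y * cnj h) \<le> norm h * norm k + norm h * norm k"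
      by (intro norm_triangle_mono) (simp_all add: norm_mult mult.commute)
    thus ?thesis unfolding norm_divide norm_power using d D by (intro frac_le power_mono) auto
  qed
  also have "\<dots> \<le> (norm h * norm k + norm h * norm k) / d ^ 3"
    using d by (intro divide_left_mono power_decreasing) auto
  finally show ?thesis by (simp add: d_def add_divide_distrib[symmetric])
qed

lemma mob_rotate_derivative:
  assumes "x \<in> disk" "c \<in> disk"
  defines "y \<equiv> \<lambda>\<theta>. cis \<theta> * c"
  shows "((\<lambda>\<theta>. mob x (y \<theta>)) has_vector_derivative
     of_real (1 - (norm x)\<^sup>2) * \<i> * y \<theta> / (1 + cnj x * y \<theta>)\<^sup>2) (at \<theta>)"
proof -
  have nz: "1 + cnj x * y \<theta> \<noteq> 0"
    using mob_denom_nz assms by (simp add: in_disk_iff norm_mult)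
  have "(y has_vector_derivative \<i> * y \<theta>) (at \<theta>)"
    using has_vector_derivative_mult_left[OF has_vector_derivative_cis, of c \<theta>] by (simp add: y_def mult.assoc)
  from field_vector_diff_chain_at[OF this has_field_derivative_mob[OF nz]]
  show ?thesis by (simp add: o_def mult_ac)
qed

context C2_bounded begin

text \<open>The second summand on the right is the derivative of \<open>Df W (\<i> * W)\<close> when \<open>y\<close> is rotated about 0, so
  that it disappears after averaging over a circle.\<close>

lemma laplacian_mob_identity:
  assumes x: "x \<in> disk" and y: "y \<in> disk"
  defines "s \<equiv> complex_of_real (1 - (norm x)\<^sup>2)" and "W \<equiv> mob x y" and "D \<equiv> 1 + cnj x * y"
  shows "s\<^sup>2 / 4 * (hess W (mob_dx x y 1) (mob_dx x y 1) + Df W (mob_dxx x y 1 1)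
      + (hess W (mob_dx x y \<i>) (mob_dx x y \<i>) + Df W (mob_dxx x y \<i> \<i>)))
    = lap W + s * (hess W (\<i> * W) (s * \<i> * y / D\<^sup>2) + Df W (\<i> * (s * \<i> * y / D\<^sup>2)))"
proof -
  have D0: "D \<noteq> 0" using mob_denom_nz[OF x, of y] y by (simp add: D_def in_disk_iff)
  hence nz: "D \<noteq> 0" "cnj D \<noteq> 0" by simp_all
  define A P Q where "A = (f11 W + f22 W) / 4" and "P = (f11 W - f22 W - 2 * \<i> * f12 W) / 4"
    and "Q = (f11 W - f22 W + 2 * \<i> * f12 W) / 4"
  have hess: "hess W h k = P * (h * k) + A * (h * cnj k + cnj h * k) + Q * (cnj h * cnj k)" for h k
    unfolding hess_wirtinger A_def P_def Q_def ..
  have s: "s = 1 - x * cnj x" unfolding s_def of_real_diff complex_norm_square by simp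
  have cs: "cnj s = s" by (simp add: s_def)
  have W: "W = (x + y) / D" by (simp add: W_def mob_def D_def)
  have cW: "cnj W = (cnj x + cnj y) / cnj D" by (simp add: W)
  have cD: "cnj D = 1 + x * cnj y" by (simp add: D_def)
  \<comment> \<open>In this form the squares of the two directional derivatives add up to -4 W y /
    D^2, while the sum of their absolute squares is 2 (1 + |W y|^2) / |D|^2.\<close>
  have dx: "mob_dx x y 1 = (1 - W * y) / D" "mob_dx x y \<i> = \<i> * (1 + W * y) / D"
    unfolding mob_dx_def W D_def[symmetric] using nz by (simp_all add: field_simps power2_eq_square)
  have "Df W (mob_dxx x y 1 1) + Df W (mob_dxx x y \<i> \<i>) = Df W (- 4 * (y / D\<^sup>2))"
    unfolding Df_add[symmetric] mob_dxx_def D_def[symmetric] by (simp add: diff_divide_distrib mult.assoc)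
  also have "\<dots> = - 4 * Df W (y / D\<^sup>2)" using Df_of_real[of W "-4" "y / D\<^sup>2"] by simp
  finally have 1: "Df W (mob_dxx x y 1 1) + Df W (mob_dxx x y \<i> \<i>) = - 4 * Df W (y / D\<^sup>2)" .
  \<comment> \<open>Under rotation y has velocity \<open>\<i> * y\<close>; the two factors
    \<open>\<i>\<close> give the sign that makes the angular term match the first order part found
    above.\<close>
  have "\<i> * (s * \<i> * y / D\<^sup>2) = of_real (- (1 - (norm x)\<^sup>2)) * (y / D\<^sup>2)"
    unfolding of_real_minus s_def[symmetric] times_divide_eq_right[symmetric] using i_squared by algebra
  hence 2: "Df W (\<i> * (s * \<i> * y / D\<^sup>2)) = - s * Df W (y / D\<^sup>2)"
    by (simp only: Df_of_real) (simp add: s_def)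
  have "complex_of_real (1 - (norm W)\<^sup>2) = s * (1 - y * cnj y) / (D * cnj D)"
    unfolding W_def D_def one_minus_mob[OF nz(1)[unfolded D_def]] s_def
    by (simp only: of_real_divide of_real_mult of_real_diff of_real_1 complex_norm_square)
  hence lapW: "lap W = (s * (1 - y * cnj y) / (D * cnj D))\<^sup>2 * A"
    unfolding lap_def A_def by (simp only: of_real_divide of_real_power) simp
  \<comment> \<open>Splits the (1,1) coefficient: (1 - |y|^2)^2 becomes the conformal factor in
    \<open>lap W\<close>, and the other two terms are the mixed terms of the angular
    derivative.\<close>
  have key: "D * cnj D + (x + y) * (cnj x + cnj y) * y * cnj y =
     (1 - y * cnj y)\<^sup>2 + (x + y) * cnj y * D + (cnj x + cnj y) * y * cnj D"
    unfolding D_def cD[unfolded D_def] by algebra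
  have "s\<^sup>2 / 4 * (hess W (mob_dx x y 1) (mob_dx x y 1) + hess W (mob_dx x y \<i>) (mob_dx x y \<i>))
      = P * (- s\<^sup>2 * W * y / D\<^sup>2) + Q * (- s\<^sup>2 * cnj W * cnj y / (cnj D)\<^sup>2)
        + A * (s\<^sup>2 * (1 + W * y * cnj W * cnj y) / (D * cnj D))"
    unfolding hess dx by (simp add: divide_simps nz) (simp add: algebra_simps power2_eq_square)
  also have "s\<^sup>2 * (1 + W * y * cnj W * cnj y) / (D * cnj D)
      = (s * (1 - y * cnj y) / (D * cnj D))\<^sup>2 + s\<^sup>2 * (W * cnj y / (cnj D)\<^sup>2 + cnj W * y / D\<^sup>2)"
  proof -
    have "s\<^sup>2 * (1 + W * y * cnj W * cnj y) / (D * cnj D)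
        = s\<^sup>2 * (D * cnj D + (x + y) * (cnj x + cnj y) * y * cnj y) / (D * cnj D)\<^sup>2"
      unfolding W cW using nz by (simp add: field_simps power2_eq_square)
    also have "\<dots> = (s * (1 - y * cnj y) / (D * cnj D))\<^sup>2 + s\<^sup>2 * (W * cnj y / (cnj D)\<^sup>2 + cnj W * y / D\<^sup>2)"
      unfolding key unfolding W cW using nz by (simp add: field_simps power2_eq_square)
    finally show ?thesis .
  qed
  finally have 3: "s\<^sup>2 / 4 * (hess W (mob_dx x y 1) (mob_dx x y 1) + hess W (mob_dx x y \<i>) (mob_dx x y \<i>))
      = lap W + s * hess W (\<i> * W) (s * \<i> * y / D\<^sup>2)"
    unfolding hess lapW by (simp add: cs algebra_simps power2_eq_square)
  have "s\<^sup>2 / 4 * (hess W (mob_dx x y 1) (mob_dx x y 1) + Df W (mob_dxx x y 1 1)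
      + (hess W (mob_dx x y \<i>) (mob_dx x y \<i>) + Df W (mob_dxx x y \<i> \<i>)))
    = s\<^sup>2 / 4 * (hess W (mob_dx x y 1) (mob_dx x y 1) + hess W (mob_dx x y \<i>) (mob_dx x y \<i>))
      + s\<^sup>2 / 4 * (Df W (mob_dxx x y 1 1) + Df W (mob_dxx x y \<i> \<i>))" by (simp add: algebra_simps)
  thus ?thesis unfolding 1 2 3 by (simp add: algebra_simps power2_eq_square)
qed


text \<open>The derivative of \<open>sinh t * (f \<circ> W)'\<close> and the angular derivative of \<open>Df W (\<i> * v)\<close> add up to
  \<open>sinh t * lap W\<close>: this is the Laplacian in polar coordinates, multiplied by \<open>sinh t\<close> so that it has no
  singularity at the centre.\<close>

lemma radial_identity:
  assumes x: "x \<in> disk"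
  defines "s \<equiv> complex_of_real (1 - (norm x)\<^sup>2)"
    and "W \<equiv> \<lambda>t \<theta>. mob x (of_real (tau t) * cis \<theta>)"
    and "v \<equiv> mob_dir x" and "a \<equiv> mob_dir2 x"
  shows "((\<lambda>t. f (W t \<theta>)) has_vector_derivative of_real ((1 - (tau t)\<^sup>2) / 2) * Df (W t \<theta>) (v t \<theta>)) (at t)" (is ?A)
    and "((\<lambda>t. of_real (tau t) * Df (W t \<theta>) (v t \<theta>)) has_vector_derivative
       of_real ((1 - (tau t)\<^sup>2) / 2) * (Df (W t \<theta>) (v t \<theta>)
         + of_real (tau t) * (hess (W t \<theta>) (v t \<theta>) (v t \<theta>) + Df (W t \<theta>) (a t \<theta>)))) (at t)" (is ?B)
    and "((\<lambda>\<theta>. Df (W t \<theta>) (\<i> * v t \<theta>)) has_vector_derivative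
       of_real (tau t) * hess (W t \<theta>) (\<i> * v t \<theta>) (\<i> * v t \<theta>) - Df (W t \<theta>) (v t \<theta>)
         - of_real (tau t) * Df (W t \<theta>) (a t \<theta>)) (at \<theta>)" (is ?C)
    and "of_real (tau t * ((1 - (tau t)\<^sup>2) / 2)) * (hess (W t \<theta>) (v t \<theta>) (v t \<theta>)
         + hess (W t \<theta>) (\<i> * v t \<theta>) (\<i> * v t \<theta>)) = of_real (sinh t) * lap (W t \<theta>)" (is ?D)
proof -
  define D where "D t \<theta> = 1 + cnj x * (of_real (tau t) * cis \<theta>)" for t \<theta>
  have nz: "D t \<theta> \<noteq> 0" for t \<theta>
    using mob_denom_nz[OF x] tau_cis_in_disk[of "cis \<theta>" t] by (simp add: D_def in_disk_iff)
  have v: "v t \<theta> = s * cis \<theta> / (D t \<theta>)\<^sup>2" for t \<theta> by (simp only: v_def mob_dir_def s_def D_def)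
  have a: "a t \<theta> = - 2 * s * cnj x * (cis \<theta>)\<^sup>2 / (D t \<theta>) ^ 3" for t \<theta> by (simp only: a_def mob_dir2_def s_def D_def)
  note tau' = has_vector_derivative_of_real_tau and cis' = has_vector_derivative_cis
  have W_t: "((\<lambda>t. W t \<theta>) has_vector_derivative of_real ((1 - (tau t)\<^sup>2) / 2) * v t \<theta>) (at t)" for t \<theta>
    using mob_tau_derivative[OF x, of "cis \<theta>" t] by (simp add: W_def v_def mob_dir_def mult_ac)
  \<comment> \<open>\<open>mob x\<close> is holomorphic, so the angular and radial velocities both
    are multiples of one vector \<open>v\<close>, the former turned by a right angle.\<close>
  have W_\<theta>: "((\<lambda>\<theta>. W t \<theta>) has_vector_derivative of_real (tau t) * (\<i> * v t \<theta>)) (at \<theta>)" for t \<theta>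
  proof -
    have "((\<lambda>\<theta>. of_real (tau t) * cis \<theta>) has_vector_derivative of_real (tau t) * (\<i> * cis \<theta>)) (at \<theta>)"
      by (rule has_vector_derivative_mult_right[OF cis'])
    from field_vector_diff_chain_at[OF this has_field_derivative_mob[OF nz[unfolded D_def]]]
    show ?thesis by (simp add: W_def v_def mob_dir_def o_def mult_ac)
  qed
  have v_tau: "((\<lambda>\<tau>. s * e / (1 + cnj x * (\<tau> * e))\<^sup>2) has_field_derivative
      - 2 * s * cnj x * e\<^sup>2 / (1 + cnj x * (\<tau> * e)) ^ 3) (at \<tau>)" if "1 + cnj x * (\<tau> * e) \<noteq> 0" for \<tau> e
    apply (rule derivative_eq_intros refl | use that in \<open>simp; fail\<close>)+
    using that apply (simp add: divide_simps)
    apply algebra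
    done
  have v_t: "((\<lambda>t. v t \<theta>) has_vector_derivative of_real ((1 - (tau t)\<^sup>2) / 2) * a t \<theta>) (at t)" for t \<theta>
    using field_vector_diff_chain_at[OF tau' v_tau[OF nz[unfolded D_def]], of \<theta> t]
    unfolding v a D_def o_def .
  have v_e: "((\<lambda>e. s * e / (1 + cnj x * (\<tau> * e))\<^sup>2) has_field_derivative
      s / (1 + cnj x * (\<tau> * e))\<^sup>2 - 2 * s * cnj x * \<tau> * e / (1 + cnj x * (\<tau> * e)) ^ 3) (at e)"
    if "1 + cnj x * (\<tau> * e) \<noteq> 0" for \<tau> e
    apply (rule derivative_eq_intros refl | use that in \<open>simp; fail\<close>)+
    using that apply (simp add: divide_simps)
    apply algebra
    done
  have v_\<theta>: "((\<lambda>\<theta>. v t \<theta>) has_vector_derivative \<i> * v t \<theta> + \<i> * of_real (tau t) * a t \<theta>) (at \<theta>)" for t \<theta>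
  proof -
    have "\<i> * cis \<theta> * (s / (D t \<theta>)\<^sup>2 - 2 * s * cnj x * of_real (tau t) * cis \<theta> / (D t \<theta>) ^ 3)
        = \<i> * v t \<theta> + \<i> * of_real (tau t) * a t \<theta>"
      unfolding v a using nz[of t \<theta>] by (simp add: field_simps power2_eq_square)
    thus ?thesis
      using field_vector_diff_chain_at[OF cis' v_e[OF nz[unfolded D_def]], of t \<theta>]
      unfolding v[abs_def] D_def[abs_def] o_def by simp
  qed
  show ?A
    using has_vector_derivative_f_compose[OF W_t] by (simp only: Df_of_real)
  show ?B
    using has_vector_derivative_mult[OF tau'[of t] has_vector_derivative_Df[OF W_t[of \<theta> t] v_t[of \<theta> t]]]
    by (simp only: Df_of_real hess_of_real_right) (simp add: algebra_simps)
  have "\<i> * (\<i> * v t \<theta> + \<i> * of_real (tau t) * a t \<theta>) = - (v t \<theta> + of_real (tau t) * a t \<theta>)"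
    using i_squared by algebra
  hence "Df (W t \<theta>) (\<i> * (\<i> * v t \<theta> + \<i> * of_real (tau t) * a t \<theta>)) = - (Df (W t \<theta>) (v t \<theta>) + of_real (tau t) * Df (W t \<theta>) (a t \<theta>))"
    by (simp only: Df_minus Df_add Df_of_real)
  thus ?C
    using has_vector_derivative_Df[OF W_\<theta>[of t \<theta>] has_vector_derivative_mult_right[OF v_\<theta>[of t \<theta>], of \<i>]]
    by (simp add: hess_of_real_right add_diff_eq)
  show ?D
  proof -
    define q where "q = 1 - (tau t)\<^sup>2"
    have q: "q > 0" using tau_sq q_def by simp
    have nq: "1 - (norm (complex_of_real (tau t) * cis \<theta>))\<^sup>2 = q"
      by (simp add: norm_mult q_def)
    have "complex_of_real (1 - (norm (W t \<theta>))\<^sup>2) = s * of_real q / (D t \<theta> * cnj (D t \<theta>))"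
      unfolding W_def one_minus_mob[OF nz[unfolded D_def]] s_def D_def nq
      by (simp only: of_real_divide of_real_mult complex_norm_square)
    hence lap: "lap (W t \<theta>) = (s * of_real q / (D t \<theta> * cnj (D t \<theta>)))\<^sup>2 * ((f11 (W t \<theta>) + f22 (W t \<theta>)) / 4)"
      unfolding lap_def by (simp only: of_real_divide of_real_power) simp
    have vv: "v t \<theta> * cnj (v t \<theta>) = s\<^sup>2 / (D t \<theta> * cnj (D t \<theta>))\<^sup>2"
    proof -
      have "cis \<theta> * cnj (cis \<theta>) = 1" by (simp add: cis_cnj cis_mult)
      moreover have "cnj s = s" by (simp add: s_def)
      ultimately show ?thesis unfolding v using nz[of t \<theta>]
        by (simp add: field_simps power2_eq_square)
    qed
    \<comment> \<open>Passing from w to \<open>\<i> * w\<close> flips the sign of the outer terms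
      and keeps the middle one, so the trace of the Hessian over orthogonal directions is
      left.\<close>
    have gen: "P * (w * w) + S / 4 * (w * cnj w + cnj w * w) + Q * (cnj w * cnj w)
        + (P * (\<i> * w * (\<i> * w)) + S / 4 * (\<i> * w * cnj (\<i> * w) + cnj (\<i> * w) * (\<i> * w))
          + Q * (cnj (\<i> * w) * cnj (\<i> * w))) = S * (w * cnj w)" for P Q S w
      unfolding complex_cnj_mult complex_cnj_i using i_squared by algebra
    have hs: "hess (W t \<theta>) (v t \<theta>) (v t \<theta>) + hess (W t \<theta>) (\<i> * v t \<theta>) (\<i> * v t \<theta>)
        = (f11 (W t \<theta>) + f22 (W t \<theta>)) * (s\<^sup>2 / (D t \<theta> * cnj (D t \<theta>))\<^sup>2)"
      unfolding hess_wirtinger by (rule trans[OF gen]) (simp only: vv)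
    have sh: "complex_of_real (sinh t) = 2 * of_real (tau t) / of_real q"
      unfolding q_def sinh_tau by simp
    show ?thesis unfolding hs lap q_def[symmetric] sh using q nz[of t \<theta>]
      by (simp add: field_simps power2_eq_square)
  qed
qed

end

section \<open>Composition of radial operators\<close>

interpretation circle_circle: pair_sigma_finite circle circle
  by (simp add: pair_sigma_finite_def sigma_finite_circle)

lemma zero_ext_bound:
  assumes "\<And>y. y \<in> disk \<Longrightarrow> norm (h y) \<le> B"
  shows "norm (zero_ext h y) \<le> B"
proof -
  have "B \<ge> 0" using order_trans[OF norm_ge_zero assms[of 0]] by (simp add: in_disk_iff)
  thus ?thesis using assms by (simp add: zero_ext_def)
qed

lemma circle_mean_measurable:
  fixes h :: "complex \<Rightarrow> complex"
  assumes "continuous_on disk h" "x \<in> disk"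
  shows "(\<lambda>t. LINT \<theta>|circle. h (mob x (of_real (tau t) * cis \<theta>))) \<in> borel_measurable borel"
proof -
  note [measurable] = zero_ext_measurable[OF assms(1)]
  have "(\<lambda>t. LINT \<theta>|circle. zero_ext h (mob x (of_real (tau t) * cis \<theta>))) \<in> borel_measurable borel"
    using circle.borel_measurable_lebesgue_integral by measurable
  thus ?thesis by (simp add: zero_ext_mob[OF assms(2)])
qed

lemma norm_circle_mean_le:
  fixes h :: "complex \<Rightarrow> complex"
  assumes "\<And>y. y \<in> disk \<Longrightarrow> norm (h y) \<le> B" "x \<in> disk"
  shows "norm (LINT \<theta>|circle. h (mob x (of_real (tau t) * cis \<theta>))) \<le> 2 * pi * B"
  by (rule norm_integral_circle_le) (use assms mob_tau_cis_in_disk in auto)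

lemma integrable_wt_mult:
  assumes "Re z > 0" "K \<in> borel_measurable borel" "\<And>t. norm (K t) \<le> B"
  shows "integrable lborel (\<lambda>t. wt z t * K t)"
proof (rule Bochner_Integration.integrable_bound[of lborel "\<lambda>t. wt z t * of_real B"])
  show "AE t in lborel. norm (wt z t * K t) \<le> norm (wt z t * of_real B)"
    unfolding norm_mult norm_of_real
    by (intro AE_I2 mult_left_mono order_trans[OF assms(3) abs_ge_self] norm_ge_zero)
qed (use assms integrable_wt in auto)

lemma norm_wt_integral_le:
  assumes "Re z > 0" "\<And>t. norm (K t) \<le> B"
  shows "norm (LINT t|lborel. wt z t * K t) \<le> B / Re z"
proof -
  have "norm (LINT t|lborel. wt z t * K t) \<le> (LINT t|lborel. norm (wt z t) * B)"
    using integrable_wt[OF assms(1)] assms(2)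
    by (intro norm_integral_le) (auto simp: norm_mult intro!: mult_left_mono)
  thus ?thesis by (simp add: integral_norm_wt[OF assms(1)])
qed

lemma norm_radial_op_le:
  assumes "Re z > 0" "\<And>y. y \<in> disk \<Longrightarrow> norm (h y) \<le> B" "x \<in> disk"
  shows "norm (radial_op z h x) \<le> 2 * pi * B / Re z"
  unfolding radial_op_def
  by (rule norm_wt_integral_le[OF assms(1)]) (rule norm_circle_mean_le[OF assms(2,3)])

lemma continuous_on_mob_tau_cis:
  "continuous_on disk (\<lambda>x. mob x (of_real (tau t) * cis \<theta>))"
  by (intro continuous_on_mob continuous_intros) (auto simp: tau_cis_in_disk)

text \<open>With \<open>norm_radial_op_le\<close> this reproduces the hypotheses on
  \<open>h\<close>, so that radial operators can be composed.\<close>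

lemma continuous_on_radial_op:
  assumes z: "Re z > 0" and h: "continuous_on disk h" "\<And>y. y \<in> disk \<Longrightarrow> norm (h y) \<le> B"
  shows "continuous_on disk (radial_op z h)"
  unfolding radial_op_def[abs_def]
proof (rule continuous_on_integral[where g = "\<lambda>t. norm (wt z t) * (2 * pi * B)"])
  show "(\<lambda>t. wt z t * (LINT \<theta>|circle. h (mob x (of_real (tau t) * cis \<theta>)))) \<in> borel_measurable lborel"
    if "x \<in> disk" for x
    using circle_mean_measurable[OF h(1) that] by simp
  show "integrable lborel (\<lambda>t. norm (wt z t) * (2 * pi * B))"
    using integrable_wt[OF z] by simp
  show "norm (wt z t * (LINT \<theta>|circle. h (mob x (of_real (tau t) * cis \<theta>)))) \<le> norm (wt z t) * (2 * pi * B)"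
    if "x \<in> disk" for x t
    unfolding norm_mult by (intro mult_left_mono norm_circle_mean_le h(2) that norm_ge_zero)
  have "continuous_on disk (\<lambda>x. LINT \<theta>|circle. h (mob x (of_real (tau t) * cis \<theta>)))" for t
  proof (rule continuous_on_integral[where g = "\<lambda>_. B"])
    show "(\<lambda>\<theta>. h (mob x (of_real (tau t) * cis \<theta>))) \<in> borel_measurable circle" if "x \<in> disk" for x
    proof -
      note [measurable] = zero_ext_measurable[OF h(1)]
      have "(\<lambda>\<theta>. zero_ext h (mob x (of_real (tau t) * cis \<theta>))) \<in> borel_measurable circle" by measurable
      thus ?thesis by (simp add: zero_ext_mob[OF that])
    qed
    show "continuous_on disk (\<lambda>x. h (mob x (of_real (tau t) * cis \<theta>)))" for \<theta>
      by (rule continuous_on_compose2[OF h(1) continuous_on_mob_tau_cis]) (auto simp: mob_tau_cis_in_disk)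
  qed (use h(2) mob_tau_cis_in_disk in auto)
  thus "continuous_on disk (\<lambda>x. wt z t * (LINT \<theta>|circle. h (mob x (of_real (tau t) * cis \<theta>))))" for t
    by (intro continuous_intros)
qed

lemma radial_op_cong:
  assumes "x \<in> disk" "\<And>y. y \<in> disk \<Longrightarrow> g y = h y"
  shows "radial_op z g x = radial_op z h x"
  unfolding radial_op_def using assms mob_tau_cis_in_disk by simp

lemma radial_op_linear:
  assumes z: "Re z > 0" and x: "x \<in> disk"
    and g: "continuous_on disk g" "\<And>y. y \<in> disk \<Longrightarrow> norm (g y) \<le> B"
    and h: "continuous_on disk h" "\<And>y. y \<in> disk \<Longrightarrow> norm (h y) \<le> C"
  shows "radial_op z (\<lambda>y. a * g y + b * h y) x = a * radial_op z g x + b * radial_op z h x"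
proof -
  have i: "integrable circle (\<lambda>\<theta>. p (mob x (of_real (tau t) * cis \<theta>)))"
    if "continuous_on disk p" "\<And>y. y \<in> disk \<Longrightarrow> norm (p y) \<le> D" for p :: "complex \<Rightarrow> complex" and D t
  proof -
    note [measurable] = zero_ext_measurable[OF that(1)]
    have "integrable circle (\<lambda>\<theta>. zero_ext p (mob x (of_real (tau t) * cis \<theta>)))"
      by (rule integrable_circle_bounded[OF _ zero_ext_bound[OF that(2)]]) measurable
    thus ?thesis by (simp add: zero_ext_mob[OF x])
  qed
  have j: "integrable lborel (\<lambda>t. wt z t * (LINT \<theta>|circle. p (mob x (of_real (tau t) * cis \<theta>))))"
    if "continuous_on disk p" "\<And>y. y \<in> disk \<Longrightarrow> norm (p y) \<le> D" for p :: "complex \<Rightarrow> complex" and D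
    by (rule integrable_wt_mult[OF z circle_mean_measurable[OF that(1) x] norm_circle_mean_le[OF that(2) x]])
  show ?thesis
    unfolding radial_op_def using i[OF g] i[OF h] j[OF g] j[OF h]
    by (simp add: distrib_left mult.left_commute[of "wt z _"])
qed

section \<open>Two-step walks and commutation of radial operators\<close>

text \<open>The end point of a walk from 0: distance t in direction \<open>\<theta>\<close>, a turn
  by \<open>\<phi>\<close>, then distance s.\<close>

definition two_step :: "real \<Rightarrow> real \<Rightarrow> real \<Rightarrow> real \<Rightarrow> complex" where
  "two_step t s \<phi> \<theta> = cis \<theta> * mob (of_real (tau t)) (of_real (tau s) * cis \<phi>)"

lemma of_real_tau_in_disk: "of_real (tau t) \<in> disk"
  using tau_cis_in_disk[of 1 t] by simp

lemma two_step_in_disk: "two_step t s \<phi> \<theta> \<in> disk"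
  using mob_tau_cis_in_disk[OF of_real_tau_in_disk, of t s \<phi>]
  by (simp add: two_step_def in_disk_iff norm_mult)

lemma two_step_measurable [measurable (raw)]:
  assumes [measurable]: "a \<in> borel_measurable M" "b \<in> borel_measurable M" "c \<in> borel_measurable M" "d \<in> borel_measurable M"
  shows "(\<lambda>\<omega>. two_step (a \<omega>) (b \<omega>) (c \<omega>) (d \<omega>)) \<in> borel_measurable M"
  unfolding two_step_def by measurable

text \<open>Two orientation preserving isometries that map 0 to the same point differ by a rotation.\<close>

lemma mob_mob:
  assumes x: "x \<in> disk" and a: "\<bar>a\<bar> < 1" and b: "\<bar>b\<bar> < 1"
  obtains d where "\<And>\<phi>. mob (mob x (of_real a * cis \<theta>)) (of_real b * cis \<phi>)
      = mob x (cis \<theta> * mob (of_real a) (of_real b * cis (\<phi> + d)))"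
proof -
  define e where "e = cis \<theta>"
  define D where "D = 1 + cnj x * (of_real a * e)"
  have e: "cnj e * e = 1" by (simp add: e_def cis_cnj cis_mult)
  have ae: "of_real a * e \<in> disk" using a by (simp add: in_disk_iff norm_mult e_def)
  have D: "D \<noteq> 0" using mob_denom_nz[OF x] ae by (simp add: D_def in_disk_iff)
  hence cD: "cnj D \<noteq> 0" by simp
  \<comment> \<open>The relative rotation, found by comparing derivatives at 0: that of
    \<open>mob (mob x (of_real a * e))\<close> is positive, while that of the other composition is a
    positive multiple of e / D^2.\<close>
  define u where "u = cnj e * D / cnj D"
  have "norm u = 1" using D by (simp add: u_def norm_mult norm_divide e_def)
  then obtain d where d: "u = cis d" using cis_Arg_unique cis_Arg by (metis norm_eq_zero sgn_eq zero_neq_one div_by_1 of_real_1)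
  show ?thesis
  proof
    fix \<phi>
    define \<beta> where "\<beta> = of_real b * cis \<phi>"
    have \<beta>: "\<beta> \<in> disk" using b by (simp add: \<beta>_def in_disk_iff norm_mult)
    have \<beta>': "of_real b * cis (\<phi> + d) = u * \<beta>" by (simp add: \<beta>_def d mult_ac flip: cis_mult)
    have "u * \<beta> \<in> disk" using \<beta> \<open>norm u = 1\<close> by (simp add: in_disk_iff norm_mult)
    moreover have "complex_of_real a \<in> disk" using a by (simp add: in_disk_iff)
    ultimately have nz1: "1 + of_real a * (u * \<beta>) \<noteq> 0"
      and inner: "mob (of_real a) (u * \<beta>) \<in> disk"
      using mob_denom_nz[of "of_real a" "u * \<beta>"] mob_in_disk[of "of_real a" "u * \<beta>"] by (auto simp: in_disk_iff)
    have nz2: "1 + cnj x * (e * mob (of_real a) (u * \<beta>)) \<noteq> 0"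
      using mob_denom_nz[OF x, of "e * mob (of_real a) (u * \<beta>)"] inner by (simp add: in_disk_iff norm_mult e_def)
    have nz3: "1 + cnj (mob x (of_real a * e)) * \<beta> \<noteq> 0"
      using mob_denom_nz[OF mob_in_disk[OF x ae]] \<beta> by (simp add: in_disk_iff)
    have cDe: "cnj D = 1 + x * (of_real a * cnj e)" by (simp add: D_def)
    have r1: "u * e * cnj D = D" using e cD by (simp add: u_def field_simps)
    have r2: "u * cnj D = cnj e * D" using cD by (simp add: u_def)
    let ?m = "1 + of_real a * (u * \<beta>)"
    let ?N = "(x + of_real a * e) + u * \<beta> * (x * of_real a + e)"
    let ?M = "D + u * \<beta> * (of_real a + cnj x * e)"
    have R: "mob x (e * mob (of_real a) (u * \<beta>)) = ?N / ?M"
    proof -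
      have m: "e * mob (of_real a) (u * \<beta>) = e * (of_real a + u * \<beta>) / ?m" by (simp add: mob_def)
      have "x + e * (of_real a + u * \<beta>) / ?m = ?N / ?m" using nz1 by (simp add: field_simps)
      moreover have "1 + cnj x * (e * (of_real a + u * \<beta>) / ?m) = ?M / ?m"
        using nz1 by (simp add: field_simps D_def)
      ultimately show ?thesis unfolding m unfolding mob_def using nz1 by simp
    qed
    have "x * of_real a + e = e * cnj D" unfolding cDe using e by algebra
    hence N: "?N = (x + of_real a * e) + D * \<beta>" using r1 by algebra
    have cm: "cnj (mob x (of_real a * e)) = (cnj x + of_real a * cnj e) / cnj D" by (simp add: mob_def D_def)
    have "cnj D * ((of_real a + cnj x * e) * u) = (cnj x + of_real a * cnj e) * D" 
      using r2 e by algebra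
    hence "u * \<beta> * (of_real a + cnj x * e) = D * (cnj (mob x (of_real a * e)) * \<beta>)"
      unfolding cm using cD by (simp add: divide_simps) algebra
    hence M: "?M = D * (1 + cnj (mob x (of_real a * e)) * \<beta>)" by (simp add: algebra_simps)
    have "mob (mob x (of_real a * e)) \<beta> = ?N / ?M"
    proof -
      have "mob x (of_real a * e) + \<beta> = ?N / D"
        unfolding N mob_def[of x "of_real a * e"] D_def[symmetric] using D by (simp add: field_simps)
      thus ?thesis unfolding M mob_def[of "mob x (of_real a * e)"] using D nz3 by simp
    qed
    thus "mob (mob x (of_real a * cis \<theta>)) (of_real b * cis \<phi>)
      = mob x (cis \<theta> * mob (of_real a) (of_real b * cis (\<phi> + d)))"
      unfolding \<beta>' R[symmetric] e_def[symmetric] \<beta>_def[symmetric] by simp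
  qed
qed

definition two_step_mean :: "(complex \<Rightarrow> complex) \<Rightarrow> complex \<Rightarrow> real \<Rightarrow> real \<Rightarrow> complex" where
  "two_step_mean h x t s = (LINT \<phi>|circle. LINT \<theta>|circle. h (mob x (two_step t s \<phi> \<theta>)))"

lemma mob_two_step_in_disk: "x \<in> disk \<Longrightarrow> mob x (two_step t s \<phi> \<theta>) \<in> disk"
  by (simp add: mob_in_disk two_step_in_disk)

lemma zero_ext_two_step: "x \<in> disk \<Longrightarrow> zero_ext h (mob x (two_step t s \<phi> \<theta>)) = h (mob x (two_step t s \<phi> \<theta>))"
  by (simp add: zero_ext_def mob_two_step_in_disk)

lemma fubini_circle_circle:
  fixes H :: "real \<Rightarrow> real \<Rightarrow> complex"
  assumes [measurable]: "(\<lambda>p. H (fst p) (snd p)) \<in> borel_measurable (borel \<Otimes>\<^sub>M borel)"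
    and B: "\<And>t \<theta>. norm (H t \<theta>) \<le> B"
  shows "integrable (circle \<Otimes>\<^sub>M circle) (\<lambda>p. H (fst p) (snd p))"
    and "(LINT \<theta>|circle. LINT \<phi>|circle. H \<phi> \<theta>) = (LINT \<phi>|circle. LINT \<theta>|circle. H \<phi> \<theta>)"
proof -
  have 1: "integrable (circle \<Otimes>\<^sub>M circle) (\<lambda>p. complex_of_real B)"
    using integrable_pair_mult[OF sigma_finite_circle sigma_finite_circle, of "\<lambda>_. complex_of_real B" "\<lambda>_. 1"] by simp
  show 2: "integrable (circle \<Otimes>\<^sub>M circle) (\<lambda>p. H (fst p) (snd p))"
    by (rule Bochner_Integration.integrable_bound[OF 1]) (auto intro!: order_trans[OF B abs_ge_self])
  show "(LINT \<theta>|circle. LINT \<phi>|circle. H \<phi> \<theta>) = (LINT \<phi>|circle. LINT \<theta>|circle. H \<phi> \<theta>)"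
    by (rule circle_circle.Fubini_integral) (use 2 in \<open>simp add: case_prod_beta'\<close>)
qed

lemma radial_op_radial_op:
  assumes w: "Re w > 0" and z: "Re z > 0" and x: "x \<in> disk"
    and h: "continuous_on disk h" "\<And>y. y \<in> disk \<Longrightarrow> norm (h y) \<le> B"
  shows "radial_op w (radial_op z h) x
     = (LINT t|lborel. wt w t * (LINT s|lborel. wt z s * two_step_mean h x t s))"
proof -
  note [measurable] = zero_ext_measurable[OF h(1)]
  note zb = zero_ext_bound[OF h(2)]
  let ?H = "\<lambda>t s \<phi> \<theta>. zero_ext h (mob x (two_step t s \<phi> \<theta>))"
  have step: "radial_op z h (mob x (of_real (tau t) * cis \<theta>))
      = (LINT s|lborel. wt z s * (LINT \<phi>|circle. ?H t s \<phi> \<theta>))" for t \<theta>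
  proof -
    have "(LINT \<phi>|circle. h (mob (mob x (of_real (tau t) * cis \<theta>)) (of_real (tau s) * cis \<phi>)))
        = (LINT \<phi>|circle. ?H t s \<phi> \<theta>)" for s
    proof -
      \<comment> \<open>The rotation angle \<open>d\<close> depends on x, t, s and
        \<open>\<theta>\<close>, but not on \<open>\<phi>\<close>, so averaging over
        \<open>\<phi>\<close> removes it.\<close>
      obtain d where d: "\<And>\<phi>. mob (mob x (of_real (tau t) * cis \<theta>)) (of_real (tau s) * cis \<phi>)
          = mob x (two_step t s (\<phi> + d) \<theta>)"
        unfolding two_step_def by (rule mob_mob[OF x abs_tau abs_tau, of t \<theta> s]) blast
      have c: "continuous_on UNIV (\<lambda>\<phi>. h (mob x (two_step t s \<phi> \<theta>)))"
        unfolding two_step_def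
        by (rule continuous_on_compose2[OF h(1)])
          (use mob_two_step_in_disk[OF x] two_step_in_disk x in
            \<open>auto intro!: continuous_on_mob continuous_intros tau_cis_in_disk of_real_tau_in_disk simp: two_step_def\<close>)
      have "two_step t s (\<phi> + 2 * pi) \<theta> = two_step t s \<phi> \<theta>" for \<phi>
        by (simp add: two_step_def flip: cis_mult)
      hence "(LINT \<phi>|circle. h (mob x (two_step t s (\<phi> + d) \<theta>))) = (LINT \<phi>|circle. h (mob x (two_step t s \<phi> \<theta>)))"
        by (intro integral_circle_shift[OF c]) simp
      thus ?thesis by (simp add: d zero_ext_two_step[OF x])
    qed
    thus ?thesis by (simp add: radial_op_def)
  qed
  have inner: "(LINT \<theta>|circle. LINT s|lborel. wt z s * (LINT \<phi>|circle. ?H t s \<phi> \<theta>))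
      = (LINT s|lborel. wt z s * two_step_mean h x t s)" for t
  proof -
    have "(LINT \<theta>|circle. LINT s|lborel. wt z s * (LINT \<phi>|circle. ?H t s \<phi> \<theta>))
        = (LINT s|lborel. wt z s * (LINT \<theta>|circle. LINT \<phi>|circle. ?H t s \<phi> \<theta>))"
    proof (rule fubini_circle(2)[where B = "2 * pi * B"])
      show "(\<lambda>p. LINT \<phi>|circle. ?H t (fst p) \<phi> (snd p)) \<in> borel_measurable (lborel \<Otimes>\<^sub>M circle)"
        using circle.borel_measurable_lebesgue_integral by measurable
      show "norm (LINT \<phi>|circle. ?H t s \<phi> \<theta>) \<le> 2 * pi * B" for s \<theta>
        by (rule norm_integral_circle_le[OF zb])
    qed (rule integrable_wt[OF z])
    moreover have "(LINT \<theta>|circle. LINT \<phi>|circle. ?H t s \<phi> \<theta>) = (LINT \<phi>|circle. LINT \<theta>|circle. ?H t s \<phi> \<theta>)" for s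
      by (rule fubini_circle_circle(2)[OF _ zb]) measurable
    ultimately show ?thesis by (simp add: two_step_mean_def zero_ext_two_step[OF x])
  qed
  show ?thesis unfolding radial_op_def[of w] step inner ..
qed

text \<open>Points of equal modulus differ by a rotation, which is absorbed by a shift of
  \<open>\<theta>\<close>.\<close>

lemma circle_mean_norm_eq:
  fixes h :: "complex \<Rightarrow> complex"
  assumes x: "x \<in> disk" and h: "continuous_on disk h" and c: "c \<in> disk" "norm c = norm d"
  shows "(LINT \<theta>|circle. h (mob x (cis \<theta> * c))) = (LINT \<theta>|circle. h (mob x (cis \<theta> * d)))"
proof -
  obtain \<alpha> where "d = cis \<alpha> * c"
  proof (cases "c = 0")
    case False
    hence n: "norm (d / c) = 1" using c by (auto simp: norm_divide)
    have "cis (Arg w) = w" if "norm w = 1" for w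
      using cis_Arg[of w] that by (cases "w = 0") (auto simp: sgn_eq)
    hence "d / c = cis (Arg (d / c))" using n by metis
    thus ?thesis using False that[of "Arg (d / c)"] by (simp add: field_simps)
  qed (use c that[of 0] in auto)
  hence eq: "cis \<theta> * d = cis (\<theta> + \<alpha>) * c" for \<theta> by (simp add: mult_ac flip: cis_mult)
  have "continuous_on UNIV (\<lambda>\<theta>. h (mob x (cis \<theta> * c)))"
    by (rule continuous_on_compose2[OF h])
      (use c x in \<open>auto intro!: continuous_on_mob continuous_intros mob_in_disk simp: in_disk_iff norm_mult\<close>)
  from integral_circle_shift[OF this, of \<alpha>] show ?thesis unfolding eq by (simp flip: cis_mult)
qed

text \<open>The law of cosines: two sides and the turn between them determine the distance of the
  end point from the start, symmetrically in the sides. The mean over \<open>\<theta>\<close>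
  depends on that distance only.\<close>

lemma two_step_mean_commute:
  assumes x: "x \<in> disk" and h: "continuous_on disk h"
  shows "two_step_mean h x t s = two_step_mean h x s t"
proof -
  have "norm (mob (of_real a) (of_real b * cis \<phi>)) = norm (mob (of_real b) (of_real a * cis \<phi>))" for a b \<phi>
  proof -
    have "cis \<phi> * cis (- \<phi>) = 1" by (simp add: cis_mult)
    \<comment> \<open>Pulling out \<open>cis \<phi>\<close> and conjugating exchanges a and b in the
      numerator; the denominator contains only their product.\<close>
    hence "of_real a + of_real b * cis \<phi> = cis \<phi> * (of_real b + of_real a * cis (- \<phi>))" by algebra
    hence "norm (of_real a + of_real b * cis \<phi>) = norm (cis \<phi> * (of_real b + of_real a * cis (- \<phi>)))" by simp
    also have "\<dots> = norm (of_real b + of_real a * cis (- \<phi>))" by (simp add: norm_mult)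
    also have "\<dots> = norm (cnj (of_real b + of_real a * cis \<phi>))" by (simp add: cis_cnj)
    finally have "norm (of_real a + of_real b * cis \<phi>) = norm (of_real b + of_real a * cis \<phi>)" by (simp only: complex_mod_cnj)
    thus ?thesis by (simp add: mob_def norm_divide mult_ac)
  qed
  thus ?thesis unfolding two_step_mean_def two_step_def
    by (intro Bochner_Integration.integral_cong refl circle_mean_norm_eq[OF x h])
      (auto intro!: mob_tau_cis_in_disk of_real_tau_in_disk)
qed

lemma two_step_mean_measurable:
  assumes "continuous_on disk h" "x \<in> disk"
  shows "(\<lambda>p. two_step_mean h x (fst p) (snd p)) \<in> borel_measurable (borel \<Otimes>\<^sub>M borel)"
proof -
  note [measurable] = zero_ext_measurable[OF assms(1)]
  have "(\<lambda>p. LINT \<phi>|circle. LINT \<theta>|circle. zero_ext h (mob x (two_step (fst p) (snd p) \<phi> \<theta>)))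
      \<in> borel_measurable (borel \<Otimes>\<^sub>M borel)"
    using circle.borel_measurable_lebesgue_integral by measurable
  thus ?thesis by (simp add: two_step_mean_def zero_ext_two_step[OF assms(2)])
qed

lemma norm_two_step_mean_le:
  assumes "\<And>y. y \<in> disk \<Longrightarrow> norm (h y) \<le> B" "x \<in> disk"
  shows "norm (two_step_mean h x t s) \<le> 2 * pi * (2 * pi * B)"
  unfolding two_step_mean_def
  by (intro norm_integral_circle_le) (use assms mob_two_step_in_disk in auto)

text \<open>After Fubini in t and s the whole statement rests on the symmetry of the two-step mean,
  as each weight depends on its own distance alone.\<close>

lemma radial_op_commute:
  assumes w: "Re w > 0" and z: "Re z > 0" and x: "x \<in> disk"
    and h: "continuous_on disk h" "\<And>y. y \<in> disk \<Longrightarrow> norm (h y) \<le> B"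
  shows "radial_op w (radial_op z h) x = radial_op z (radial_op w h) x"
proof -
  let ?C = "2 * pi * (2 * pi * B)"
  note [measurable] = two_step_mean_measurable[OF h(1) x]
  have "integrable (lborel \<Otimes>\<^sub>M lborel) (\<lambda>p. wt w (fst p) * (wt z (snd p) * of_real ?C))"
    by (rule integrable_pair_mult[OF lborel.sigma_finite_measure_axioms lborel.sigma_finite_measure_axioms])
      (use integrable_wt[OF w] integrable_wt[OF z] in auto)
  hence "integrable (lborel \<Otimes>\<^sub>M lborel) (\<lambda>p. wt w (fst p) * (wt z (snd p) * two_step_mean h x (fst p) (snd p)))"
  proof (rule Bochner_Integration.integrable_bound)
    show "AE p in lborel \<Otimes>\<^sub>M lborel. norm (wt w (fst p) * (wt z (snd p) * two_step_mean h x (fst p) (snd p)))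
        \<le> norm (wt w (fst p) * (wt z (snd p) * complex_of_real ?C))"
      unfolding norm_mult[of "wt w _"] norm_mult[of "wt z _"] norm_of_real
      by (intro AE_I2 mult_left_mono order_trans[OF norm_two_step_mean_le[OF h(2) x] abs_ge_self] norm_ge_zero)
  qed measurable
  hence i: "integrable (lborel \<Otimes>\<^sub>M lborel) (\<lambda>(t, s). wt w t * (wt z s * two_step_mean h x t s))"
    by (simp add: case_prod_beta')
  have "radial_op w (radial_op z h) x = (LINT t|lborel. LINT s|lborel. wt w t * (wt z s * two_step_mean h x t s))"
    by (simp add: radial_op_radial_op[OF w z x h])
  also have "\<dots> = (LINT s|lborel. LINT t|lborel. wt w t * (wt z s * two_step_mean h x t s))"
    using lborel_pair.Fubini_integral[OF i] by simp
  also have "\<dots> = (LINT s|lborel. wt z s * (LINT t|lborel. wt w t * two_step_mean h x s t))"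
    by (simp add: mult.left_commute[of "wt w _"])
      (intro Bochner_Integration.integral_cong refl arg_cong2[where f = "(*)"] two_step_mean_commute x h)
  also have "\<dots> = radial_op z (radial_op w h) x" by (simp add: radial_op_radial_op[OF z w x h])
  finally show ?thesis .
qed

section \<open>The resolvent identity for radial operators\<close>

lemma continuous_pair_measurable:
  fixes g :: "real \<times> real \<Rightarrow> complex"
  assumes "continuous_on UNIV g"
  shows "g \<in> borel_measurable (lborel \<Otimes>\<^sub>M circle)"
proof -
  have "sets (lborel \<Otimes>\<^sub>M circle) = sets (borel :: (real \<times> real) measure)"
    unfolding borel_prod[symmetric] by (intro sets_pair_measure_cong) auto
  thus ?thesis using borel_measurable_continuous_onI[OF assms] by (simp cong: measurable_cong_sets)
qed

lemma mob_tau_denom_nz: "x \<in> disk \<Longrightarrow> 1 + cnj x * (of_real (tau t) * cis \<theta>) \<noteq> 0"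
  using mob_denom_nz[of x "of_real (tau t) * cis \<theta>"] tau_cis_in_disk[of "cis \<theta>" t] by (simp add: in_disk_iff)

lemma continuous_on_mob_path:
  assumes "x \<in> disk" "continuous_on S a" "continuous_on S b"
  shows "continuous_on S (\<lambda>p. mob x (of_real (tau (a p)) * cis (b p)))"
    and "continuous_on S (\<lambda>p. mob_dir x (a p) (b p))"
    and "continuous_on S (\<lambda>p. mob_dir2 x (a p) (b p))"
  unfolding mob_def mob_dir_def mob_dir2_def using assms mob_tau_denom_nz
  by (auto intro!: continuous_intros)

lemma norm_mob_dir_le:
  assumes "x \<in> disk"
  shows "norm (mob_dir x t \<theta>) \<le> 1 / (1 - norm x)\<^sup>2" and "norm (mob_dir2 x t \<theta>) \<le> 2 / (1 - norm x) ^ 3"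
proof -
  have x: "norm x < 1" using assms by (simp add: in_disk_iff)
  have D: "1 - norm x \<le> norm (1 + cnj x * (of_real (tau t) * cis \<theta>))"
    by (rule norm_mob_denom_ge[OF order_refl x]) (simp add: tau_cis_in_disk)
  have s: "\<bar>1 - (norm x)\<^sup>2\<bar> \<le> 1" using one_minus_norm_sq_pos[OF assms] by simp
  show "norm (mob_dir x t \<theta>) \<le> 1 / (1 - norm x)\<^sup>2"
    unfolding mob_dir_def norm_divide norm_mult[of "of_real _"] norm_of_real norm_power norm_cis mult_1_right
    using s D x by (intro frac_le power_mono) auto
  have "\<bar>1 - (norm x)\<^sup>2\<bar> * norm x \<le> 1 * 1" using s x by (intro mult_mono) auto
  thus "norm (mob_dir2 x t \<theta>) \<le> 2 / (1 - norm x) ^ 3"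
    unfolding mob_dir2_def norm_divide norm_mult[of _ "(cis \<theta>)\<^sup>2"] norm_mult[of _ "cnj x"] norm_mult[of "-2"] norm_of_real norm_power norm_cis
    using D x by (intro frac_le power_mono) auto
qed

text \<open>Unit hyperbolic speed in Euclidean terms. It bounds the time derivative of f along
  geodesics independently of x, in contrast to \<open>norm_mob_dir_le\<close>.\<close>

lemma mob_dir_tau_derivative:
  assumes "x \<in> disk"
  shows "norm (mob_dir x t \<theta>) * ((1 - (tau t)\<^sup>2) / 2) = (1 - (norm (mob x (of_real (tau t) * cis \<theta>)))\<^sup>2) / 2"
  using one_minus_norm_sq_pos[OF assms]
  by (simp add: one_minus_mob[OF mob_tau_denom_nz[OF assms]] mob_dir_def norm_divide norm_mult norm_power
      del: of_real_diff of_real_power)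

context C2_bounded begin

text \<open>With \<zeta> = z + 1, two integrations by parts move the radial derivatives onto the
  exponential and leave the coefficient \<zeta> cosh t - \<zeta>^2 sinh t for f. Its exp t and exp
  (-t) parts are -z (z+1) / 2 and (z+1) (z+2) / 2, which explains both constants.\<close>

lemma radial_op_recurrence:
  assumes z: "Re z > 0" and x: "x \<in> disk"
  shows "radial_op z (\<lambda>w. z * (z + 1) * f w - lap w) x
    = radial_op (z + 2) (\<lambda>w. (z + 1) * (z + 2) * f w - lap w) x"
proof -
  define W where "W t \<theta> = mob x (of_real (tau t) * cis \<theta>)" for t \<theta>
  define v where "v = mob_dir x"
  define a where "a = mob_dir2 x"
  define \<zeta> where "\<zeta> = z + 1"
  define q where "q t \<theta> = of_real (tau t) * Df (W t \<theta>) (v t \<theta>)" for t \<theta>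
  define \<tau>' where "\<tau>' t = complex_of_real ((1 - (tau t)\<^sup>2) / 2)" for t
  define q' where "q' t \<theta> = \<tau>' t * (Df (W t \<theta>) (v t \<theta>) + of_real (tau t) * (hess (W t \<theta>) (v t \<theta>) (v t \<theta>) + Df (W t \<theta>) (a t \<theta>)))" for t \<theta>
  define p' where "p' t \<theta> = of_real (tau t) * hess (W t \<theta>) (\<i> * v t \<theta>) (\<i> * v t \<theta>) - Df (W t \<theta>) (v t \<theta>) - of_real (tau t) * Df (W t \<theta>) (a t \<theta>)" for t \<theta>
  define h1 where "h1 w = z * (z + 1) * f w - lap w" for w
  define h2 where "h2 w = (z + 1) * (z + 2) * f w - lap w" for w
  note R = radial_identity[OF x, folded W_def v_def a_def \<tau>'_def]
  have Wd: "W t \<theta> \<in> disk" for t \<theta> by (simp add: W_def mob_tau_cis_in_disk[OF x])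
  have Wc: "continuous_on UNIV (\<lambda>p. W (fst p) (snd p))" "continuous_on UNIV (\<lambda>p. v (fst p) (snd p))"
      "continuous_on UNIV (\<lambda>p. a (fst p) (snd p))"
    unfolding W_def v_def a_def by (intro continuous_on_mob_path[OF x] continuous_intros)+
  have Wct: "continuous_on UNIV (\<lambda>t. W t \<theta>)" "continuous_on UNIV (\<lambda>t. v t \<theta>)" "continuous_on UNIV (\<lambda>t. a t \<theta>)" for \<theta>
    unfolding W_def v_def a_def by (intro continuous_on_mob_path[OF x] continuous_intros)+
  have Wc\<theta>: "continuous_on UNIV (\<lambda>\<theta>. W t \<theta>)" "continuous_on UNIV (\<lambda>\<theta>. v t \<theta>)" "continuous_on UNIV (\<lambda>\<theta>. a t \<theta>)" for t
    unfolding W_def v_def a_def by (intro continuous_on_mob_path[OF x] continuous_intros)+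
  have \<tau>'c: "continuous_on S g \<Longrightarrow> continuous_on S (\<lambda>p. \<tau>' (g p))" for g and S :: "'c::topological_space set"
    unfolding \<tau>'_def by (intro continuous_intros) auto
  have q'_eq: "q' t \<theta> = of_real (sinh t) * lap (W t \<theta>) - \<tau>' t * p' t \<theta>" for t \<theta>
    unfolding R(4)[symmetric] q'_def p'_def of_real_mult \<tau>'_def by (simp add: algebra_simps)
  define E where "E t = exp (- \<zeta> * complex_of_real t)" for t
  have E': "(E has_vector_derivative - \<zeta> * E t) (at t)" for t
    unfolding E_def by (rule has_vector_derivative_real_field) (auto intro!: derivative_eq_intros)
  have sinh': "((\<lambda>t. complex_of_real (sinh t)) has_vector_derivative of_real (cosh t)) (at t)" for t
    by (intro has_vector_derivative_of_real)
      (auto simp: has_real_derivative_iff_has_vector_derivative[symmetric] intro!: derivative_eq_intros)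
  \<comment> \<open>Collects the boundary terms of both integrations by parts, so that one
    application of the fundamental theorem suffices. As \<open>q\<close> contains the factor
    \<open>tau t\<close>, it vanishes at t = 0.\<close>
  define \<Psi> where "\<Psi> t \<theta> = E t * (q t \<theta> + \<zeta> * of_real (sinh t) * f (W t \<theta>))" for t \<theta>
  define \<Psi>' where "\<Psi>' t \<theta> = E t * (q' t \<theta> + (\<zeta> * of_real (cosh t) - \<zeta>\<^sup>2 * of_real (sinh t)) * f (W t \<theta>))" for t \<theta>
  have sq: "complex_of_real (sinh t) * (\<tau>' t * Df (W t \<theta>) (v t \<theta>)) = q t \<theta>" for t \<theta>
  proof -
    have "sinh t * ((1 - (tau t)\<^sup>2) / 2) = tau t" using tau_sq[of t] by (simp add: sinh_tau)
    thus ?thesis unfolding q_def \<tau>'_def by (simp only: mult.assoc[symmetric] of_real_mult[symmetric])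
  qed
  have \<Psi>_deriv: "((\<lambda>t. \<Psi> t \<theta>) has_vector_derivative \<Psi>' t \<theta>) (at t)" for t \<theta>
  proof -
    have "((\<lambda>t. \<Psi> t \<theta>) has_vector_derivative
        E t * (q' t \<theta> + \<zeta> * (of_real (sinh t) * (\<tau>' t * Df (W t \<theta>) (v t \<theta>)) + of_real (cosh t) * f (W t \<theta>)))
        + - \<zeta> * E t * (q t \<theta> + \<zeta> * (of_real (sinh t) * f (W t \<theta>)))) (at t)"
      unfolding \<Psi>_def mult.assoc[of \<zeta>] q_def q'_def
      by (intro has_vector_derivative_mult has_vector_derivative_add has_vector_derivative_mult_right E' sinh' R(1,2))
    thus ?thesis unfolding sq by (rule back_subst) (simp add: \<Psi>'_def algebra_simps power2_eq_square)
  qed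
  define Cv where "Cv = 1 / (1 - norm x)\<^sup>2"
  define Ca where "Ca = 2 / (1 - norm x) ^ 3"
  have v: "norm (v t \<theta>) \<le> Cv" and a: "norm (a t \<theta>) \<le> Ca" for t \<theta>
    unfolding v_def a_def Cv_def Ca_def by (rule norm_mob_dir_le[OF x])+
  have Cv0: "Cv \<ge> 0" and Ca0: "Ca \<ge> 0" using v[of 0 0] a[of 0 0] norm_ge_zero order_trans by blast+
  have tau1: "\<bar>tau t\<bar> \<le> 1" for t using abs_tau[of t] by simp
  have Dfv: "norm (Df (W t \<theta>) (v t \<theta>)) \<le> 2 * B * Cv" for t \<theta>
    using norm_Df_le[of "W t \<theta>" "v t \<theta>"] mult_left_mono[OF v[of t \<theta>], of "2 * B"] B_nonneg by simp
  have Dfa: "norm (Df (W t \<theta>) (a t \<theta>)) \<le> 2 * B * Ca" for t \<theta>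
    using norm_Df_le[of "W t \<theta>" "a t \<theta>"] mult_left_mono[OF a[of t \<theta>], of "2 * B"] B_nonneg by simp
  have hv: "norm (hess (W t \<theta>) (\<i> * v t \<theta>) (\<i> * v t \<theta>)) \<le> 4 * B * Cv * Cv" for t \<theta>
  proof -
    have "norm (hess (W t \<theta>) (\<i> * v t \<theta>) (\<i> * v t \<theta>)) \<le> 4 * B * norm (v t \<theta>) * norm (v t \<theta>)"
      using norm_hess_le[of "W t \<theta>" "\<i> * v t \<theta>" "\<i> * v t \<theta>"] by (simp add: norm_mult)
    also have "\<dots> \<le> 4 * B * Cv * Cv" using v[of t \<theta>] B_nonneg Cv0 by (intro mult_mono) auto
    finally show ?thesis .
  qed
  have q_bound: "norm (q t \<theta>) \<le> 2 * B * Cv" for t \<theta>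
    unfolding q_def norm_mult norm_of_real using mult_mono[OF tau1[of t] Dfv[of t \<theta>]] by simp
  define Cp where "Cp = 4 * B * Cv * Cv + 2 * B * Cv + 2 * B * Ca"
  have p'_bound: "norm (p' t \<theta>) \<le> Cp" for t \<theta>
  proof -
    have "norm (p' t \<theta>) \<le> norm (of_real (tau t) * hess (W t \<theta>) (\<i> * v t \<theta>) (\<i> * v t \<theta>))
        + norm (Df (W t \<theta>) (v t \<theta>)) + norm (of_real (tau t) * Df (W t \<theta>) (a t \<theta>))"
      unfolding p'_def by (intro order_trans[OF norm_triangle_ineq4] add_mono norm_triangle_ineq4 order_refl)
    also have "\<dots> \<le> 1 * (4 * B * Cv * Cv) + 2 * B * Cv + 1 * (2 * B * Ca)"
      unfolding norm_mult[of "of_real _"] norm_of_real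
      by (intro add_mono mult_mono tau1 hv Dfv Dfa) auto
    finally show ?thesis by (simp add: Cp_def)
  qed
  have \<tau>'_bound: "norm (\<tau>' t) \<le> 1" for t
  proof -
    have "\<bar>u / 2\<bar> \<le> 1" if "0 < u" "u \<le> 1" for u :: real using that by simp
    from this[OF tau_sq] show ?thesis unfolding \<tau>'_def norm_of_real by simp
  qed
  have h_bound: "norm (h1 w) \<le> norm (z * (z + 1)) * B + B" "norm (h2 w) \<le> norm ((z + 1) * (z + 2)) * B + B"
    if "w \<in> disk" for w
    unfolding h1_def h2_def
    by (intro order_trans[OF norm_triangle_ineq4] add_mono norm_lap_le[OF that];
        simp add: norm_mult mult_left_mono bound(1))+
  have h_cont: "continuous_on S (\<lambda>p. h1 (g p))" "continuous_on S (\<lambda>p. h2 (g p))"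
    if "continuous_on S g" for g and S :: "'d::topological_space set"
    unfolding h1_def h2_def using that by (intro continuous_intros cont_compose continuous_on_lap; auto)+
  have p'_cont: "continuous_on UNIV (\<lambda>p. p' (fst p) (snd p))" "continuous_on UNIV (\<lambda>t. p' t \<theta>)"
      "continuous_on UNIV (\<lambda>\<theta>. p' t \<theta>)" for t \<theta>
    unfolding p'_def by (intro continuous_intros continuous_on_Df continuous_on_hess Wc Wct Wc\<theta>)+
  have int: "integrable lborel (\<lambda>t. wt (z + 2) t * h2 (W t \<theta>))" "integrable lborel (\<lambda>t. wt z t * h1 (W t \<theta>))"
      "integrable lborel (\<lambda>t. wt \<zeta> t * (\<tau>' t * p' t \<theta>))" for \<theta>
  proof -
    show "integrable lborel (\<lambda>t. wt (z + 2) t * h2 (W t \<theta>))"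
      using z by (intro integrable_wt_mult[OF _ _ h_bound(2)[OF Wd]] borel_measurable_continuous_onI h_cont Wct) simp
    show "integrable lborel (\<lambda>t. wt z t * h1 (W t \<theta>))"
      using z by (intro integrable_wt_mult[OF _ _ h_bound(1)[OF Wd]] borel_measurable_continuous_onI h_cont Wct) simp
    show "integrable lborel (\<lambda>t. wt \<zeta> t * (\<tau>' t * p' t \<theta>))"
    proof (rule integrable_wt_mult)
      show "(\<lambda>t. \<tau>' t * p' t \<theta>) \<in> borel_measurable borel"
        by (intro borel_measurable_continuous_onI continuous_on_mult \<tau>'c p'_cont continuous_on_id)
      show "norm (\<tau>' t * p' t \<theta>) \<le> 1 * Cp" for t
        unfolding norm_mult by (intro mult_mono \<tau>'_bound p'_bound) auto
    qed (use z in \<open>simp add: \<zeta>_def\<close>)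
  qed
  \<comment> \<open>Multiplying the weight of \<zeta> by exp t or exp (-t) gives the weights of z
    and z + 2; what remains is an angular derivative.\<close>
  have split: "indicator {0..} t *\<^sub>R \<Psi>' t \<theta>
      = (wt (z + 2) t * h2 (W t \<theta>) - wt z t * h1 (W t \<theta>)) / 2 - wt \<zeta> t * (\<tau>' t * p' t \<theta>)" for t \<theta>
  proof (cases "t \<ge> 0")
    case True
    have e1: "exp (- z * of_real t) = E t * of_real (exp t)"
      unfolding E_def \<zeta>_def of_real_exp exp_add[symmetric] by (rule arg_cong[where f = exp]) algebra
    have e2: "exp (- (z + 2) * of_real t) = E t * of_real (exp (- t))"
      unfolding E_def \<zeta>_def of_real_exp of_real_minus exp_add[symmetric]
      by (rule arg_cong[where f = exp]) algebra
    have sc: "complex_of_real (sinh t) = (of_real (exp t) - of_real (exp (- t))) / 2"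
      "complex_of_real (cosh t) = (of_real (exp t) + of_real (exp (- t))) / 2"
      by (simp_all add: sinh_def cosh_def scaleR_conv_of_real)
    have "\<Psi>' t \<theta> = (E t * of_real (exp (- t)) * h2 (W t \<theta>) - E t * of_real (exp t) * h1 (W t \<theta>)) / 2
        - E t * (\<tau>' t * p' t \<theta>)"
      unfolding \<Psi>'_def q'_eq sc h1_def h2_def \<zeta>_def
      by (simp add: field_simps power2_eq_square)
    moreover have "wt (z + 2) t = E t * of_real (exp (- t))" "wt z t = E t * of_real (exp t)" "wt \<zeta> t = E t"
      unfolding e1[symmetric] e2[symmetric] using True by (simp_all add: wt_def E_def)
    ultimately show ?thesis using True by simp
  qed (simp add: wt_def)
  have zero: "(LINT t|lborel. indicator {0..} t *\<^sub>R \<Psi>' t \<theta>) = 0" for \<theta>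
  proof -
    have "(LINT t|lborel. indicator {0..} t *\<^sub>R \<Psi>' t \<theta>) = - \<Psi> 0 \<theta>"
    proof (rule integral_half_line_derivative[OF \<Psi>_deriv])
      show "continuous_on UNIV (\<lambda>t. \<Psi>' t \<theta>)"
        unfolding \<Psi>'_def q'_def E_def
        by (intro continuous_intros continuous_on_Df continuous_on_hess Wct \<tau>'c cont_compose) auto
      show "integrable lborel (\<lambda>t. indicator {0..} t *\<^sub>R \<Psi>' t \<theta>)"
        unfolding split using int[of \<theta>] by simp
      have lim: "((\<lambda>t. (2 * B * Cv + norm \<zeta> * B) * exp (- (Re z * t))) \<longlongrightarrow> 0) at_top"
        by (rule tendsto_mult_right_zero[OF tendsto_exp_minus_at_top[OF z]])
      show "((\<lambda>t. \<Psi> t \<theta>) \<longlongrightarrow> 0) at_top"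
      proof (rule Lim_null_comparison[OF _ lim])
        show "\<forall>\<^sub>F t in at_top. norm (\<Psi> t \<theta>) \<le> (2 * B * Cv + norm \<zeta> * B) * exp (- (Re z * t))"
          using eventually_ge_at_top[of 0]
        proof eventually_elim
          case (elim t)
          have E: "norm (E t) = exp (- (Re z * t)) * exp (- t)"
            by (simp add: E_def \<zeta>_def algebra_simps flip: exp_add)
          have "norm (\<Psi> t \<theta>) \<le> norm (E t) * (norm (q t \<theta>) + norm \<zeta> * \<bar>sinh t\<bar> * norm (f (W t \<theta>)))"
            unfolding \<Psi>_def norm_mult[of "E t"]
            by (intro mult_left_mono order_trans[OF norm_triangle_ineq]) (auto simp: norm_mult)
          \<comment> \<open>The growth of sinh t costs one unit of the decay rate Re z + 1, and the
            decay left over is exp (- Re z t).\<close>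
          also have "\<dots> \<le> norm (E t) * (2 * B * Cv * exp t + norm \<zeta> * exp t * B)"
          proof -
            have "2 * B * Cv * 1 \<le> 2 * B * Cv * exp t" using elim B_nonneg Cv0 by (intro mult_left_mono) auto
            hence "norm (q t \<theta>) \<le> 2 * B * Cv * exp t" using q_bound[of t \<theta>] by simp
            moreover have "\<bar>sinh t\<bar> \<le> exp t"
            proof -
              have "sinh t \<le> exp t" using sinh_plus_cosh[of t] cosh_real_pos[of t] by linarith
              thus ?thesis using elim by simp
            qed
            ultimately show ?thesis by (intro mult_left_mono add_mono mult_mono bound) auto
          qed
          also have "\<dots> = (2 * B * Cv + norm \<zeta> * B) * exp (- (Re z * t)) * (exp (- t) * exp t)"
            unfolding E by (simp add: algebra_simps)
          finally show ?case by (simp flip: exp_add)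
        qed
      qed
    qed
    thus ?thesis by (simp add: \<Psi>_def q_def)
  qed
  have eq: "(LINT t|lborel. wt (z + 2) t * h2 (W t \<theta>)) - (LINT t|lborel. wt z t * h1 (W t \<theta>))
      = 2 * (LINT t|lborel. wt \<zeta> t * (\<tau>' t * p' t \<theta>))" for \<theta>
    using zero[of \<theta>] int[of \<theta>] unfolding split by simp
  have z2: "Re (z + 2) > 0" "Re \<zeta> > 0" using z by (auto simp: \<zeta>_def)
  note F1 = fubini_circle[OF continuous_pair_measurable[OF h_cont(1)[OF Wc(1)]] h_bound(1)[OF Wd] integrable_wt[OF z]]
  note F2 = fubini_circle[OF continuous_pair_measurable[OF h_cont(2)[OF Wc(1)]] h_bound(2)[OF Wd] integrable_wt[OF z2(1)]]
  have "radial_op (z + 2) h2 x - radial_op z h1 x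
      = (LINT \<theta>|circle. (LINT t|lborel. wt (z + 2) t * h2 (W t \<theta>)) - (LINT t|lborel. wt z t * h1 (W t \<theta>)))"
    using F1 F2 by (simp add: radial_op_def W_def)
  also have "\<dots> = 2 * (LINT \<theta>|circle. LINT t|lborel. wt \<zeta> t * (\<tau>' t * p' t \<theta>))"
    unfolding eq by simp
  also have "(LINT \<theta>|circle. LINT t|lborel. wt \<zeta> t * (\<tau>' t * p' t \<theta>))
      = (LINT t|lborel. wt \<zeta> t * (LINT \<theta>|circle. \<tau>' t * p' t \<theta>))"
  proof (rule fubini_circle(2)[where B = "1 * Cp"])
    show "(\<lambda>p. \<tau>' (fst p) * p' (fst p) (snd p)) \<in> borel_measurable (lborel \<Otimes>\<^sub>M circle)"
      by (intro continuous_pair_measurable continuous_on_mult \<tau>'c p'_cont continuous_intros)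
    show "norm (\<tau>' t * p' t \<theta>) \<le> 1 * Cp" for t \<theta>
      unfolding norm_mult by (intro mult_mono \<tau>'_bound p'_bound) auto
  qed (rule integrable_wt[OF z2(2)])
  also have "\<dots> = 0"
  proof -
    \<comment> \<open>\<open>p'\<close> is the derivative in the angle of a 2 pi periodic
      function.\<close>
    have "(LINT \<theta>|circle. p' t \<theta>) = Df (W t (2*pi)) (\<i> * v t (2*pi)) - Df (W t 0) (\<i> * v t 0)" for t
      by (rule integral_circle_derivative[OF _ p'_cont(3)]) (unfold p'_def, rule R(3))
    hence "(LINT \<theta>|circle. p' t \<theta>) = 0" for t by (simp add: W_def v_def mob_dir_def)
    thus ?thesis by simp
  qed
  finally show ?thesis unfolding h1_def h2_def by simp
qed

text \<open>A single integration by parts along each geodesic: the boundary term is f x, integrated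
  over directions to 2 pi f x, and the error is governed by the derivative along a unit speed
  geodesic. The bound is the same for all x, so it can be inserted under a second radial
  operator.\<close>

lemma radial_op_asymptotic:
  assumes z: "Re z > 0" and x: "x \<in> disk"
  shows "norm (z * radial_op z f x - 2 * pi * f x) \<le> 2 * pi * B / Re z"
proof -
  define W where "W t \<theta> = mob x (of_real (tau t) * cis \<theta>)" for t \<theta>
  define v where "v = mob_dir x"
  define \<phi> where "\<phi> t \<theta> = of_real ((1 - (tau t)\<^sup>2) / 2) * Df (W t \<theta>) (v t \<theta>)" for t \<theta>
  note R = radial_identity(1)[OF x, folded W_def v_def, folded \<phi>_def]
  have Wd: "W t \<theta> \<in> disk" for t \<theta> by (simp add: W_def mob_tau_cis_in_disk[OF x])
  have Wc: "continuous_on UNIV (\<lambda>p. W (fst p) (snd p))" "continuous_on UNIV (\<lambda>p. v (fst p) (snd p))"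
    unfolding W_def v_def by (intro continuous_on_mob_path[OF x] continuous_intros)+
  have Wct: "continuous_on UNIV (\<lambda>t. W t \<theta>)" "continuous_on UNIV (\<lambda>t. v t \<theta>)" for \<theta>
    unfolding W_def v_def by (intro continuous_on_mob_path[OF x] continuous_intros)+
  have \<phi>c: "continuous_on UNIV (\<lambda>p. \<phi> (fst p) (snd p))" "continuous_on UNIV (\<lambda>t. \<phi> t \<theta>)" for \<theta>
    unfolding \<phi>_def by (intro continuous_intros continuous_on_Df Wc Wct; simp)+
  have fc: "continuous_on UNIV (\<lambda>p. f (W (fst p) (snd p)))" "continuous_on UNIV (\<lambda>t. f (W t \<theta>))" for \<theta>
    by (intro cont_compose Wc Wct; simp)+
  have \<phi>_bound: "norm (\<phi> t \<theta>) \<le> B" for t \<theta>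
  proof -
    have q: "(1 - (tau t)\<^sup>2) / 2 > 0" using tau_sq[of t] by simp
    have "norm (\<phi> t \<theta>) = (1 - (tau t)\<^sup>2) / 2 * norm (Df (W t \<theta>) (v t \<theta>))"
      unfolding \<phi>_def norm_mult norm_of_real using q by simp
    also have "\<dots> \<le> (1 - (tau t)\<^sup>2) / 2 * (2 * B * norm (v t \<theta>))"
      by (intro mult_left_mono norm_Df_le) (use q in simp)
    also have "\<dots> = 2 * B * (norm (v t \<theta>) * ((1 - (tau t)\<^sup>2) / 2))" by simp
    also have "\<dots> = 2 * B * ((1 - (norm (W t \<theta>))\<^sup>2) / 2)"
      unfolding v_def W_def mob_dir_tau_derivative[OF x] ..
    also have "\<dots> \<le> 2 * B * (1 / 2)" using B_nonneg by (intro mult_left_mono) auto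
    finally show ?thesis by simp
  qed
  define E where "E t = exp (- z * complex_of_real t)" for t
  have E': "(E has_vector_derivative - z * E t) (at t)" for t
    unfolding E_def by (rule has_vector_derivative_real_field) (auto intro!: derivative_eq_intros)
  have int: "integrable lborel (\<lambda>t. wt z t * f (W t \<theta>))" "integrable lborel (\<lambda>t. wt z t * \<phi> t \<theta>)" for \<theta>
    by (intro integrable_wt_mult[OF z _ bound(1)] integrable_wt_mult[OF z _ \<phi>_bound]
        borel_measurable_continuous_onI fc \<phi>c)+
  have split: "indicator {0..} t *\<^sub>R (E t * \<phi> t \<theta> + - z * E t * f (W t \<theta>))
      = wt z t * \<phi> t \<theta> - z * (wt z t * f (W t \<theta>))" for t \<theta>
    by (simp add: wt_def E_def algebra_simps)
  have eq: "z * (LINT t|lborel. wt z t * f (W t \<theta>)) = f x + (LINT t|lborel. wt z t * \<phi> t \<theta>)" for \<theta>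
  proof -
    have "(LINT t|lborel. indicator {0..} t *\<^sub>R (E t * \<phi> t \<theta> + - z * E t * f (W t \<theta>))) = - (E 0 * f (W 0 \<theta>))"
    proof (rule integral_half_line_derivative)
      show "((\<lambda>t. E t * f (W t \<theta>)) has_vector_derivative E t * \<phi> t \<theta> + - z * E t * f (W t \<theta>)) (at t)" for t
        by (intro has_vector_derivative_mult E' R)
      show "continuous_on UNIV (\<lambda>t. E t * \<phi> t \<theta> + - z * E t * f (W t \<theta>))"
        unfolding E_def by (intro continuous_intros \<phi>c fc)
      show "integrable lborel (\<lambda>t. indicator {0..} t *\<^sub>R (E t * \<phi> t \<theta> + - z * E t * f (W t \<theta>)))"
        unfolding split using int[of \<theta>] by simp
      have lim: "((\<lambda>t. exp (- (Re z * t)) * B) \<longlongrightarrow> 0) at_top"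
        by (rule tendsto_mult_left_zero[OF tendsto_exp_minus_at_top[OF z]])
      show "((\<lambda>t. E t * f (W t \<theta>)) \<longlongrightarrow> 0) at_top"
        by (rule Lim_null_comparison[OF _ lim])
          (auto simp: E_def norm_mult intro!: always_eventually mult_left_mono bound)
    qed
    hence "(LINT t|lborel. wt z t * \<phi> t \<theta>) - z * (LINT t|lborel. wt z t * f (W t \<theta>)) = - f x"
      unfolding split using int[of \<theta>] by (simp add: E_def W_def mob_def)
    thus ?thesis by (simp add: algebra_simps)
  qed
  note F1 = fubini_circle[OF continuous_pair_measurable[OF fc(1)] bound(1) integrable_wt[OF z]]
  note F2 = fubini_circle[OF continuous_pair_measurable[OF \<phi>c(1)] \<phi>_bound integrable_wt[OF z]]
  have "z * radial_op z f x = (LINT \<theta>|circle. z * (LINT t|lborel. wt z t * f (W t \<theta>)))"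
    using F1(2) by (simp add: radial_op_def W_def)
  also have "\<dots> = (LINT \<theta>|circle. f x) + (LINT \<theta>|circle. LINT t|lborel. wt z t * \<phi> t \<theta>)"
    unfolding eq using F2(3) by (intro Bochner_Integration.integral_add) auto
  finally have "z * radial_op z f x - 2 * pi * f x = (LINT \<theta>|circle. LINT t|lborel. wt z t * \<phi> t \<theta>)"
    by (simp add: measure_circle scaleR_conv_of_real)
  also have "norm \<dots> \<le> 2 * pi * (B / Re z)"
    by (intro norm_integral_circle_le norm_wt_integral_le z \<phi>_bound)
  finally show ?thesis by simp
qed

lemma radial_op_resolvent:
  assumes z: "Re z > 0" and x: "x \<in> disk"
  shows "radial_op (z + 1) (radial_op z (\<lambda>w. z * (z + 1) * f w - lap w)) x = 4 * pi\<^sup>2 * f x"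
proof -
  define g where "g z w = z * (z + 1) * f w - lap w" for z w
  define Q where "Q z = radial_op (z + 1) (radial_op z (g z)) x" for z
  have gc: "continuous_on disk (g z)" for z
    unfolding g_def[abs_def] by (intro continuous_intros cont_compose continuous_on_lap; simp)
  have gb: "norm (g z w) \<le> norm (z * (z + 1)) * B + B" if "w \<in> disk" for z w
    unfolding g_def by (intro order_trans[OF norm_triangle_ineq4] add_mono norm_lap_le[OF that])
      (simp add: norm_mult mult_left_mono bound(1))
  have fc: "continuous_on disk f" "continuous_on disk lap"
    using cont(1) continuous_on_lap[OF continuous_on_id] continuous_on_subset by blast+
  \<comment> \<open>The factor (z+1) (z+2) on the right of the recurrence is z (z+1) with z replaced
    by z + 1, so the recurrence lands on \<open>g (z + 1)\<close>; commuting then puts the two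
    operators in the order required by \<open>Q (z + 1)\<close>.\<close>
  have step: "Q z = Q (z + 1)" if z: "Re z > 0" for z
  proof -
    have "Q z = radial_op (z + 1) (radial_op (z + 1 + 1) (g (z + 1))) x"
      unfolding Q_def
    proof (rule radial_op_cong[OF x])
      fix y assume "y \<in> disk"
      thus "radial_op z (g z) y = radial_op (z + 1 + 1) (g (z + 1)) y"
        using radial_op_recurrence[OF z, of y] by (simp add: g_def[abs_def] add.assoc)
    qed
    also have "\<dots> = Q (z + 1)"
      unfolding Q_def by (rule radial_op_commute[OF _ _ x gc gb]) (use z in auto)
    finally show ?thesis .
  qed
  have Qn: "Q (z + of_nat n) = Q z" for n
  proof (induction n)
    case (Suc n)
    have "Q (z + of_nat (Suc n)) = Q ((z + of_nat n) + 1)" by (simp add: add_ac)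
    also have "\<dots> = Q (z + of_nat n)" by (rule step[symmetric]) (use z in simp)
    finally show ?case using Suc by simp
  qed simp
  \<comment> \<open>Shifts by integers leave the imaginary part fixed; this constant is chosen so
    that |\<zeta> + 1| + 1 is at most 2 M Re (\<zeta> + 1) along the whole sequence.\<close>
  define M where "M = 1 + \<bar>Im z\<bar>"
  define C where "C = 4 * pi\<^sup>2 * B * (2 * M + 1)"
  have est: "norm (Q \<zeta> - 4 * pi\<^sup>2 * f x) \<le> C / Re \<zeta>" if \<zeta>: "Re \<zeta> \<ge> 1" "Im \<zeta> = Im z" for \<zeta>
  proof -
    have r: "Re \<zeta> > 0" "Re (\<zeta> + 1) > 0" using \<zeta> by auto
    have Af: "continuous_on disk (radial_op \<zeta> f)" by (rule continuous_on_radial_op[OF r(1) fc(1) bound(1)])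
    have Al: "continuous_on disk (radial_op \<zeta> lap)" by (rule continuous_on_radial_op[OF r(1) fc(2) norm_lap_le])
    have Alb: "norm (radial_op \<zeta> lap y) \<le> 2 * pi * B / Re \<zeta>" if "y \<in> disk" for y
      by (rule norm_radial_op_le[OF r(1) norm_lap_le that])
    \<comment> \<open>Error of the inner asymptotics. In \<open>Q \<zeta>\<close> it is multiplied
      by \<zeta> + 1, which the outer operator, of size 2 pi / Re (\<zeta> + 1), compensates; the
      small size of \<open>e\<close> itself is what makes the product tend to 0. The main terms
      contribute 2 pi twice.\<close>
    define e where "e y = \<zeta> * radial_op \<zeta> f y - 2 * pi * f y" for y
    have ec: "continuous_on disk e" unfolding e_def[abs_def] by (intro continuous_intros Af fc)
    have eb: "norm (e y) \<le> 2 * pi * B / Re \<zeta>" if "y \<in> disk" for y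
      unfolding e_def by (rule radial_op_asymptotic[OF r(1) that])
    have lin: "radial_op \<zeta> (g \<zeta>) y = (2 * pi * (\<zeta> + 1)) * f y + 1 * ((\<zeta> + 1) * e y + (- 1) * radial_op \<zeta> lap y)" if "y \<in> disk" for y
    proof -
      have "radial_op \<zeta> (g \<zeta>) y = radial_op \<zeta> (\<lambda>w. (\<zeta> * (\<zeta> + 1)) * f w + (- 1) * lap w) y"
        by (simp add: g_def[abs_def])
      also have "\<dots> = (\<zeta> * (\<zeta> + 1)) * radial_op \<zeta> f y + (- 1) * radial_op \<zeta> lap y"
        by (rule radial_op_linear[OF r(1) that fc(1) bound(1) fc(2) norm_lap_le])
      finally show ?thesis by (simp add: e_def algebra_simps)
    qed
    let ?e2 = "\<lambda>y. (\<zeta> + 1) * e y + (- 1) * radial_op \<zeta> lap y"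
    have e2c: "continuous_on disk ?e2" by (intro continuous_intros ec Al)
    have e2b: "norm (?e2 y) \<le> (norm (\<zeta> + 1) + 1) * (2 * pi * B / Re \<zeta>)" if "y \<in> disk" for y
    proof -
      have "norm (?e2 y) \<le> norm (\<zeta> + 1) * norm (e y) + norm (radial_op \<zeta> lap y)"
        by (rule order_trans[OF norm_triangle_ineq]) (simp add: norm_mult)
      also have "\<dots> \<le> norm (\<zeta> + 1) * (2 * pi * B / Re \<zeta>) + 2 * pi * B / Re \<zeta>"
        by (intro add_mono mult_left_mono eb Alb that norm_ge_zero)
      finally show ?thesis by (simp add: algebra_simps add_divide_distrib)
    qed
    have "Q \<zeta> = radial_op (\<zeta> + 1) (\<lambda>y. (2 * pi * (\<zeta> + 1)) * f y + 1 * ?e2 y) x"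
      unfolding Q_def by (rule radial_op_cong[OF x lin])
    also have "\<dots> = (2 * pi * (\<zeta> + 1)) * radial_op (\<zeta> + 1) f x + 1 * radial_op (\<zeta> + 1) ?e2 x"
      by (rule radial_op_linear[OF r(2) x fc(1) bound(1) e2c e2b])
    finally have "Q \<zeta> - 4 * pi\<^sup>2 * f x
        = 2 * pi * ((\<zeta> + 1) * radial_op (\<zeta> + 1) f x - 2 * pi * f x) + radial_op (\<zeta> + 1) ?e2 x"
      by (simp add: algebra_simps power2_eq_square)
    also have "norm \<dots> \<le> 2 * pi * (2 * pi * B / Re (\<zeta> + 1)) + 2 * pi * ((norm (\<zeta> + 1) + 1) * (2 * pi * B / Re \<zeta>)) / Re (\<zeta> + 1)"
    proof (rule order_trans[OF norm_triangle_ineq], rule add_mono)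
      show "norm (2 * pi * ((\<zeta> + 1) * radial_op (\<zeta> + 1) f x - 2 * pi * f x)) \<le> 2 * pi * (2 * pi * B / Re (\<zeta> + 1))"
        using mult_left_mono[OF radial_op_asymptotic[OF r(2) x], of "2 * pi"] by (simp add: norm_mult)
      show "norm (radial_op (\<zeta> + 1) ?e2 x) \<le> 2 * pi * ((norm (\<zeta> + 1) + 1) * (2 * pi * B / Re \<zeta>)) / Re (\<zeta> + 1)"
        by (rule norm_radial_op_le[OF r(2) e2b x])
    qed
    also have "\<dots> = 4 * pi\<^sup>2 * B * (1 / Re (\<zeta> + 1) + (norm (\<zeta> + 1) + 1) / Re (\<zeta> + 1) * (1 / Re \<zeta>))"
      by (simp add: field_simps power2_eq_square)
    also have "\<dots> \<le> 4 * pi\<^sup>2 * B * (1 / Re \<zeta> + 2 * M * (1 / Re \<zeta>))"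
    proof -
      have "norm (\<zeta> + 1) \<le> Re (\<zeta> + 1) + \<bar>Im z\<bar>" using cmod_le[of "\<zeta> + 1"] r \<zeta> by simp
      moreover have "0 \<le> Re \<zeta> * \<bar>Im z\<bar>" using \<zeta> by simp
      moreover have "1 \<le> Re (\<zeta> + 1)" using \<zeta> by simp
      moreover have "2 * M * Re (\<zeta> + 1) = 2 * Re (\<zeta> + 1) + 2 * (Re \<zeta> * \<bar>Im z\<bar>) + 2 * \<bar>Im z\<bar>"
        by (simp add: M_def algebra_simps)
      ultimately have "norm (\<zeta> + 1) + 1 \<le> 2 * M * Re (\<zeta> + 1)" by linarith
      hence "(norm (\<zeta> + 1) + 1) / Re (\<zeta> + 1) \<le> 2 * M" using r by (simp add: divide_simps)
      moreover have "1 / Re (\<zeta> + 1) \<le> 1 / Re \<zeta>" using r by (simp add: frac_le)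
      ultimately show ?thesis using B_nonneg r by (intro mult_left_mono add_mono mult_right_mono) auto
    qed
    also have "\<dots> = C / Re \<zeta>" by (simp add: C_def field_simps add_divide_distrib)
    finally show ?thesis .
  qed
  have "(\<lambda>n::nat. Q z - 4 * pi\<^sup>2 * f x) \<longlonglongrightarrow> 0"
  proof (rule Lim_null_comparison)
    show "\<forall>\<^sub>F n in sequentially. norm (Q z - 4 * pi\<^sup>2 * f x) \<le> C / real n"
      using eventually_ge_at_top[of 1]
    proof eventually_elim
      case (elim n)
      have "norm (Q z - 4 * pi\<^sup>2 * f x) \<le> C / Re (z + of_nat n)"
        using est[of "z + of_nat n"] Qn[of n] z elim by simp
      also have "\<dots> \<le> C / real n"
        using elim z B_nonneg by (intro divide_left_mono) (auto simp: C_def M_def)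
      finally show ?case .
    qed
    show "(\<lambda>n. C / real n) \<longlonglongrightarrow> 0" by (rule lim_const_over_n)
  qed
  hence "Q z - 4 * pi\<^sup>2 * f x = 0" by (simp add: LIMSEQ_const_iff)
  thus ?thesis by (simp add: Q_def g_def[abs_def])
qed

end

section \<open>Regularity and Laplacian of averages over Moebius images\<close>

lemma bounded_linear_eq_rlin:
  assumes "bounded_linear L"
  shows "L = rlin (L 1) (L \<i>)"
proof
  fix h
  interpret bounded_linear L by fact
  have "h = Re h *\<^sub>R 1 + Im h *\<^sub>R \<i>" by (simp add: complex_eq_iff)
  hence "L h = L (Re h *\<^sub>R 1 + Im h *\<^sub>R \<i>)" by simp
  thus "L h = rlin (L 1) (L \<i>) h" unfolding add scale by (simp add: rlin_def scaleR_conv_of_real)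
qed

text \<open>Openness of \<open>U\<close> lets Frechet derivatives, known to equal \<open>u'\<close>
  only on \<open>U\<close>, be differentiated again.\<close>

lemma Ck_on_2I:
  fixes u :: "complex \<Rightarrow> complex"
  assumes "open U"
    and u: "\<And>x. x \<in> U \<Longrightarrow> (u has_derivative u' x) (at x)"
    and u': "\<And>x h. x \<in> U \<Longrightarrow> ((\<lambda>x. u' x h) has_derivative u'' x h) (at x)"
    and c: "\<And>h k. continuous_on U (\<lambda>x. u'' x h k)"
  shows "Ck_on 2 u U"
proof -
  have fd: "frechet_derivative u (at x) = u' x" if "x \<in> U" for x
    using frechet_derivative_at[OF u[OF that]] by simp
  have 2: "((\<lambda>x. frechet_derivative u (at x) h) has_derivative u'' x h) (at x)" if "x \<in> U" for x h
    by (rule has_derivative_transform_within_open[OF u'[OF that] assms(1) that]) (simp add: fd)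
  have fd2: "frechet_derivative (\<lambda>x. frechet_derivative u (at x) h) (at x) = u'' x h" if "x \<in> U" for x h
    using frechet_derivative_at[OF 2[OF that]] by simp
  have "continuous_on U (\<lambda>x. frechet_derivative (\<lambda>x. frechet_derivative u (at x) h) (at x) k)" for h k
    using c[of h k] by (rule continuous_on_eq) (simp add: fd2)
  thus ?thesis
    unfolding numeral_2_eq_2 Ck_on.simps differentiable_def using u 2 by blast
qed

context C2_bounded begin

lemma measurable_components [measurable]:
  "f \<in> borel_measurable borel" "f1 \<in> borel_measurable borel" "f2 \<in> borel_measurable borel"
  "f11 \<in> borel_measurable borel" "f12 \<in> borel_measurable borel"
  "f21 \<in> borel_measurable borel" "f22 \<in> borel_measurable borel"
  using cont cont2 by (auto intro: borel_measurable_continuous_onI)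

lemma measurable_Df [measurable (raw)]:
  assumes [measurable]: "g \<in> borel_measurable M" "p \<in> borel_measurable M"
  shows "(\<lambda>\<omega>. Df (g \<omega>) (p \<omega>)) \<in> borel_measurable M"
  unfolding Df_def rlin_def by measurable

lemma measurable_hess [measurable (raw)]:
  assumes [measurable]: "g \<in> borel_measurable M" "p \<in> borel_measurable M" "q \<in> borel_measurable M"
  shows "(\<lambda>\<omega>. hess (g \<omega>) (p \<omega>) (q \<omega>)) \<in> borel_measurable M"
  unfolding hess_def rlin_def by measurable

lemma measurable_lap [measurable]: "lap \<in> borel_measurable borel"
  by (intro borel_measurable_continuous_onI continuous_on_lap continuous_on_id)

end

text \<open>The weight \<open>k\<close> and the points \<open>Y\<close> do not depend on x; x enters
  only through \<open>mob x\<close>. In this form a kernel that is singular in the end point does no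
  harm to differentiability.\<close>

locale mob_average = C2_bounded +
  fixes M :: "'m measure" and k :: "'m \<Rightarrow> complex" and Y :: "'m \<Rightarrow> complex"
  assumes k: "integrable M k" and Y_meas [measurable]: "Y \<in> borel_measurable M"
    and Y: "\<And>\<omega>. Y \<omega> \<in> disk"
begin

definition u :: "complex \<Rightarrow> complex" where
  "u x = (LINT \<omega>|M. k \<omega> * f (mob x (Y \<omega>)))"

definition du :: "complex \<Rightarrow> complex \<Rightarrow> complex" where
  "du x h = (LINT \<omega>|M. k \<omega> * Df (mob x (Y \<omega>)) (mob_dx x (Y \<omega>) h))"

definition ddu :: "complex \<Rightarrow> complex \<Rightarrow> complex \<Rightarrow> complex" where
  "ddu x h l = (LINT \<omega>|M. k \<omega> * (hess (mob x (Y \<omega>)) (mob_dx x (Y \<omega>) h) (mob_dx x (Y \<omega>) l)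
      + Df (mob x (Y \<omega>)) (mob_dxx x (Y \<omega>) h l)))"

lemma k_meas [measurable]: "k \<in> borel_measurable M"
  using k by auto

lemma measurable_mob_dx [measurable]: "(\<lambda>\<omega>. mob_dx x (Y \<omega>) h) \<in> borel_measurable M"
  and measurable_mob_dxx [measurable]: "(\<lambda>\<omega>. mob_dxx x (Y \<omega>) h l) \<in> borel_measurable M"
  unfolding mob_dx_def mob_dxx_def by measurable

lemma integrable_k_mult:
  assumes "g \<in> borel_measurable M" "\<And>\<omega>. norm (g \<omega>) \<le> C"
  shows "integrable M (\<lambda>\<omega>. k \<omega> * g \<omega>)"
proof (rule Bochner_Integration.integrable_bound[of M "\<lambda>\<omega>. k \<omega> * of_real C"])
  show "AE \<omega> in M. norm (k \<omega> * g \<omega>) \<le> norm (k \<omega> * complex_of_real C)"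
    unfolding norm_mult norm_of_real
    by (intro AE_I2 mult_left_mono order_trans[OF assms(2) abs_ge_self] norm_ge_zero)
qed (use k assms(1) in auto)

lemma denom_nz: "x \<in> disk \<Longrightarrow> 1 + cnj x * Y \<omega> \<noteq> 0"
  using mob_denom_nz[of x "Y \<omega>"] Y[of \<omega>] by (simp add: in_disk_iff)

definition C1 :: "real \<Rightarrow> real" where
  "C1 r = 2 * B * (3 / (1 - r)\<^sup>2)"

definition C2 :: "real \<Rightarrow> real" where
  "C2 r = 4 * B * (3 / (1 - r)\<^sup>2) * (3 / (1 - r)\<^sup>2) + 2 * B * (6 / (1 - r) ^ 3)"

lemma first_bound:
  assumes "norm x \<le> r" "r < 1"
  shows "norm (Df (mob x (Y \<omega>)) (mob_dx x (Y \<omega>) h)) \<le> C1 r * norm h"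
proof -
  have "2 * B * norm (mob_dx x (Y \<omega>) h) \<le> 2 * B * (3 / (1 - r)\<^sup>2 * norm h)"
    using B_nonneg by (intro mult_left_mono norm_mob_dx_le[OF assms Y]) auto
  thus ?thesis using norm_Df_le[of "mob x (Y \<omega>)" "mob_dx x (Y \<omega>) h"]
    by (simp add: C1_def mult.assoc)
qed

lemma second_bound:
  assumes "norm x \<le> r" "r < 1"
  shows "norm (hess (mob x (Y \<omega>)) (mob_dx x (Y \<omega>) h) (mob_dx x (Y \<omega>) l)
      + Df (mob x (Y \<omega>)) (mob_dxx x (Y \<omega>) h l)) \<le> C2 r * norm h * norm l"
proof -
  have "norm (hess (mob x (Y \<omega>)) (mob_dx x (Y \<omega>) h) (mob_dx x (Y \<omega>) l))
      \<le> 4 * B * norm (mob_dx x (Y \<omega>) h) * norm (mob_dx x (Y \<omega>) l)" by (rule norm_hess_le)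
  also have "\<dots> \<le> 4 * B * (3 / (1 - r)\<^sup>2 * norm h) * (3 / (1 - r)\<^sup>2 * norm l)"
    using B_nonneg by (intro mult_mono norm_mob_dx_le[OF assms Y]) auto
  finally have 1: "norm (hess (mob x (Y \<omega>)) (mob_dx x (Y \<omega>) h) (mob_dx x (Y \<omega>) l))
      \<le> 4 * B * (3 / (1 - r)\<^sup>2 * norm h) * (3 / (1 - r)\<^sup>2 * norm l)" .
  have "norm (Df (mob x (Y \<omega>)) (mob_dxx x (Y \<omega>) h l)) \<le> 2 * B * norm (mob_dxx x (Y \<omega>) h l)"
    by (rule norm_Df_le)
  also have "\<dots> \<le> 2 * B * (6 / (1 - r) ^ 3 * norm h * norm l)"
    using B_nonneg by (intro mult_left_mono norm_mob_dxx_le[OF assms Y]) auto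
  finally have "norm (hess (mob x (Y \<omega>)) (mob_dx x (Y \<omega>) h) (mob_dx x (Y \<omega>) l)
      + Df (mob x (Y \<omega>)) (mob_dxx x (Y \<omega>) h l))
    \<le> 4 * B * (3 / (1 - r)\<^sup>2 * norm h) * (3 / (1 - r)\<^sup>2 * norm l) + 2 * B * (6 / (1 - r) ^ 3 * norm h * norm l)"
    by (intro norm_triangle_le add_mono 1)
  thus ?thesis by (simp add: C2_def algebra_simps)
qed

text \<open>The derivative bounds blow up at the boundary of the disk, so differentiation under the
  integral takes place on a smaller ball, which is convex as required.\<close>

lemma disk_radius:
  assumes "x \<in> disk"
  obtains r where "x \<in> ball 0 r" "r < 1" "ball 0 r \<subseteq> disk"
proof
  show "x \<in> ball 0 ((norm x + 1) / 2)" "(norm x + 1) / 2 < 1" "ball 0 ((norm x + 1) / 2) \<subseteq> disk"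
    using assms by (auto simp: in_disk_iff)
qed

lemma u_derivative:
  assumes "x \<in> disk"
  shows "(u has_derivative du x) (at x)"
proof -
  obtain r where r: "x \<in> ball 0 r" "r < 1" "ball 0 r \<subseteq> disk" using assms by (rule disk_radius)
  show ?thesis unfolding u_def[abs_def] du_def[abs_def]
  proof (rule has_derivative_integral[where U = "ball 0 r" and g = "\<lambda>\<omega>. norm (k \<omega>) * C1 r"])
    fix y :: complex and \<omega> assume y: "y \<in> ball 0 r"
    have "((\<lambda>x. f (mob x (Y \<omega>))) has_derivative (\<lambda>h. Df (mob y (Y \<omega>)) (mob_dx y (Y \<omega>) h))) (at y)"
      using y r by (intro has_derivative_f_compose mob_has_derivative denom_nz) auto
    thus "((\<lambda>x. k \<omega> * f (mob x (Y \<omega>))) has_derivative (\<lambda>h. k \<omega> * Df (mob y (Y \<omega>)) (mob_dx y (Y \<omega>) h))) (at y)"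
      by (rule has_derivative_mult_right)
    show "norm (k \<omega> * Df (mob y (Y \<omega>)) (mob_dx y (Y \<omega>) h)) \<le> norm (k \<omega>) * C1 r * norm h" for h
      unfolding norm_mult[of "k _"] mult.assoc
      using y r by (intro mult_left_mono first_bound[unfolded mult.assoc]) auto
  next
    show "integrable M (\<lambda>\<omega>. k \<omega> * f (mob y (Y \<omega>)))" for y :: complex
      by (rule integrable_k_mult[OF _ bound(1)]) measurable
  qed (use r k in auto)
qed

lemma du_derivative:
  assumes "x \<in> disk"
  shows "((\<lambda>x. du x h) has_derivative ddu x h) (at x)"
proof -
  obtain r where r: "x \<in> ball 0 r" "r < 1" "ball 0 r \<subseteq> disk" using assms by (rule disk_radius)
  show ?thesis unfolding du_def[abs_def] ddu_def[abs_def]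
  proof (rule has_derivative_integral[where U = "ball 0 r" and g = "\<lambda>\<omega>. norm (k \<omega>) * (C2 r * norm h)"])
    fix y :: complex and \<omega> assume y: "y \<in> ball 0 r"
    have "((\<lambda>x. Df (mob x (Y \<omega>)) (mob_dx x (Y \<omega>) h)) has_derivative
        (\<lambda>l. hess (mob y (Y \<omega>)) (mob_dx y (Y \<omega>) h) (mob_dx y (Y \<omega>) l) + Df (mob y (Y \<omega>)) (mob_dxx y (Y \<omega>) h l))) (at y)"
      using y r by (intro has_derivative_Df mob_has_derivative mob_dx_has_derivative denom_nz) auto
    thus "((\<lambda>x. k \<omega> * Df (mob x (Y \<omega>)) (mob_dx x (Y \<omega>) h)) has_derivative
        (\<lambda>l. k \<omega> * (hess (mob y (Y \<omega>)) (mob_dx y (Y \<omega>) h) (mob_dx y (Y \<omega>) l) + Df (mob y (Y \<omega>)) (mob_dxx y (Y \<omega>) h l)))) (at y)"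
      by (rule has_derivative_mult_right)
    show "norm (k \<omega> * (hess (mob y (Y \<omega>)) (mob_dx y (Y \<omega>) h) (mob_dx y (Y \<omega>) l) + Df (mob y (Y \<omega>)) (mob_dxx y (Y \<omega>) h l)))
        \<le> norm (k \<omega>) * (C2 r * norm h) * norm l" for l
      unfolding norm_mult[of "k _"] mult.assoc
      using y r by (intro mult_left_mono second_bound[unfolded mult.assoc]) auto
  next
    show "integrable M (\<lambda>\<omega>. k \<omega> * Df (mob y (Y \<omega>)) (mob_dx y (Y \<omega>) h))" if "y \<in> ball 0 r" for y :: complex
      using that r(2) by (intro integrable_k_mult[where C = "C1 r * norm h"] first_bound) auto
  qed (use r k in auto)
qed

lemma continuous_on_ddu: "continuous_on disk (\<lambda>x. ddu x h l)"
proof -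
  have "isCont (\<lambda>x. ddu x h l) x" if x: "x \<in> disk" for x
  proof -
    obtain r where r: "x \<in> ball 0 r" "r < 1" "ball 0 r \<subseteq> disk" using x by (rule disk_radius)
    have "continuous_on (ball 0 r) (\<lambda>x. ddu x h l)"
      unfolding ddu_def
    proof (rule continuous_on_integral[where g = "\<lambda>\<omega>. norm (k \<omega>) * (C2 r * norm h * norm l)"])
      show "norm (k \<omega> * (hess (mob y (Y \<omega>)) (mob_dx y (Y \<omega>) h) (mob_dx y (Y \<omega>) l) + Df (mob y (Y \<omega>)) (mob_dxx y (Y \<omega>) h l)))
          \<le> norm (k \<omega>) * (C2 r * norm h * norm l)" if "y \<in> ball 0 r" for y :: complex and \<omega>
        unfolding norm_mult[of "k _"] using that r by (intro mult_left_mono second_bound) auto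
      show "continuous_on (ball 0 r) (\<lambda>y. k \<omega> * (hess (mob y (Y \<omega>)) (mob_dx y (Y \<omega>) h) (mob_dx y (Y \<omega>) l)
          + Df (mob y (Y \<omega>)) (mob_dxx y (Y \<omega>) h l)))" for \<omega>
        unfolding mob_def mob_dx_def mob_dxx_def
        using denom_nz[of _ \<omega>] r(3)
        by (intro continuous_intros continuous_on_hess continuous_on_Df) auto
    qed (use k in auto)
    thus ?thesis using r(1) by (simp add: continuous_on_eq_continuous_at)
  qed
  thus ?thesis by (simp add: continuous_on_eq_continuous_at open_disk)
qed

lemma average_derivative:
  assumes "\<And>x. x \<in> disk \<Longrightarrow> g x = u x" "x \<in> disk"
  shows "(g has_derivative du x) (at x)"
  by (rule has_derivative_transform_within_open[OF u_derivative[OF assms(2)] open_disk assms(2)])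
    (simp add: assms(1))

lemma Ck_on_2_average:
  assumes "\<And>x. x \<in> disk \<Longrightarrow> g x = u x"
  shows "Ck_on 2 g disk"
  by (rule Ck_on_2I[OF open_disk average_derivative[OF assms] du_derivative continuous_on_ddu])

text \<open>\<open>V\<close> is the angular derivative of \<open>laplacian_mob_identity\<close>
  without its factor s. The assumption that its weighted integral vanishes is all that is asked of
  the rotational symmetry of the weighted measure.\<close>

lemma laplace_beltrami_average:
  assumes g: "\<And>x. x \<in> disk \<Longrightarrow> g x = u x" and x: "x \<in> disk"
  defines "s \<equiv> complex_of_real (1 - (norm x)\<^sup>2)"
  defines "V \<equiv> \<lambda>y. hess (mob x y) (\<i> * mob x y) (s * \<i> * y / (1 + cnj x * y)\<^sup>2)
      + Df (mob x y) (\<i> * (s * \<i> * y / (1 + cnj x * y)\<^sup>2))"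
  assumes V: "integrable M (\<lambda>\<omega>. k \<omega> * V (Y \<omega>))" "(LINT \<omega>|M. k \<omega> * V (Y \<omega>)) = 0"
  shows "laplace_beltrami g x = (LINT \<omega>|M. k \<omega> * lap (mob x (Y \<omega>)))"
proof -
  have g': "(g has_derivative rlin (du y 1) (du y \<i>)) (at y)" if "y \<in> disk" for y
    using average_derivative[OF g that] bounded_linear_eq_rlin[of "du y"] has_derivative_bounded_linear by metis
  let ?G = "\<lambda>h \<omega>. hess (mob x (Y \<omega>)) (mob_dx x (Y \<omega>) h) (mob_dx x (Y \<omega>) h) + Df (mob x (Y \<omega>)) (mob_dxx x (Y \<omega>) h h)"
  have int: "integrable M (\<lambda>\<omega>. k \<omega> * ?G h \<omega>)" for h
    by (rule integrable_k_mult[OF _ second_bound[OF order_refl]]) (use x in \<open>auto simp: in_disk_iff\<close>)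
  have intl: "integrable M (\<lambda>\<omega>. k \<omega> * lap (mob x (Y \<omega>)))"
    by (rule integrable_k_mult[OF _ norm_lap_le]) (auto intro: mob_in_disk x Y)
  have "laplace_beltrami g x = of_real ((1 - (norm x)\<^sup>2)\<^sup>2 / 4) * (ddu x 1 1 + ddu x \<i> \<i>)"
    by (rule laplace_beltrami_eq[OF x g' du_derivative[OF x] du_derivative[OF x]])
  also have "of_real ((1 - (norm x)\<^sup>2)\<^sup>2 / 4) = s\<^sup>2 / 4" by (simp add: s_def)
  also have "s\<^sup>2 / 4 * (ddu x 1 1 + ddu x \<i> \<i>) = (LINT \<omega>|M. s\<^sup>2 / 4 * (k \<omega> * ?G 1 \<omega> + k \<omega> * ?G \<i> \<omega>))"
    using int[of 1] int[of \<i>] by (simp add: ddu_def)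
  also have "\<dots> = (LINT \<omega>|M. k \<omega> * lap (mob x (Y \<omega>)) + s * (k \<omega> * V (Y \<omega>)))"
  proof (rule Bochner_Integration.integral_cong[OF refl])
    fix \<omega>
    have "s\<^sup>2 / 4 * (k \<omega> * ?G 1 \<omega> + k \<omega> * ?G \<i> \<omega>) = k \<omega> * (s\<^sup>2 / 4 * (?G 1 \<omega> + ?G \<i> \<omega>))" by algebra
    also have "s\<^sup>2 / 4 * (?G 1 \<omega> + ?G \<i> \<omega>) = lap (mob x (Y \<omega>)) + s * V (Y \<omega>)"
      unfolding V_def s_def by (rule laplacian_mob_identity[OF x Y])
    finally show "s\<^sup>2 / 4 * (k \<omega> * ?G 1 \<omega> + k \<omega> * ?G \<i> \<omega>) = k \<omega> * lap (mob x (Y \<omega>)) + s * (k \<omega> * V (Y \<omega>))"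
      by (simp only: distrib_left mult.left_commute)
  qed
  also have "\<dots> = (LINT \<omega>|M. k \<omega> * lap (mob x (Y \<omega>)))"
    using intl V by simp
  finally show ?thesis .
qed

end

section \<open>The composition as a single average\<close>

text \<open>The two distances t, s carry the weights, the angles \<open>\<phi>\<close>,
  \<open>\<theta>\<close> the uniform measures. The last angle is the overall rotation and can be
  integrated first.\<close>

definition step_measure :: "((real \<times> real) \<times> (real \<times> real)) measure" where
  "step_measure = (lborel \<Otimes>\<^sub>M lborel) \<Otimes>\<^sub>M (circle \<Otimes>\<^sub>M circle)"

definition step_weight :: "complex \<Rightarrow> complex \<Rightarrow> (real \<times> real) \<times> (real \<times> real) \<Rightarrow> complex" where
  "step_weight w z \<omega> = wt w (fst (fst \<omega>)) * wt z (snd (fst \<omega>))"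

definition step_point :: "(real \<times> real) \<times> (real \<times> real) \<Rightarrow> complex" where
  "step_point \<omega> = two_step (fst (fst \<omega>)) (snd (fst \<omega>)) (fst (snd \<omega>)) (snd (snd \<omega>))"

lemma step_point_measurable: "step_point \<in> borel_measurable step_measure"
  unfolding step_measure_def step_point_def[abs_def] by measurable

lemma integral_step_measure:
  fixes H :: "complex \<Rightarrow> complex"
  assumes w: "Re w > 0" and z: "Re z > 0"
    and H: "continuous_on disk H" "\<And>y. y \<in> disk \<Longrightarrow> norm (H y) \<le> C"
  shows "integrable step_measure (\<lambda>\<omega>. step_weight w z \<omega> * H (step_point \<omega>))"
    and "(LINT \<omega>|step_measure. step_weight w z \<omega> * H (step_point \<omega>))
      = (LINT t|lborel. wt w t * (LINT s|lborel. wt z s * (LINT \<phi>|circle. LINT \<theta>|circle. H (two_step t s \<phi> \<theta>))))"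
proof -
  interpret Q: pair_sigma_finite "lborel \<Otimes>\<^sub>M lborel :: (real \<times> real) measure" "circle \<Otimes>\<^sub>M circle"
    by (intro pair_sigma_finite.intro sigma_finite_pair lborel.sigma_finite_measure_axioms sigma_finite_circle)
  note [measurable] = zero_ext_measurable[OF H(1)]
  note b = zero_ext_bound[OF H(2)]
  have ext: "H (two_step t s \<phi> \<theta>) = zero_ext H (two_step t s \<phi> \<theta>)" for t s \<phi> \<theta>
    by (simp add: zero_ext_def two_step_in_disk)
  let ?wt = "\<lambda>p. wt w (fst p) * wt z (snd p)"
  have kw: "integrable (lborel \<Otimes>\<^sub>M lborel) ?wt"
    by (intro integrable_pair_mult lborel.sigma_finite_measure_axioms integrable_wt w z)
  have one: "integrable (circle \<Otimes>\<^sub>M circle) (\<lambda>q. complex_of_real C)"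
    using integrable_pair_mult[OF sigma_finite_circle sigma_finite_circle, of "\<lambda>_. complex_of_real C" "\<lambda>_. 1"] by simp
  have "integrable step_measure (\<lambda>\<omega>. step_weight w z \<omega> * of_real C)"
    unfolding step_measure_def step_weight_def
    by (rule integrable_pair_mult[OF sigma_finite_pair[OF lborel.sigma_finite_measure_axioms lborel.sigma_finite_measure_axioms]
          sigma_finite_pair[OF sigma_finite_circle sigma_finite_circle] kw one])
  thus 1: "integrable step_measure (\<lambda>\<omega>. step_weight w z \<omega> * H (step_point \<omega>))"
  proof (rule Bochner_Integration.integrable_bound)
    show "(\<lambda>\<omega>. step_weight w z \<omega> * H (step_point \<omega>)) \<in> borel_measurable step_measure"
      unfolding step_measure_def step_weight_def step_point_def ext by measurable
    show "AE \<omega> in step_measure. norm (step_weight w z \<omega> * H (step_point \<omega>)) \<le> norm (step_weight w z \<omega> * complex_of_real C)"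
      unfolding norm_mult norm_of_real step_point_def ext
      by (intro AE_I2 mult_left_mono order_trans[OF b abs_ge_self] norm_ge_zero)
  qed
  let ?K = "\<lambda>p. LINT \<phi>|circle. LINT \<theta>|circle. H (two_step (fst p) (snd p) \<phi> \<theta>)"
  have inner: "(LINT q|(circle \<Otimes>\<^sub>M circle). step_weight w z (p, q) * H (step_point (p, q))) = ?wt p * ?K p" for p
  proof -
    have i: "integrable (circle \<Otimes>\<^sub>M circle) (\<lambda>q. zero_ext H (two_step (fst p) (snd p) (fst q) (snd q)))"
      by (rule fubini_circle_circle(1)[of "\<lambda>\<phi> \<theta>. zero_ext H (two_step (fst p) (snd p) \<phi> \<theta>)", OF _ b]) measurable
    show ?thesis using circle_circle.integral_fst'[OF i]
      by (simp add: step_weight_def step_point_def ext)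
  qed
  have "(LINT \<omega>|step_measure. step_weight w z \<omega> * H (step_point \<omega>)) = (LINT p|(lborel \<Otimes>\<^sub>M lborel). ?wt p * ?K p)"
    using Q.integral_fst'[OF 1[unfolded step_measure_def]] unfolding inner step_measure_def by simp
  moreover have "integrable (lborel \<Otimes>\<^sub>M lborel) (\<lambda>p. ?wt p * ?K p)"
    using Q.integrable_fst'[OF 1[unfolded step_measure_def]] unfolding inner by simp
  from lborel_pair.integral_fst'[OF this]
  have "(LINT p|(lborel \<Otimes>\<^sub>M lborel). ?wt p * ?K p)
      = (LINT t|lborel. LINT s|lborel. wt w t * wt z s * ?K (t, s))" by simp
  ultimately show "(LINT \<omega>|step_measure. step_weight w z \<omega> * H (step_point \<omega>))
      = (LINT t|lborel. wt w t * (LINT s|lborel. wt z s * (LINT \<phi>|circle. LINT \<theta>|circle. H (two_step t s \<phi> \<theta>))))"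
    by (simp add: mult.assoc)
qed

lemma radial_op_radial_op_eq_average:
  assumes w: "Re w > 0" and z: "Re z > 0" and x: "x \<in> disk"
    and h: "continuous_on disk h" "\<And>y. y \<in> disk \<Longrightarrow> norm (h y) \<le> B"
  shows "radial_op w (radial_op z h) x = (LINT \<omega>|step_measure. step_weight w z \<omega> * h (mob x (step_point \<omega>)))"
proof -
  have c: "continuous_on disk (\<lambda>y. h (mob x y))"
    by (rule continuous_on_compose2[OF h(1)])
      (auto intro!: continuous_on_mob continuous_intros mob_in_disk x)
  have "radial_op w (radial_op z h) x = (LINT t|lborel. wt w t * (LINT s|lborel. wt z s *
      (LINT \<phi>|circle. LINT \<theta>|circle. h (mob x (two_step t s \<phi> \<theta>)))))"
    by (simp add: radial_op_radial_op[OF w z x h] two_step_mean_def)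
  also have "\<dots> = (LINT \<omega>|step_measure. step_weight w z \<omega> * h (mob x (step_point \<omega>)))"
    by (rule integral_step_measure(2)[OF w z c h(2)[OF mob_in_disk[OF x]], symmetric])
  finally show ?thesis .
qed

context C2_bounded begin

text \<open>Taking the Laplacian under the average replaces f by \<open>lap\<close> there; by
  linearity the left side then becomes -2 times the expression of
  \<open>radial_op_resolvent\<close>.\<close>

lemma laplace_beltrami_radial_op:
  assumes z: "Re z > 0" and g: "\<And>x. x \<in> disk \<Longrightarrow> g x = 2 * radial_op (z + 1) (radial_op z f) x"
  shows "Ck_on 2 g disk"
    and "x \<in> disk \<Longrightarrow> laplace_beltrami g x - z * (z + 1) * g x = - 8 * pi\<^sup>2 * f x"
proof -
  have z1: "Re (z + 1) > 0" using z by simp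
  have fc: "continuous_on disk f" "continuous_on disk lap"
    using cont(1) continuous_on_lap[OF continuous_on_id] continuous_on_subset by blast+
  \<comment> \<open>The factor 2 is the one between \<open>Pi0\<close> and
    \<open>radial_op\<close>.\<close>
  define k where "k \<omega> = 2 * step_weight (z + 1) z \<omega>" for \<omega>
  interpret av: mob_average f f1 f2 f11 f12 f21 f22 B step_measure k step_point
  proof unfold_locales
    show "integrable step_measure k"
      using integral_step_measure(1)[OF z1 z, of "\<lambda>_. 2" 2] by (simp add: k_def[abs_def] mult.commute)
  qed (auto simp: step_point_measurable step_point_def two_step_in_disk)
  have avg: "2 * radial_op (z + 1) (radial_op z h) x = (LINT \<omega>|step_measure. k \<omega> * h (mob x (step_point \<omega>)))"
    if "continuous_on disk h" "\<And>y. y \<in> disk \<Longrightarrow> norm (h y) \<le> C" "x \<in> disk" for h C x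
    using radial_op_radial_op_eq_average[OF z1 z that(3) that(1) that(2)] by (simp add: k_def mult.assoc)
  have gu: "g x = av.u x" if "x \<in> disk" for x
    unfolding g[OF that] av.u_def by (rule avg[OF fc(1) bound(1) that])
  show "Ck_on 2 g disk" by (rule av.Ck_on_2_average[OF gu])
  assume x: "x \<in> disk"
  define s where "s = complex_of_real (1 - (norm x)\<^sup>2)"
  define V where "V y = hess (mob x y) (\<i> * mob x y) (s * \<i> * y / (1 + cnj x * y)\<^sup>2)
      + Df (mob x y) (\<i> * (s * \<i> * y / (1 + cnj x * y)\<^sup>2))" for y
  have mobc: "continuous_on S (\<lambda>p. mob x (b p))" if "continuous_on S b" "\<And>p. p \<in> S \<Longrightarrow> b p \<in> disk"
    for b and S :: "'c::topological_space set"
    using that x by (intro continuous_on_mob continuous_intros)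
  have denom: "1 + cnj x * y \<noteq> 0" if "y \<in> disk" for y
    using mob_denom_nz[OF x, of y] that by (simp add: in_disk_iff)
  have Vc: "continuous_on S (\<lambda>p. V (b p))" if "continuous_on S b" "\<And>p. p \<in> S \<Longrightarrow> b p \<in> disk"
    for b and S :: "'c::topological_space set"
    unfolding V_def using that denom
    by (intro continuous_intros continuous_on_hess continuous_on_Df mobc) auto
  obtain CV where CV: "\<And>y. y \<in> disk \<Longrightarrow> norm (V y) \<le> CV"
  proof
    fix y assume y: "y \<in> disk"
    let ?d = "s * \<i> * y / (1 + cnj x * y)\<^sup>2"
    have "norm ?d \<le> 1 / (1 - norm x)\<^sup>2"
    proof -
      have "\<bar>1 - (norm x)\<^sup>2\<bar> * norm y \<le> 1 * 1"
        using one_minus_norm_sq_pos[OF x] y by (intro mult_mono) (auto simp: in_disk_iff)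
      moreover have "norm s = \<bar>1 - (norm x)\<^sup>2\<bar>" unfolding s_def norm_of_real ..
      moreover have "1 - norm x \<le> norm (1 + cnj x * y)"
        using x y by (intro norm_mob_denom_ge) (auto simp: in_disk_iff)
      ultimately show ?thesis using x unfolding norm_divide norm_mult norm_power
        by (intro frac_le power_mono) (auto simp: in_disk_iff)
    qed
    moreover have "norm (mob x y) \<le> 1" using mob_in_disk[OF x y] by (simp add: in_disk_iff)
    moreover have "norm (V y) \<le> 4 * B * norm (\<i> * mob x y) * norm ?d + 2 * B * norm (\<i> * ?d)"
      unfolding V_def by (intro norm_triangle_le add_mono norm_hess_le norm_Df_le)
    ultimately show "norm (V y) \<le> 4 * B * 1 * (1 / (1 - norm x)\<^sup>2) + 2 * B * (1 / (1 - norm x)\<^sup>2)"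
      using B_nonneg
      by (elim order_trans, unfold norm_mult[of \<i>] norm_ii mult_1_left) (intro add_mono mult_mono mult_left_mono; simp)
  qed
  have Vd: "continuous_on disk V" using Vc[of disk "\<lambda>y. y"] by simp
  note I = integral_step_measure[OF z1 z Vd CV]
  \<comment> \<open>For a fixed shape of the walk the end point moves on a circle about 0 as
    \<open>\<theta>\<close> varies, and \<open>V\<close> is the derivative of a periodic function
    along it.\<close>
  have "(LINT \<theta>|circle. V (cis \<theta> * c)) = 0" if c: "c \<in> disk" for c
  proof -
    have cd: "cis \<theta> * c \<in> disk" for \<theta> using c by (simp add: in_disk_iff norm_mult)
    let ?W = "\<lambda>\<theta>. mob x (cis \<theta> * c)"
    have "(LINT \<theta>|circle. V (cis \<theta> * c)) = Df (?W (2*pi)) (\<i> * ?W (2*pi)) - Df (?W 0) (\<i> * ?W 0)"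
    proof (rule integral_circle_derivative)
      show "((\<lambda>\<theta>. Df (?W \<theta>) (\<i> * ?W \<theta>)) has_vector_derivative V (cis \<theta> * c)) (at \<theta>)" for \<theta>
        unfolding V_def s_def
        by (intro has_vector_derivative_Df has_vector_derivative_mult_right mob_rotate_derivative x c)
      show "continuous_on UNIV (\<lambda>\<theta>. V (cis \<theta> * c))"
        by (rule Vc) (use cd in \<open>auto intro!: continuous_intros\<close>)
    qed
    thus ?thesis by simp
  qed
  hence "(LINT \<theta>|circle. V (two_step t s \<phi> \<theta>)) = 0" for t s \<phi>
    unfolding two_step_def using mob_tau_cis_in_disk[OF of_real_tau_in_disk] by blast
  hence V0: "(LINT \<omega>|step_measure. step_weight (z + 1) z \<omega> * V (step_point \<omega>)) = 0"
    by (simp add: I(2))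
  have "laplace_beltrami g x = (LINT \<omega>|step_measure. k \<omega> * lap (mob x (step_point \<omega>)))"
  proof (rule av.laplace_beltrami_average[OF gu x])
    show "integrable step_measure (\<lambda>\<omega>. k \<omega> * (hess (mob x (step_point \<omega>)) (\<i> * mob x (step_point \<omega>))
        (complex_of_real (1 - (norm x)\<^sup>2) * \<i> * step_point \<omega> / (1 + cnj x * step_point \<omega>)\<^sup>2)
      + Df (mob x (step_point \<omega>)) (\<i> * (complex_of_real (1 - (norm x)\<^sup>2) * \<i> * step_point \<omega> / (1 + cnj x * step_point \<omega>)\<^sup>2))))"
      using integrable_mult_right[OF I(1), of 2]
      unfolding k_def V_def[symmetric] s_def[symmetric] by (simp add: mult.assoc)
    show "(LINT \<omega>|step_measure. k \<omega> * (hess (mob x (step_point \<omega>)) (\<i> * mob x (step_point \<omega>))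
        (complex_of_real (1 - (norm x)\<^sup>2) * \<i> * step_point \<omega> / (1 + cnj x * step_point \<omega>)\<^sup>2)
      + Df (mob x (step_point \<omega>)) (\<i> * (complex_of_real (1 - (norm x)\<^sup>2) * \<i> * step_point \<omega> / (1 + cnj x * step_point \<omega>)\<^sup>2)))) = 0"
      using V0 unfolding k_def V_def[symmetric] s_def[symmetric] by (simp add: mult.assoc)
  qed
  also have "\<dots> = 2 * radial_op (z + 1) (radial_op z lap) x"
    by (rule avg[OF fc(2) norm_lap_le x, symmetric])
  finally have lg: "laplace_beltrami g x = 2 * radial_op (z + 1) (radial_op z lap) x" .
  have "4 * pi\<^sup>2 * f x = radial_op (z + 1) (radial_op z (\<lambda>w. z * (z + 1) * f w - lap w)) x"
    by (rule radial_op_resolvent[OF z x, symmetric])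
  also have "\<dots> = radial_op (z + 1) (\<lambda>y. (z * (z + 1)) * radial_op z f y + (- 1) * radial_op z lap y) x"
  proof (rule radial_op_cong[OF x])
    fix y assume y: "y \<in> disk"
    show "radial_op z (\<lambda>w. z * (z + 1) * f w - lap w) y = (z * (z + 1)) * radial_op z f y + (- 1) * radial_op z lap y"
      using radial_op_linear[OF z y fc(1) bound(1) fc(2) norm_lap_le, of "z * (z + 1)" "-1"] by simp
  qed
  also have "\<dots> = (z * (z + 1)) * radial_op (z + 1) (radial_op z f) x + (- 1) * radial_op (z + 1) (radial_op z lap) x"
    by (rule radial_op_linear[OF z1 x continuous_on_radial_op[OF z fc(1) bound(1)] norm_radial_op_le[OF z bound(1)]
          continuous_on_radial_op[OF z fc(2) norm_lap_le] norm_radial_op_le[OF z norm_lap_le]])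
  finally have "2 * (4 * pi\<^sup>2 * f x) = 2 * ((z * (z + 1)) * radial_op (z + 1) (radial_op z f) x
      + (- 1) * radial_op (z + 1) (radial_op z lap) x)" by (simp only:)
  thus "laplace_beltrami g x - z * (z + 1) * g x = - 8 * pi\<^sup>2 * f x"
    unfolding lg g[OF x] by (simp add: algebra_simps)
qed

end

section \<open>Extension by zero\<close>

text \<open>The disk and the complement of C are open and cover the plane, and on the second the
  extension is identically 0.\<close>

lemma zero_ext_compact_support:
  assumes C: "compact C" "C \<subseteq> disk" and g: "continuous_on disk g" "\<And>x. x \<in> disk - C \<Longrightarrow> g x = 0"
  shows "continuous_on UNIV (zero_ext g)" and "bounded (range (zero_ext g))"
proof -
  have oc: "open (- C)" using C(1) compact_imp_closed open_Compl by blast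
  have "continuous_on disk (zero_ext g)"
    using g(1) by (rule continuous_on_eq) (simp add: zero_ext_def)
  moreover have "continuous_on (- C) (zero_ext g)"
    using continuous_on_const[of "- C" 0] by (rule continuous_on_eq) (use g(2) in \<open>auto simp: zero_ext_def\<close>)
  ultimately have "continuous_on (disk \<union> - C) (zero_ext g)"
    by (intro continuous_on_open_Un open_disk oc)
  moreover have "disk \<union> - C = UNIV" using C(2) by auto
  ultimately show "continuous_on UNIV (zero_ext g)" by simp
  have "bounded (insert 0 (g ` C))"
    by (simp add: compact_imp_bounded compact_continuous_image continuous_on_subset[OF g(1) C(2)] C(1))
  moreover have "range (zero_ext g) \<subseteq> insert 0 (g ` C)" using g(2) by (auto simp: zero_ext_def)
  ultimately show "bounded (range (zero_ext g))"
    by (rule bounded_subset)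
qed

text \<open>The second claim makes the first repeatable: directional derivatives again vanish off C,
  so they can be extended in the same way.\<close>

lemma zero_ext_derivative:
  assumes C: "compact C" "C \<subseteq> disk" and g: "\<And>x. x \<in> disk \<Longrightarrow> g differentiable (at x)" "\<And>x. x \<in> disk - C \<Longrightarrow> g x = 0"
  defines "d \<equiv> \<lambda>v x. frechet_derivative g (at x) v"
  shows "(zero_ext g has_derivative rlin (zero_ext (d 1) w) (zero_ext (d \<i>) w)) (at w)"
    and "x \<in> disk - C \<Longrightarrow> d v x = 0"
proof -
  have oc: "open (- C)" using C(1) compact_imp_closed open_Compl by blast
  have zero: "d v x = 0" if "x \<in> disk - C" for x v
  proof -
    have "(g has_derivative (\<lambda>h. 0)) (at x)"
      by (rule has_derivative_transform_within_open[of "\<lambda>_. 0" _ _ UNIV "disk - C"])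
        (use that g(2) open_disk C(1) in \<open>auto intro: open_Diff compact_imp_closed\<close>)
    from frechet_derivative_at[OF this] show ?thesis unfolding d_def by metis
  qed
  show "x \<in> disk - C \<Longrightarrow> d v x = 0" by (rule zero)
  show "(zero_ext g has_derivative rlin (zero_ext (d 1) w) (zero_ext (d \<i>) w)) (at w)"
  proof (cases "w \<in> disk")
    case True
    have gd: "(g has_derivative frechet_derivative g (at w)) (at w)"
      using g(1)[OF True] by (simp add: frechet_derivative_works)
    have "(g has_derivative rlin (d 1 w) (d \<i> w)) (at w)"
      using gd bounded_linear_eq_rlin[OF has_derivative_bounded_linear[OF gd]] unfolding d_def by simp
    hence "(zero_ext g has_derivative rlin (d 1 w) (d \<i> w)) (at w)"
      by (rule has_derivative_transform_within_open[OF _ open_disk True]) (simp add: zero_ext_def)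
    thus ?thesis using True by (simp add: zero_ext_def)
  next
    case False
    have "rlin 0 0 = (\<lambda>h. 0)" by (simp add: rlin_def fun_eq_iff)
    moreover have "(zero_ext g has_derivative (\<lambda>h. 0)) (at w)"
      by (rule has_derivative_transform_within_open[OF has_derivative_const oc])
        (use False C(2) g(2) in \<open>auto simp: zero_ext_def\<close>)
    ultimately show ?thesis using False by (simp add: zero_ext_def)
  qed
qed

lemma Cc_infinity_C2_bounded:
  assumes "Cc_infinity f"
  obtains f1 f2 f11 f12 f21 f22 B where "C2_bounded (zero_ext f) f1 f2 f11 f12 f21 f22 B"
proof -
  define C where "C = disk \<inter> closure {x \<in> disk. f x \<noteq> 0}"
  have C: "compact C" "C \<subseteq> disk" using assms by (auto simp: Cc_infinity_def C_def)
  have f0: "f x = 0" if "x \<in> disk - C" for x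
    using that closure_subset[of "{x \<in> disk. f x \<noteq> 0}"] by (auto simp: C_def)
  have "Ck_on (Suc (Suc 0)) f disk" using assms by (simp add: Cc_infinity_def)
  hence f: "\<And>x. x \<in> disk \<Longrightarrow> f differentiable (at x)"
    and df: "\<And>v x. x \<in> disk \<Longrightarrow> (\<lambda>x. frechet_derivative f (at x) v) differentiable (at x)"
    and ddf: "\<And>v w. continuous_on disk (\<lambda>x. frechet_derivative (\<lambda>x. frechet_derivative f (at x) v) (at x) w)"
    by simp_all
  define d where "d v x = frechet_derivative f (at x) v" for v x
  define dd where "dd v w x = frechet_derivative (d v) (at x) w" for v w x
  have d0: "d v x = 0" if "x \<in> disk - C" for v x
    unfolding d_def by (rule zero_ext_derivative(2)[OF C f f0 that])
  have dd0: "dd v w x = 0" if "x \<in> disk - C" for v w x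
    unfolding dd_def by (rule zero_ext_derivative(2)[OF C _ d0 that]) (use df in \<open>simp add: d_def[abs_def]\<close>)
  have fc: "continuous_on disk f"
    using f differentiable_imp_continuous_within by (auto simp: continuous_on_eq_continuous_at open_disk)
  have dc: "continuous_on disk (d v)" for v
    using df[of _ v] differentiable_imp_continuous_within
    unfolding d_def[abs_def] by (auto simp: continuous_on_eq_continuous_at open_disk)
  have ddc: "continuous_on disk (dd v w)" for v w
    using ddf[of v w] by (simp add: dd_def[abs_def] d_def[abs_def])
  have bdd: "bounded (range (zero_ext f) \<union> range (zero_ext (d 1)) \<union> range (zero_ext (d \<i>)) \<union>
      range (zero_ext (dd 1 1)) \<union> range (zero_ext (dd 1 \<i>)) \<union> range (zero_ext (dd \<i> 1)) \<union> range (zero_ext (dd \<i> \<i>)))"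
    by (intro bounded_Un[THEN iffD2] conjI zero_ext_compact_support(2)[OF C] fc dc ddc f0 d0 dd0)
  then obtain B where B: "\<And>y. y \<in> range (zero_ext f) \<union> range (zero_ext (d 1)) \<union> range (zero_ext (d \<i>)) \<union>
      range (zero_ext (dd 1 1)) \<union> range (zero_ext (dd 1 \<i>)) \<union> range (zero_ext (dd \<i> 1)) \<union> range (zero_ext (dd \<i> \<i>))
      \<Longrightarrow> norm y \<le> B"
    unfolding bounded_iff by blast
  have d1: "(zero_ext f has_derivative rlin (zero_ext (d 1) w) (zero_ext (d \<i>) w)) (at w)" for w
    using zero_ext_derivative(1)[OF C f f0, of w] by (simp add: d_def[abs_def])
  have d2: "(zero_ext (d v) has_derivative rlin (zero_ext (dd v 1) w) (zero_ext (dd v \<i>) w)) (at w)" for v w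
    unfolding dd_def[abs_def]
    by (rule zero_ext_derivative(1)[OF C _ d0]) (use df in \<open>simp add: d_def[abs_def]\<close>)
  have "C2_bounded (zero_ext f) (zero_ext (d 1)) (zero_ext (d \<i>)) (zero_ext (dd 1 1)) (zero_ext (dd 1 \<i>))
      (zero_ext (dd \<i> 1)) (zero_ext (dd \<i> \<i>)) B"
    by unfold_locales
      (auto intro!: d1 d2 B zero_ext_compact_support(1)[OF C] ddc dd0)
  thus ?thesis by (rule that)
qed

section \<open>The resolvent formula for compactly supported functions\<close>

theorem theorem2:
  fixes f :: "complex \<Rightarrow> complex" and z :: complex
  assumes "Cc_infinity f"
    and "Re z > 0"
  shows "(\<forall>x\<in>disk. Pi0_converges z f x \<and> S_converges z (Pi0 z f) x) \<and>
         Ck_on 2 (S_op z (Pi0 z f)) disk \<and>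
         (\<forall>x\<in>disk. laplace_beltrami (S_op z (Pi0 z f)) x - z * (z + 1) * S_op z (Pi0 z f) x
                     = - 8 * of_real pi ^ 2 * f x)"
proof -
  obtain f1 f2 f11 f12 f21 f22 B where "C2_bounded (zero_ext f) f1 f2 f11 f12 f21 f22 B"
    using assms(1) by (rule Cc_infinity_C2_bounded)
  then interpret F: C2_bounded "zero_ext f" f1 f2 f11 f12 f21 f22 B .
  note z = assms(2)
  have ext: "zero_ext f x = f x" if "x \<in> disk" for x using that by (simp add: zero_ext_def)
  have fc: "continuous_on disk f"
    using continuous_on_subset[OF F.cont(1) subset_UNIV] by (rule continuous_on_eq) (rule ext)
  have fb: "norm (f x) \<le> B" if "x \<in> disk" for x using F.bound(1)[of x] ext[OF that] by simp
  note P = Pi0_eq_radial_op[OF _ fc fb z]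
  have Peq: "Pi0 z f x = 2 * radial_op z (zero_ext f) x" if "x \<in> disk" for x
    using P(2)[OF that] radial_op_cong[OF that ext] by simp
  have rc: "continuous_on disk (radial_op z (zero_ext f))"
    by (rule continuous_on_radial_op[OF z continuous_on_subset[OF F.cont(1) subset_UNIV] F.bound(1)])
  have rb: "norm (radial_op z (zero_ext f) x) \<le> 2 * pi * B / Re z" if "x \<in> disk" for x
    by (rule norm_radial_op_le[OF z F.bound(1) that])
  \<comment> \<open>\<open>Pi0 z f\<close> no longer has compact support; continuity and boundedness
    are what the convergence of \<open>S_op\<close> relies on.\<close>
  have Pc: "continuous_on disk (Pi0 z f)"
    using continuous_on_mult_left[OF rc, of 2] by (rule continuous_on_eq) (rule Peq[symmetric])
  have Pb: "norm (Pi0 z f x) \<le> 2 * (2 * pi * B / Re z)" if "x \<in> disk" for x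
    using rb[OF that] Peq[OF that] by (simp add: norm_mult)
  have z': "Re z > - 1" "Re (z + 1) > 0" using z by auto
  note S = S_op_eq_radial_op[OF _ Pc Pb z'(1)]
  have Seq: "S_op z (Pi0 z f) x = 2 * radial_op (z + 1) (radial_op z (zero_ext f)) x" if "x \<in> disk" for x
  proof -
    \<comment> \<open>The summand with coefficient 0 brings a scalar multiple into the shape of
      \<open>radial_op_linear\<close>.\<close>
    have "S_op z (Pi0 z f) x = radial_op (z + 1) (\<lambda>y. 2 * radial_op z (zero_ext f) y + 0 * radial_op z (zero_ext f) y) x"
      using S(2)[OF that] radial_op_cong[OF that Peq] by simp
    also have "\<dots> = 2 * radial_op (z + 1) (radial_op z (zero_ext f)) x + 0 * radial_op (z + 1) (radial_op z (zero_ext f)) x"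
      by (rule radial_op_linear[OF z'(2) that rc rb rc rb])
    finally show ?thesis by simp
  qed
  show ?thesis
    using P(1) S(1) F.laplace_beltrami_radial_op[OF z Seq] ext by simp
qed

end
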